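(* Let $X_1,\dots,X_n$ be random functions satisfying Assumption 1 (written out in the context). Then, as $n\to\infty$: (i) For all $t\in[0,1]$, $$\sqrt n\{\bar X(t)-\mu(t)\}=\sum_r\Big\{\frac1{\sqrt n}\sum_{i=1}^n\beta_{ri}\Big\}\gamma_r(t)\ \xrightarrow{\mathcal L}\ N\Big(0,\sum_r\lambda_r\gamma_r(t)^2\Big).$$ If, furthermore, $\lambda_{r-1}>\lambda_r>\lambda_{r+1}$ holds for some fixed $r\in\{1,2,\dots\}$, then (ii) $$\sqrt n(\hat\lambda_r-\lambda_r)=\frac1{\sqrt n}\sum_{i=1}^n(\beta_{ri}^2-\lambda_r)+O_p(n^{-1/2})\ \xrightarrow{\mathcal L}\ N(0,\Lambda_r),\qquad \Lambda_r=E[(\beta_{ri}^2-\lambda_r)^2],$$ (iii) and for all $t\in[0,1]$ $$\hat\gamma_r(t)-\gamma_r(t)=\sum_{s\ne r}\Big\{\frac1{n(\lambda_r-\lambda_s)}\sum_{i=1}^n\beta_{si}\beta_{ri}\Big\}\gamma_s(t)+R_r(t),\qquad\text{where }\|R_r\|=O_p(n^{-1}).$$ Moreover, for all $t\in[0,1]$, $$\sqrt n\sum_{s\ne r}\Big\{\frac1{n(\lambda_r-\lambda_s)}\sum_{i=1}^n\beta_{si}\beta_{ri}\Big\}\gamma_s(t)\ \xrightarrow{\mathcal L}\ N\Big(0,\sum_{q\ne r}\sum_{s\ne r}\frac{E[\beta_{ri}^2\beta_{qi}\beta_{si}]}{(\lambda_q-\lambda_r)(\lambda_s-\lambda_r)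}\gamma_q(t)\gamma_s(t)\Big).$$
   Context: $\langle v,w\rangle=\int_0^1 v(t)w(t)\,dt$ and $\|v\|=\langle v,v\rangle^{1/2}$ on $L^2[0,1]$; $\mathbb N=\{1,2,\dots\}$; $\xrightarrow{\mathcal L}$ denotes convergence in distribution. **Assumption 1.** $X_1,\dots,X_n\in L^2[0,1]$ is an i.i.d. sample of random functions with mean function $\mu=E(X_i)$ and continuous covariance function $\sigma(t,s)=E[\{X_i(t)-\mu(t)\}\{X_i(s)-\mu(s)\}]$. Let $\lambda_1\ge\lambda_2\ge\cdots$ and $\gamma_1,\gamma_2,\dots$ be the eigenvalues and a corresponding complete orthonormal basis of eigenfunctions of the covariance operator $(\Gamma v)(t)=\int_0^1\sigma(t,s)v(s)\,ds$. The Karhunen–Loève expansion $X_i=\mu+\sum_{r=1}^\infty\beta_{ri}\gamma_r$ holds, with $\beta_{ri}=\langle X_i-\mu,\gamma_r\rangle$ (so $E\beta_{ri}=0$, $E\beta_{ri}^2=\lambda_r$, $E\beta_{ri}\beta_{si}=0$ for $r\ne s$), for a system of eigenfunctions satisfying $\sup_{s\in\mathbb N}\sup_{t\in[0,1]}|\gamma_s(t)|<\infty$. Furthermore $\sum_{r=1}^\infty\sum_{s=1}^\infty E[\beta_{ri}^2\beta_{si}^2]<\infty$ and $\sum_{q=1}^\infty\sum_{s=1}^\infty E[\beta_{ri}^2\beta_{qi}\beta_{si}]<\infty$ for all $r\in\mathbb N$. **Empirical quantities.** $\bar X=n^{-1}\sum_iX_i$, $\hat\sigma(t,s)=n^{-1}\sum_{i}\{X_i(t)-\bar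 X(t)\}\{X_i(s)-\bar X(s)\}$; $\hat\lambda_1\ge\hat\lambda_2\ge\cdots$ and $\hat\gamma_1,\hat\gamma_2,\dots$ are the eigenvalues and corresponding orthonormal eigenfunctions of the empirical covariance operator $(\hat\Gamma_nv)(t)=\int_0^1\hat\sigma(t,s)v(s)\,ds$. **Conventions.** For $r=1$ the condition $\lambda_{r-1}>\lambda_r$ is void. Eigenfunctions are determined only up to sign, and signs are chosen such that $\langle\gamma_r,\hat\gamma_r\rangle\ge0$. *)

theory Defs
  imports "HOL-Probability.Probability"
begin

text \<open>
  Functions on the unit interval are represented by total functions on the reals, of which only
  the values on \<open>{0..1}\<close> matter. They are not identified when equal almost everywhere, because
  the results concern values at individual points.
\<close>

abbreviation unit_leb :: "real measure" where
  "unit_leb \<equiv> lebesgue_on {0..1}"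

definition L2 :: "(real \<Rightarrow> real) set" where
  "L2 = {v \<in> borel_measurable unit_leb. integrable unit_leb (\<lambda>t. (v t)\<^sup>2)}"

definition ip :: "(real \<Rightarrow> real) \<Rightarrow> (real \<Rightarrow> real) \<Rightarrow> real" where
  "ip v w = (\<integral>t. v t * w t \<partial>unit_leb)"

definition l2norm :: "(real \<Rightarrow> real) \<Rightarrow> real" where
  "l2norm v = sqrt (ip v v)"

definition int_op :: "(real \<Rightarrow> real \<Rightarrow> real) \<Rightarrow> (real \<Rightarrow> real) \<Rightarrow> real \<Rightarrow> real" where
  "int_op k v t = (\<integral>s. k t s * v s \<partial>unit_leb)"

definition eigenfunction :: "(real \<Rightarrow> real \<Rightarrow> real) \<Rightarrow> real \<Rightarrow> (real \<Rightarrow> real) \<Rightarrow> bool" where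
  "eigenfunction k \<rho> v \<longleftrightarrow>
     v \<in> L2 \<and> \<not> (AE t in unit_leb. v t = 0) \<and> (\<forall>t\<in>{0..1}. int_op k v t = \<rho> * v t)"

text \<open>
  Sequences are indexed from 1; the entry at index 0 is irrelevant. The last clause says that
  every nonzero eigenvalue is listed with its full multiplicity: no eigenfunction for a nonzero
  eigenvalue is orthogonal to all listed ones. The eigenvalue 0 may be listed any number of times.
\<close>

definition eigensystem ::
  "(real \<Rightarrow> real \<Rightarrow> real) \<Rightarrow> (nat \<Rightarrow> real) \<Rightarrow> (nat \<Rightarrow> real \<Rightarrow> real) \<Rightarrow> bool" where
  "eigensystem k lam gam \<longleftrightarrow>
     (\<forall>r\<ge>1. lam (r + 1) \<le> lam r) \<and>
     (\<forall>r\<ge>1. eigenfunction k (lam r) (gam r)) \<and>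
     (\<forall>r\<ge>1. \<forall>s\<ge>1. ip (gam r) (gam s) = (if r = s then 1 else 0)) \<and>
     (\<forall>\<rho> v. \<rho> \<noteq> 0 \<longrightarrow> eigenfunction k \<rho> v \<longrightarrow> (\<exists>r\<ge>1. ip v (gam r) \<noteq> 0))"

definition complete_system :: "(nat \<Rightarrow> real \<Rightarrow> real) \<Rightarrow> bool" where
  "complete_system gam \<longleftrightarrow>
     (\<forall>v\<in>L2. (\<forall>r\<ge>1. ip v (gam r) = 0) \<longrightarrow> (AE t in unit_leb. v t = 0))"

definition random_function :: "'a measure \<Rightarrow> ('a \<Rightarrow> real \<Rightarrow> real) \<Rightarrow> bool" where
  "random_function M Y \<longleftrightarrow>
     (\<lambda>(\<omega>, t). Y \<omega> t) \<in> borel_measurable (M \<Otimes>\<^sub>M unit_leb) \<and> (\<forall>\<omega>\<in>space M. Y \<omega> \<in> L2)"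

text \<open>
  Independence and equality in law refer to the random paths, as elements of the space of all
  functions on \<open>{0..1}\<close> with the product sigma-algebra.
\<close>

definition iid_random_functions :: "'a measure \<Rightarrow> (nat \<Rightarrow> 'a \<Rightarrow> real \<Rightarrow> real) \<Rightarrow> bool" where
  "iid_random_functions M X \<longleftrightarrow>
     (\<forall>i\<ge>1. random_function M (X i)) \<and>
     prob_space.indep_vars M (\<lambda>_. Pi\<^sub>M {0..1} (\<lambda>_. borel)) (\<lambda>i \<omega>. restrict (X i \<omega>) {0..1}) {1..} \<and>
     (\<forall>i\<ge>1. \<forall>j\<ge>1. distr M (Pi\<^sub>M {0..1} (\<lambda>_. borel)) (\<lambda>\<omega>. restrict (X i \<omega>) {0..1})
                 = distr M (Pi\<^sub>M {0..1} (\<lambda>_. borel)) (\<lambda>\<omega>. restrict (X j \<omega>) {0..1}))"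

definition emp_mean :: "(nat \<Rightarrow> 'a \<Rightarrow> real \<Rightarrow> real) \<Rightarrow> nat \<Rightarrow> 'a \<Rightarrow> real \<Rightarrow> real" where
  "emp_mean X n \<omega> t = (1 / real n) * (\<Sum>i=1..n. X i \<omega> t)"

definition emp_cov :: "(nat \<Rightarrow> 'a \<Rightarrow> real \<Rightarrow> real) \<Rightarrow> nat \<Rightarrow> 'a \<Rightarrow> real \<Rightarrow> real \<Rightarrow> real" where
  "emp_cov X n \<omega> t s =
     (1 / real n) * (\<Sum>i=1..n. (X i \<omega> t - emp_mean X n \<omega> t) * (X i \<omega> s - emp_mean X n \<omega> s))"

definition ms_conv :: "'a measure \<Rightarrow> (nat \<Rightarrow> 'a \<Rightarrow> real) \<Rightarrow> ('a \<Rightarrow> real) \<Rightarrow> bool" where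
  "ms_conv M Z Y \<longleftrightarrow>
     (\<forall>N. Z N \<in> borel_measurable M) \<and> Y \<in> borel_measurable M \<and>
     (\<forall>N. integrable M (\<lambda>\<omega>. (Z N \<omega> - Y \<omega>)\<^sup>2)) \<and>
     (\<lambda>N. \<integral>\<omega>. (Z N \<omega> - Y \<omega>)\<^sup>2 \<partial>M) \<longlonglongrightarrow> 0"

text \<open>
  The normal law with variance \<open>v \<ge> 0\<close>, degenerate for \<open>v = 0\<close>; note that
  \<^const>\<open>normal_density\<close> takes the standard deviation.
\<close>

definition normal_law :: "real \<Rightarrow> real \<Rightarrow> real measure" where
  "normal_law m v =
     (if v = 0 then return borel m else density lborel (\<lambda>x. ennreal (normal_density m (sqrt v) x)))"

text \<open>
  Measurability is part of the two notions below, since distributions and probabilities of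
  non-measurable objects have junk values. Sample size 0 is ignored.
\<close>

definition conv_in_dist :: "'a measure \<Rightarrow> (nat \<Rightarrow> 'a \<Rightarrow> real) \<Rightarrow> real measure \<Rightarrow> bool" where
  "conv_in_dist M Y L \<longleftrightarrow>
     (\<forall>n\<ge>1. Y n \<in> borel_measurable M) \<and> weak_conv_m (\<lambda>n. distr M borel (Y n)) L"

definition big_Op :: "'a measure \<Rightarrow> (nat \<Rightarrow> 'a \<Rightarrow> real) \<Rightarrow> (nat \<Rightarrow> real) \<Rightarrow> bool" where
  "big_Op M Y a \<longleftrightarrow>
     (\<forall>n\<ge>1. Y n \<in> borel_measurable M) \<and>
     (\<forall>\<epsilon>>0. \<exists>C>0. \<forall>\<^sub>F n in sequentially. measure M {\<omega>\<in>space M. \<bar>Y n \<omega>\<bar> > C * a n} \<le> \<epsilon>)"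

end

theory Submission
  imports Defs
begin

text \<open>
  Expand everything in the eigenbasis of the population covariance. The empirical covariance then
  becomes a symmetric matrix that differs from the diagonal matrix of the eigenvalues by a matrix whose
  squared Hilbert-Schmidt norm has expectation of order \<open>1 / n\<close>, by the summability of the fourth
  moments. Weyl's inequality locates the empirical eigenvalue near the isolated population eigenvalue,
  and a first order perturbation argument shows that the remainders are at most quadratic in the norm
  of the perturbation. The linear terms are sums of i.i.d. random variables, so the central limit theorem
  and Slutsky's lemma give the limit laws.

  Two points need care. A score is an integral over a path and therefore not measurable
  for the product sigma-algebra to which independence refers; it is almost surely equal to a measurable
  functional, obtained from grid values. The leading term of the eigenfunction expansion has to be defined
  for every sample point and every argument; this is achieved by splitting off the residual of the observation
  from the series.
\<close>

section \<open>Square integrable functions\<close>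

text \<open>The randomness of the empirical eigenstructure is condensed into one number,
  \<open>total_dev n\<close>: the squared Hilbert-Schmidt norm of the deviation of the averaged
  score products from their expectations, plus the squared length of the mean score vector. The
  second summand pays for centring at the empirical mean, which subtracts a rank one matrix. Below a
  fixed threshold for \<open>total_dev n\<close> every estimate is deterministic, with error
  proportional to \<open>total_dev n\<close>; as its expectation is of order 1/n, Markov's
  inequality gives the stochastic orders.

  The listed empirical eigenfunctions need not span the space, so Weyl's lower bound cannot expand
  in them. It rests on the last clause of \<open>eigensystem\<close> instead: too large a quadratic
  form on the orthogonal complement of listed eigenfunctions would produce an eigenfunction
  orthogonal to all of them.

  The remainder is defined as a plain difference, and only its basis coefficients enter the norm
  bound. The leading term must therefore have the right coefficients for every sample point and the
  right mean square limit at every argument.\<close>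

definition sq_int :: "'b measure \<Rightarrow> ('b \<Rightarrow> real) set" where
  "sq_int M = {f \<in> borel_measurable M. integrable M (\<lambda>x. (f x)\<^sup>2)}"

lemma sq_intI: "f \<in> borel_measurable M \<Longrightarrow> integrable M (\<lambda>x. (f x)\<^sup>2) \<Longrightarrow> f \<in> sq_int M"
  by (simp add: sq_int_def)

lemma sq_int_measurable: "f \<in> sq_int M \<Longrightarrow> f \<in> borel_measurable M"
  and sq_int_integrable: "f \<in> sq_int M \<Longrightarrow> integrable M (\<lambda>x. (f x)\<^sup>2)"
  by (simp_all add: sq_int_def)

lemma L2_eq_sq_int: "L2 = sq_int unit_leb"
  by (simp add: L2_def sq_int_def)

lemma two_abs_mult_le: "2 * \<bar>a * b\<bar> \<le> a\<^sup>2 + (b\<^sup>2 :: real)"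
proof -
  have "0 \<le> (\<bar>a\<bar> - \<bar>b\<bar>)\<^sup>2" by simp
  also have "\<dots> = \<bar>a\<bar>\<^sup>2 + \<bar>b\<bar>\<^sup>2 - 2 * (\<bar>a\<bar> * \<bar>b\<bar>)" by (simp only: power2_diff)
  finally show ?thesis by (simp add: abs_mult)
qed

lemma power2_add_le: "(a + b)\<^sup>2 \<le> 2 * a\<^sup>2 + 2 * (b\<^sup>2 :: real)"
  using two_abs_mult_le[of a b] by (auto simp: power2_sum abs_le_iff)

lemma sq_int_integrable_mult:
  assumes f: "f \<in> sq_int M" and g: "g \<in> sq_int M"
  shows "integrable M (\<lambda>x. f x * g x)"
proof (rule Bochner_Integration.integrable_bound)
  show "integrable M (\<lambda>x. (f x)\<^sup>2 + (g x)\<^sup>2)"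
    using f g by (simp add: sq_int_def)
  show "(\<lambda>x. f x * g x) \<in> borel_measurable M"
    using f g by (intro borel_measurable_times sq_int_measurable)
  have "\<bar>f x * g x\<bar> \<le> (f x)\<^sup>2 + (g x)\<^sup>2" for x
    using two_abs_mult_le[of "f x" "g x"] abs_ge_zero[of "f x * g x"] by linarith
  then show "AE x in M. norm (f x * g x) \<le> norm ((f x)\<^sup>2 + (g x)\<^sup>2)"
    by (intro AE_I2) (simp add: abs_of_nonneg)
qed

lemma sq_int_cmult: "f \<in> sq_int M \<Longrightarrow> (\<lambda>x. c * f x) \<in> sq_int M"
  by (auto simp: sq_int_def power_mult_distrib)

lemma sq_int_add:
  assumes f: "f \<in> sq_int M" and g: "g \<in> sq_int M"
  shows "(\<lambda>x. f x + g x) \<in> sq_int M"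
proof -
  have "(\<lambda>x. (f x + g x)\<^sup>2) = (\<lambda>x. (f x)\<^sup>2 + (g x)\<^sup>2 + 2 * (f x * g x))"
    by (simp add: fun_eq_iff power2_sum)
  moreover have "integrable M (\<lambda>x. (f x)\<^sup>2 + (g x)\<^sup>2 + 2 * (f x * g x))"
    using f g sq_int_integrable_mult[OF f g] by (simp add: sq_int_def)
  ultimately show ?thesis
    using borel_measurable_add[OF sq_int_measurable[OF f] sq_int_measurable[OF g]] by (simp add: sq_int_def)
qed

lemma sq_int_diff: "f \<in> sq_int M \<Longrightarrow> g \<in> sq_int M \<Longrightarrow> (\<lambda>x. f x - g x) \<in> sq_int M"
  using sq_int_add[of f M "\<lambda>x. (-1) * g x"] sq_int_cmult[of g M "-1"] by simp

lemma sq_int_zero: "(\<lambda>x. 0) \<in> sq_int M"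
  by (simp add: sq_int_def)

lemma sq_int_sum: "(\<And>i. i \<in> I \<Longrightarrow> f i \<in> sq_int M) \<Longrightarrow> (\<lambda>x. \<Sum>i\<in>I. f i x) \<in> sq_int M"
  by (induction I rule: infinite_finite_induct) (simp_all add: sq_int_add sq_int_zero)

lemma sq_int_bounded_mult:
  assumes f: "f \<in> sq_int M" and g: "g \<in> borel_measurable M" and le: "\<And>x. x \<in> space M \<Longrightarrow> \<bar>g x\<bar> \<le> C"
  shows "(\<lambda>x. g x * f x) \<in> sq_int M"
proof (rule sq_intI)
  show gf: "(\<lambda>x. g x * f x) \<in> borel_measurable M"
    using g sq_int_measurable[OF f] by (rule borel_measurable_times)
  show "integrable M (\<lambda>x. (g x * f x)\<^sup>2)"
  proof (rule Bochner_Integration.integrable_bound)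
    show "integrable M (\<lambda>x. C\<^sup>2 * (f x)\<^sup>2)" using f by (simp add: sq_int_def)
    show "(\<lambda>x. (g x * f x)\<^sup>2) \<in> borel_measurable M" using gf by (rule borel_measurable_power)
    have "(g x)\<^sup>2 \<le> C\<^sup>2" if "x \<in> space M" for x
      using le[OF that] by (metis abs_le_square_iff abs_of_nonneg abs_ge_zero order_trans)
    then show "AE x in M. norm ((g x * f x)\<^sup>2) \<le> norm (C\<^sup>2 * (f x)\<^sup>2)"
      by (intro AE_I2) (simp add: power_mult_distrib mult_right_mono)
  qed
qed

lemma (in finite_measure) bounded_sq_int:
  assumes "f \<in> borel_measurable M" "\<And>x. x \<in> space M \<Longrightarrow> \<bar>f x\<bar> \<le> C"
  shows "f \<in> sq_int M"
  using sq_int_bounded_mult[of "\<lambda>_. 1" M f C] assms by (simp add: sq_int_def)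

lemma (in finite_measure) sq_int_imp_integrable: "f \<in> sq_int M \<Longrightarrow> integrable M f"
  using sq_int_integrable_mult[of f M "\<lambda>_. 1"] by (simp add: sq_int_def)

text \<open>Common source of the Cauchy-Schwarz inequalities for integrals and for series: there the
  quadratic is the squared norm of \<open>x * f + g\<close>.\<close>

lemma discriminant_le:
  fixes a b c :: real
  assumes "0 \<le> a" "\<And>x. 0 \<le> a * x\<^sup>2 + 2 * b * x + c"
  shows "b\<^sup>2 \<le> a * c"
proof (cases "a = 0")
  case True
  have "b = 0"
  proof (rule ccontr)
    assume "b \<noteq> 0"
    \<comment> \<open>With \<open>a = 0\<close> this argument makes the expression equal to
      -1.\<close>
    then show False using assms(2)[of "- (c + 1) / (2 * b)"] True by simp
  qed
  then show ?thesis using True by simp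
next
  case False
  then have "0 < a" using assms(1) by simp
  \<comment> \<open>The quadratic is evaluated at its minimiser.\<close>
  have "0 \<le> a * (- b / a)\<^sup>2 + 2 * b * (- b / a) + c" by (rule assms(2))
  also have "\<dots> = c - b\<^sup>2 / a" using \<open>0 < a\<close> by (simp add: field_simps power2_eq_square)
  finally show ?thesis using \<open>0 < a\<close> by (simp add: field_simps)
qed

lemma integral_Cauchy_Schwarz:
  assumes f: "f \<in> sq_int M" and g: "g \<in> sq_int M"
  shows "(\<integral>x. f x * g x \<partial>M)\<^sup>2 \<le> (\<integral>x. (f x)\<^sup>2 \<partial>M) * (\<integral>x. (g x)\<^sup>2 \<partial>M)"
proof (rule discriminant_le)
  show "0 \<le> (\<integral>x. (f x)\<^sup>2 \<partial>M)" by simp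
  fix y
  have "0 \<le> (\<integral>x. (y * f x + g x)\<^sup>2 \<partial>M)" by simp
  also have "\<dots> = (\<integral>x. y\<^sup>2 * (f x)\<^sup>2 + 2 * y * (f x * g x) + (g x)\<^sup>2 \<partial>M)"
    by (intro Bochner_Integration.integral_cong) (auto simp: power2_eq_square algebra_simps)
  also have "\<dots> = (\<integral>x. (f x)\<^sup>2 \<partial>M) * y\<^sup>2 + 2 * (\<integral>x. f x * g x \<partial>M) * y + (\<integral>x. (g x)\<^sup>2 \<partial>M)"
    using f g sq_int_integrable_mult[OF f g] by (simp add: sq_int_def)
  finally show "0 \<le> (\<integral>x. (f x)\<^sup>2 \<partial>M) * y\<^sup>2 + 2 * (\<integral>x. f x * g x \<partial>M) * y + (\<integral>x. (g x)\<^sup>2 \<partial>M)" .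
qed

text \<open>Cauchy-Schwarz against the constant 1. It turns mean square statements into L1
  statements, for which almost everywhere convergent subsequences are at hand.\<close>

lemma (in finite_measure) integral_abs_le_sq_int:
  assumes "f \<in> sq_int M"
  shows "(\<integral>x. \<bar>f x\<bar> \<partial>M) \<le> sqrt ((\<integral>x. (f x)\<^sup>2 \<partial>M) * measure M (space M))"
proof (rule real_le_rsqrt)
  have "(\<lambda>x. \<bar>f x\<bar>) \<in> sq_int M" using assms by (auto simp: sq_int_def)
  from integral_Cauchy_Schwarz[OF this, of "\<lambda>_. 1"]
  show "(\<integral>x. \<bar>f x\<bar> \<partial>M)\<^sup>2 \<le> (\<integral>x. (f x)\<^sup>2 \<partial>M) * measure M (space M)"
    by (simp add: sq_int_def)
qed

text \<open>Its purpose is identification: when a sequence converges in mean square and also in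
  another sense, both limits can be compared along one subsequence.\<close>

lemma (in finite_measure) sq_int_conv_AE_subseq:
  assumes f: "\<And>n. f n \<in> sq_int M" and g: "g \<in> sq_int M"
    and lim: "(\<lambda>n. \<integral>x. (f n x - g x)\<^sup>2 \<partial>M) \<longlonglongrightarrow> 0"
  shows "\<exists>r::nat\<Rightarrow>nat. strict_mono r \<and> (AE x in M. (\<lambda>n. f (r n) x) \<longlonglongrightarrow> g x)"
proof -
  have d: "(\<lambda>x. f n x - g x) \<in> sq_int M" for n using f g by (rule sq_int_diff)
  have "(\<lambda>n. sqrt ((\<integral>x. (f n x - g x)\<^sup>2 \<partial>M) * measure M (space M))) \<longlonglongrightarrow> sqrt (0 * measure M (space M))"
    by (intro tendsto_intros lim)
  then have lim': "(\<lambda>n. sqrt ((\<integral>x. (f n x - g x)\<^sup>2 \<partial>M) * measure M (space M))) \<longlonglongrightarrow> 0" by simp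
  have "(\<lambda>n. \<integral>x. norm (f n x - g x) \<partial>M) \<longlonglongrightarrow> 0"
    by (rule tendsto_sandwich[OF _ _ tendsto_const lim'])
       (use integral_abs_le_sq_int[OF d] in \<open>auto intro!: always_eventually\<close>)
  then obtain r :: "nat \<Rightarrow> nat" where "strict_mono r" "AE x in M. (\<lambda>n. f (r n) x - g x) \<longlonglongrightarrow> 0"
    using tendsto_L1_AE_subseq[of M "\<lambda>n x. f n x - g x"] sq_int_imp_integrable[OF d] by blast
  then show ?thesis
    by (intro exI[of _ r]) (auto simp: Lim_null[symmetric] LIM_zero_iff)
qed

text \<open>A uniform bound on the second moments replaces domination; Fatou's lemma passes it to
  the limit.\<close>

lemma sq_int_Fatou:
  assumes f: "\<And>n. f n \<in> sq_int M" and g: "g \<in> borel_measurable M"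
    and lim: "AE x in M. (\<lambda>n. f n x) \<longlonglongrightarrow> g x"
    and le: "\<And>n. (\<integral>x. (f n x)\<^sup>2 \<partial>M) \<le> B"
  shows "g \<in> sq_int M" "(\<integral>x. (g x)\<^sup>2 \<partial>M) \<le> B"
proof -
  have [measurable]: "f n \<in> borel_measurable M" for n using f by (rule sq_int_measurable)
  note g[measurable]
  have B: "0 \<le> B" using le[of 0] by (rule order_trans[rotated]) simp
  have "(\<integral>\<^sup>+x. ennreal ((g x)\<^sup>2) \<partial>M) = (\<integral>\<^sup>+x. liminf (\<lambda>n. ennreal ((f n x)\<^sup>2)) \<partial>M)"
    using lim
    by (intro nn_integral_cong_AE) (auto elim!: eventually_mono intro!: lim_imp_Liminf[symmetric] tendsto_intros)
  also have "\<dots> \<le> liminf (\<lambda>n. \<integral>\<^sup>+x. ennreal ((f n x)\<^sup>2) \<partial>M)"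
    by (intro nn_integral_liminf) simp
  also have "\<dots> \<le> liminf (\<lambda>n. ennreal B)"
    using f le by (intro Liminf_mono always_eventually allI)
      (auto simp: nn_integral_eq_integral sq_int_def intro!: ennreal_leI)
  also have "\<dots> = ennreal B" by (simp add: Liminf_const)
  finally have *: "(\<integral>\<^sup>+x. ennreal ((g x)\<^sup>2) \<partial>M) \<le> ennreal B" .
  then have "(\<integral>\<^sup>+x. ennreal ((g x)\<^sup>2) \<partial>M) < \<infinity>"
    using ennreal_less_top le_less_trans by fastforce
  then have i: "integrable M (\<lambda>x. (g x)\<^sup>2)" by (intro integrableI_nonneg) auto
  then show "g \<in> sq_int M" by (simp add: sq_int_def)
  show "(\<integral>x. (g x)\<^sup>2 \<partial>M) \<le> B"
    using * i B by (simp add: nn_integral_eq_integral)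
qed

lemma sq_int_conv_mult:
  assumes f: "\<And>n. f n \<in> sq_int M" and g: "g \<in> sq_int M" and h: "h \<in> sq_int M"
    and lim: "(\<lambda>n. \<integral>x. (f n x - g x)\<^sup>2 \<partial>M) \<longlonglongrightarrow> 0"
  shows "(\<lambda>n. \<integral>x. f n x * h x \<partial>M) \<longlonglongrightarrow> (\<integral>x. g x * h x \<partial>M)"
proof -
  have d: "(\<lambda>x. f n x - g x) \<in> sq_int M" for n using f g by (rule sq_int_diff)
  have "(\<lambda>n. sqrt ((\<integral>x. (f n x - g x)\<^sup>2 \<partial>M) * (\<integral>x. (h x)\<^sup>2 \<partial>M))) \<longlonglongrightarrow> sqrt (0 * (\<integral>x. (h x)\<^sup>2 \<partial>M))"
    by (intro tendsto_intros lim)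
  then have lim': "(\<lambda>n. sqrt ((\<integral>x. (f n x - g x)\<^sup>2 \<partial>M) * (\<integral>x. (h x)\<^sup>2 \<partial>M))) \<longlonglongrightarrow> 0" by simp
  have eq: "(\<integral>x. f n x * h x \<partial>M) - (\<integral>x. g x * h x \<partial>M) = (\<integral>x. (f n x - g x) * h x \<partial>M)" for n
    using sq_int_integrable_mult[OF f h] sq_int_integrable_mult[OF g h] by (simp add: left_diff_distrib)
  have "(\<lambda>n. (\<integral>x. f n x * h x \<partial>M) - (\<integral>x. g x * h x \<partial>M)) \<longlonglongrightarrow> 0"
    unfolding eq
    by (rule Lim_null_comparison[OF always_eventually lim'])
       (auto intro!: real_le_rsqrt integral_Cauchy_Schwarz d h)
  then show ?thesis by (simp add: LIM_zero_iff)
qed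

text \<open>The square of \<open>f n\<close> is rewritten through that of \<open>f n - g\<close> and
  a mixed term, so that convergence of norms reduces to \<open>sq_int_conv_mult\<close>.\<close>

lemma sq_int_conv_square:
  assumes f: "\<And>n. f n \<in> sq_int M" and g: "g \<in> sq_int M"
    and lim: "(\<lambda>n. \<integral>x. (f n x - g x)\<^sup>2 \<partial>M) \<longlonglongrightarrow> 0"
  shows "(\<lambda>n. \<integral>x. (f n x)\<^sup>2 \<partial>M) \<longlonglongrightarrow> (\<integral>x. (g x)\<^sup>2 \<partial>M)"
proof -
  have eq: "(\<integral>x. (f n x)\<^sup>2 \<partial>M) = (\<integral>x. (f n x - g x)\<^sup>2 \<partial>M) + 2 * (\<integral>x. f n x * g x \<partial>M) - (\<integral>x. g x * g x \<partial>M)" for n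
  proof -
    have "(\<integral>x. (f n x)\<^sup>2 \<partial>M) = (\<integral>x. (f n x - g x)\<^sup>2 + 2 * (f n x * g x) - g x * g x \<partial>M)"
      by (intro Bochner_Integration.integral_cong) (auto simp: power2_eq_square algebra_simps)
    then show ?thesis
      using sq_int_integrable[OF sq_int_diff[OF f[of n] g]] sq_int_integrable_mult[OF f[of n] g] sq_int_integrable_mult[OF g g]
      by simp
  qed
  have "(\<lambda>n. (\<integral>x. (f n x - g x)\<^sup>2 \<partial>M) + 2 * (\<integral>x. f n x * g x \<partial>M) - (\<integral>x. g x * g x \<partial>M))
     \<longlonglongrightarrow> 0 + 2 * (\<integral>x. g x * g x \<partial>M) - (\<integral>x. g x * g x \<partial>M)"
    by (intro tendsto_intros lim sq_int_conv_mult f g)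
  then show ?thesis unfolding eq by (simp add: power2_eq_square)
qed

text \<open>The modulus \<open>b\<close> bounds the distance of \<open>f n\<close> to all later
  members. The limit along a subsequence inherits this bound by Fatou's lemma, which gives
  convergence of the full sequence at once.\<close>

lemma (in finite_measure) Riesz_Fischer:
  assumes f: "\<And>n. f n \<in> sq_int M"
    and le: "\<And>m n. n \<le> m \<Longrightarrow> (\<integral>x. (f m x - f n x)\<^sup>2 \<partial>M) \<le> b n" and b: "b \<longlonglongrightarrow> 0"
  shows "\<exists>g\<in>sq_int M. (\<lambda>n. \<integral>x. (f n x - g x)\<^sup>2 \<partial>M) \<longlonglongrightarrow> 0"
proof -
  have [measurable]: "f n \<in> borel_measurable M" for n using f by (rule sq_int_measurable)
  have d: "(\<lambda>x. f m x - f n x) \<in> sq_int M" for m n using f f by (rule sq_int_diff)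
  have sym: "(\<integral>x. norm (f j x - f i x) \<partial>M) = (\<integral>x. norm (f i x - f j x) \<partial>M)" for i j
    by (simp only: norm_minus_commute[of "f j _" "f i _"])
  have cauchy: "\<exists>N. \<forall>i\<ge>N. \<forall>j\<ge>N. (\<integral>x. norm (f i x - f j x) \<partial>M) < e" if "e > 0" for e
  proof -
    have "(\<lambda>n. sqrt (b n * measure M (space M))) \<longlonglongrightarrow> sqrt (0 * measure M (space M))"
      by (intro tendsto_intros b)
    then have "\<forall>\<^sub>F n in sequentially. sqrt (b n * measure M (space M)) < e"
      using that by (auto intro: order_tendstoD)
    then obtain N where N: "\<And>n. n \<ge> N \<Longrightarrow> sqrt (b n * measure M (space M)) < e"
      by (auto simp: eventually_sequentially)
    have *: "(\<integral>x. norm (f i x - f j x) \<partial>M) < e" if "j \<ge> N" "i \<ge> j" for i j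
    proof -
      have "(\<integral>x. norm (f i x - f j x) \<partial>M) \<le> sqrt ((\<integral>x. (f i x - f j x)\<^sup>2 \<partial>M) * measure M (space M))"
        using integral_abs_le_sq_int[OF d] by simp
      also have "\<dots> \<le> sqrt (b j * measure M (space M))"
        using le[OF that(2)] by (simp add: mult_right_mono)
      finally show ?thesis using N[OF that(1)] by simp
    qed
    show ?thesis
    proof (intro exI[of _ N] allI impI)
      fix i j assume "N \<le> i" "N \<le> j"
      then show "(\<integral>x. norm (f i x - f j x) \<partial>M) < e"
        using *[of j i] *[of i j] sym[of i j] by (cases "i \<le> j") auto
    qed
  qed
  obtain r where r: "strict_mono r" "AE x in M. Cauchy (\<lambda>i. f (r i) x)"
    using cauchy_L1_AE_cauchy_subseq[of M f] sq_int_imp_integrable[OF f] cauchy by blast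
  define g where "g x = lim (\<lambda>i. f (r i) x)" for x
  have [measurable]: "g \<in> borel_measurable M" unfolding g_def by measurable
  have g: "AE x in M. (\<lambda>i. f (r i) x) \<longlonglongrightarrow> g x"
    using r(2) by eventually_elim (simp add: g_def Cauchy_convergent_iff convergent_LIMSEQ_iff)
  have bound: "(\<lambda>x. g x - f n x) \<in> sq_int M \<and> (\<integral>x. (g x - f n x)\<^sup>2 \<partial>M) \<le> b n" for n
  proof -
    have "n \<le> r (i + n)" for i
      using seq_suble[OF r(1), of "i + n"] by simp
    moreover have "AE x in M. (\<lambda>i. f (r (i + n)) x - f n x) \<longlonglongrightarrow> g x - f n x"
      using g by eventually_elim (intro tendsto_intros LIMSEQ_ignore_initial_segment)
    ultimately show ?thesis
      using sq_int_Fatou[of "\<lambda>i x. f (r (i + n)) x - f n x" M "\<lambda>x. g x - f n x" "b n"] d le by auto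
  qed
  have "g \<in> sq_int M"
    using sq_int_add[OF conjunct1[OF bound[of 0]] f[of 0]] by simp
  moreover have "(\<lambda>n. \<integral>x. (f n x - g x)\<^sup>2 \<partial>M) \<longlonglongrightarrow> 0"
    by (rule tendsto_sandwich[OF _ _ tendsto_const b])
       (use bound in \<open>auto intro!: always_eventually simp: power2_commute[of "f _ _" "g _"]\<close>)
  ultimately show ?thesis by blast
qed

section \<open>The inner product and Parseval's identity\<close>

interpretation unit_leb: prob_space unit_leb
  by (rule prob_spaceI) (simp add: emeasure_restrict_space)

lemma ip_commute: "ip v w = ip w v"
  by (simp add: ip_def mult.commute)

lemma ip_self: "ip v v = (\<integral>t. (v t)\<^sup>2 \<partial>unit_leb)"
  by (simp add: ip_def power2_eq_square)

lemma ip_nonneg: "0 \<le> ip v v"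
  by (simp add: ip_self)

lemma ip_cmult_left: "ip (\<lambda>t. a * v t) w = a * ip v w"
  by (simp add: ip_def mult.assoc)

lemma ip_cmult_right: "ip w (\<lambda>t. a * v t) = a * ip w v"
  by (simp only: ip_commute[of w] ip_cmult_left)

lemma ip_zero_left: "ip (\<lambda>t. 0) w = 0"
  by (simp add: ip_def)

lemma L2_add: "v \<in> L2 \<Longrightarrow> w \<in> L2 \<Longrightarrow> (\<lambda>t. v t + w t) \<in> L2"
  and L2_diff: "v \<in> L2 \<Longrightarrow> w \<in> L2 \<Longrightarrow> (\<lambda>t. v t - w t) \<in> L2"
  and L2_cmult: "v \<in> L2 \<Longrightarrow> (\<lambda>t. a * v t) \<in> L2"
  by (simp_all add: L2_eq_sq_int sq_int_add sq_int_diff sq_int_cmult)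

lemma L2_sum: "(\<And>i. i \<in> I \<Longrightarrow> f i \<in> L2) \<Longrightarrow> (\<lambda>t. \<Sum>i\<in>I. f i t) \<in> L2"
  by (simp add: L2_eq_sq_int sq_int_sum)

lemma L2_integrable_mult: "v \<in> L2 \<Longrightarrow> w \<in> L2 \<Longrightarrow> integrable unit_leb (\<lambda>t. v t * w t)"
  by (simp add: L2_eq_sq_int sq_int_integrable_mult)

lemma ip_add_left: "u \<in> L2 \<Longrightarrow> v \<in> L2 \<Longrightarrow> w \<in> L2 \<Longrightarrow> ip (\<lambda>t. u t + v t) w = ip u w + ip v w"
  by (simp add: ip_def distrib_right L2_integrable_mult)

lemma ip_diff_left: "u \<in> L2 \<Longrightarrow> v \<in> L2 \<Longrightarrow> w \<in> L2 \<Longrightarrow> ip (\<lambda>t. u t - v t) w = ip u w - ip v w"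
  by (simp add: ip_def left_diff_distrib L2_integrable_mult)

lemma ip_diff_right: "u \<in> L2 \<Longrightarrow> v \<in> L2 \<Longrightarrow> w \<in> L2 \<Longrightarrow> ip w (\<lambda>t. u t - v t) = ip w u - ip w v"
  by (simp only: ip_commute[of w] ip_diff_left)

lemma ip_sum_left:
  "(\<And>i. i \<in> I \<Longrightarrow> f i \<in> L2) \<Longrightarrow> w \<in> L2 \<Longrightarrow> ip (\<lambda>t. \<Sum>i\<in>I. f i t) w = (\<Sum>i\<in>I. ip (f i) w)"
  by (induction I rule: infinite_finite_induct) (simp_all add: ip_zero_left ip_add_left L2_sum)

lemma ip_lincomb_left:
  "(\<And>i. i \<in> I \<Longrightarrow> f i \<in> L2) \<Longrightarrow> w \<in> L2 \<Longrightarrow>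
    ip (\<lambda>t. \<Sum>i\<in>I. a i * f i t) w = (\<Sum>i\<in>I. a i * ip (f i) w)"
  by (subst ip_sum_left) (auto simp: ip_cmult_left L2_cmult)

lemma ip_lincomb_right:
  "(\<And>i. i \<in> I \<Longrightarrow> f i \<in> L2) \<Longrightarrow> w \<in> L2 \<Longrightarrow>
    ip w (\<lambda>t. \<Sum>i\<in>I. a i * f i t) = (\<Sum>i\<in>I. a i * ip w (f i))"
  by (simp only: ip_commute[of w] ip_lincomb_left)

lemma ip_Cauchy_Schwarz: "v \<in> L2 \<Longrightarrow> w \<in> L2 \<Longrightarrow> (ip v w)\<^sup>2 \<le> ip v v * ip w w"
  using integral_Cauchy_Schwarz[of v unit_leb w] by (simp add: L2_eq_sq_int ip_self) (simp add: ip_def)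

lemma ip_self_eq_0_iff: "v \<in> L2 \<Longrightarrow> ip v v = 0 \<longleftrightarrow> (AE t in unit_leb. v t = 0)"
  unfolding ip_self by (subst integral_nonneg_eq_0_iff_AE) (auto simp: L2_def)

locale orthonormal_basis =
  fixes e :: "nat \<Rightarrow> real \<Rightarrow> real"
  assumes basis_L2: "\<And>s. e s \<in> L2"
    and orthonormal: "\<And>r s. ip (e r) (e s) = (if r = s then 1 else 0)"
    and total: "\<And>v. v \<in> L2 \<Longrightarrow> (\<And>s. ip v (e s) = 0) \<Longrightarrow> AE t in unit_leb. v t = 0"
begin

lemma ip_lincomb_basis:
  "finite I \<Longrightarrow> ip (\<lambda>t. \<Sum>s\<in>I. a s * e s t) (e q) = (if q \<in> I then a q else 0)"
proof -
  assume I: "finite I"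
  have "ip (\<lambda>t. \<Sum>s\<in>I. a s * e s t) (e q) = (\<Sum>s\<in>I. a s * ip (e s) (e q))"
    by (rule ip_lincomb_left) (rule basis_L2)+
  also have "\<dots> = (\<Sum>s\<in>I. if s = q then a s else 0)"
    by (intro sum.cong refl) (simp add: orthonormal)
  finally show ?thesis using I by simp
qed

lemma ip_lincomb_basis_self:
  assumes "finite I"
  shows "ip (\<lambda>t. \<Sum>s\<in>I. a s * e s t) (\<lambda>t. \<Sum>s\<in>I. a s * e s t) = (\<Sum>s\<in>I. (a s)\<^sup>2)"
proof -
  have "(\<lambda>t. \<Sum>s\<in>I. a s * e s t) \<in> L2" by (intro L2_sum L2_cmult basis_L2)
  then show ?thesis
    by (subst ip_lincomb_right)
       (auto simp: basis_L2 assms ip_lincomb_basis power2_eq_square intro!: sum.cong)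
qed

text \<open>Pythagoras for the projection onto the first \<open>N\<close> basis functions.\<close>

lemma ip_partial_sum_residual:
  assumes v: "v \<in> L2"
  defines "p \<equiv> \<lambda>N t. \<Sum>s<N. ip v (e s) * e s t"
  shows "ip (\<lambda>t. v t - p N t) (\<lambda>t. v t - p N t) = ip v v - (\<Sum>s<N. (ip v (e s))\<^sup>2)"
proof -
  have p: "p N \<in> L2" unfolding p_def by (intro L2_sum L2_cmult basis_L2)
  have "ip (p N) v = (\<Sum>s<N. (ip v (e s))\<^sup>2)"
    unfolding p_def using v
    by (subst ip_lincomb_left) (auto simp: basis_L2 power2_eq_square ip_commute[of "e _" v])
  moreover have "ip (p N) (p N) = (\<Sum>s<N. (ip v (e s))\<^sup>2)"
    unfolding p_def by (rule ip_lincomb_basis_self) simp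
  ultimately show ?thesis
    using v p by (simp add: ip_diff_left ip_diff_right L2_diff ip_commute[of v "p N"])
qed

lemma Bessel_finite: "v \<in> L2 \<Longrightarrow> (\<Sum>s<N. (ip v (e s))\<^sup>2) \<le> ip v v"
  using ip_partial_sum_residual[of v N] ip_nonneg[of "\<lambda>t. v t - (\<Sum>s<N. ip v (e s) * e s t)"] by simp

text \<open>By Bessel's inequality the partial sums form a Cauchy sequence, so they have a mean
  square limit. That limit has the coefficients of \<open>v\<close>, and \<open>total\<close> makes
  it equal to \<open>v\<close> almost everywhere; hence the residuals vanish.\<close>

lemma Parseval_square:
  assumes v: "v \<in> L2"
  shows "(\<lambda>s. (ip v (e s))\<^sup>2) sums ip v v"
proof -
  define p where "p N t = (\<Sum>s<N. ip v (e s) * e s t)" for N t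
  \<comment> \<open>The tail sum is the Cauchy modulus required by
    \<open>Riesz_Fischer\<close>.\<close>
  define B where "B N = (\<Sum>s. (ip v (e s))\<^sup>2) - (\<Sum>s<N. (ip v (e s))\<^sup>2)" for N
  have summ: "summable (\<lambda>s. (ip v (e s))\<^sup>2)"
    by (rule summableI_nonneg_bounded[of _ "ip v v"]) (auto intro: Bessel_finite[OF v])
  have p: "p N \<in> L2" for N unfolding p_def by (intro L2_sum L2_cmult basis_L2)
  have "B \<longlonglongrightarrow> (\<Sum>s. (ip v (e s))\<^sup>2) - (\<Sum>s. (ip v (e s))\<^sup>2)"
    unfolding B_def by (intro tendsto_intros summable_LIMSEQ summ)
  then have B: "B \<longlonglongrightarrow> 0" by simp
  have "(\<integral>x. (p m x - p n x)\<^sup>2 \<partial>unit_leb) \<le> B n" if "n \<le> m" for m n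
  proof -
    have "p m t - p n t = (\<Sum>s\<in>{n..<m}. ip v (e s) * e s t)" for t
      unfolding p_def using sum_diff_nat_ivl[of 0 n m "\<lambda>s. ip v (e s) * e s t"] that
      by (simp add: atLeast0LessThan)
    then have "(\<integral>x. (p m x - p n x)\<^sup>2 \<partial>unit_leb) = (\<Sum>s\<in>{n..<m}. (ip v (e s))\<^sup>2)"
      by (simp flip: ip_self add: ip_lincomb_basis_self)
    also have "\<dots> = (\<Sum>s<m. (ip v (e s))\<^sup>2) - (\<Sum>s<n. (ip v (e s))\<^sup>2)"
      using sum_diff_nat_ivl[of 0 n m "\<lambda>s. (ip v (e s))\<^sup>2"] that by (simp add: atLeast0LessThan)
    also have "\<dots> \<le> B n"
      unfolding B_def by (intro diff_right_mono sum_le_suminf summ) auto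
    finally show ?thesis .
  qed
  then obtain w where w: "w \<in> L2" and lim: "(\<lambda>n. \<integral>x. (p n x - w x)\<^sup>2 \<partial>unit_leb) \<longlonglongrightarrow> 0"
    using unit_leb.Riesz_Fischer[of p B] p B unfolding L2_eq_sq_int by blast
  have "ip w (e s) = ip v (e s)" for s
  proof (rule LIMSEQ_unique)
    show "(\<lambda>n. ip (p n) (e s)) \<longlonglongrightarrow> ip w (e s)"
      unfolding ip_def using p w basis_L2[of s] lim
      by (intro sq_int_conv_mult) (auto simp: L2_eq_sq_int)
    have "\<forall>\<^sub>F n in sequentially. ip (p n) (e s) = ip v (e s)"
      unfolding p_def using eventually_gt_at_top[of s] by eventually_elim (simp add: ip_lincomb_basis)
    then show "(\<lambda>n. ip (p n) (e s)) \<longlonglongrightarrow> ip v (e s)" by (rule tendsto_eventually)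
  qed
  then have "AE t in unit_leb. v t - w t = 0"
    using v w by (intro total) (auto simp: L2_diff ip_diff_left basis_L2)
  then have eq: "(\<integral>x. (p n x - w x)\<^sup>2 \<partial>unit_leb) = ip (\<lambda>t. v t - p n t) (\<lambda>t. v t - p n t)" for n
    unfolding ip_self using v w p[of n]
    by (intro integral_cong_AE) (auto simp: L2_def power2_commute)
  have "(\<lambda>n. ip v v - (\<Sum>s<n. (ip v (e s))\<^sup>2)) \<longlonglongrightarrow> 0"
    using lim unfolding eq unfolding p_def by (simp only: ip_partial_sum_residual[OF v])
  then have "(\<lambda>n. ip v v - (ip v v - (\<Sum>s<n. (ip v (e s))\<^sup>2))) \<longlonglongrightarrow> ip v v - 0"
    by (intro tendsto_diff tendsto_const)
  then show ?thesis by (simp add: sums_def)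
qed

text \<open>Polarisation of \<open>Parseval_square\<close>.\<close>

lemma Parseval:
  assumes v: "v \<in> L2" and w: "w \<in> L2"
  shows "(\<lambda>s. ip v (e s) * ip w (e s)) sums ip v w"
proof -
  have "(\<lambda>s. ((ip (\<lambda>t. v t + w t) (e s))\<^sup>2 - (ip v (e s))\<^sup>2 - (ip w (e s))\<^sup>2) / 2)
     sums ((ip (\<lambda>t. v t + w t) (\<lambda>t. v t + w t) - ip v v - ip w w) / 2)"
    by (intro sums_divide sums_diff Parseval_square L2_add v w)
  moreover have "((ip (\<lambda>t. v t + w t) (e s))\<^sup>2 - (ip v (e s))\<^sup>2 - (ip w (e s))\<^sup>2) / 2 = ip v (e s) * ip w (e s)" for s
    using v w by (simp add: ip_add_left basis_L2 power2_sum)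
  moreover have "(ip (\<lambda>t. v t + w t) (\<lambda>t. v t + w t) - ip v v - ip w w) / 2 = ip v w"
  proof -
    have vw: "(\<lambda>t. v t + w t) \<in> L2" using v w by (rule L2_add)
    have "ip v (\<lambda>t. v t + w t) = ip v v + ip v w" "ip w (\<lambda>t. v t + w t) = ip v w + ip w w"
      unfolding ip_commute[of _ "\<lambda>t. v t + w t"] ip_add_left[OF v w v] ip_add_left[OF v w w]
      by (simp_all add: ip_commute[of w v])
    then show ?thesis unfolding ip_add_left[OF v w vw] by simp
  qed
  ultimately show ?thesis by (simp only:)
qed

end

section \<open>Square summable sequences\<close>

lemma suminf_Cauchy_Schwarz:
  fixes a b :: "nat \<Rightarrow> real"
  assumes a: "summable (\<lambda>p. (a p)\<^sup>2)" and b: "summable (\<lambda>p. (b p)\<^sup>2)"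
  shows "summable (\<lambda>p. a p * b p)" "(\<Sum>p. a p * b p)\<^sup>2 \<le> (\<Sum>p. (a p)\<^sup>2) * (\<Sum>p. (b p)\<^sup>2)"
proof -
  have "\<bar>a p * b p\<bar> \<le> (a p)\<^sup>2 + (b p)\<^sup>2" for p
    using two_abs_mult_le[of "a p" "b p"] abs_ge_zero[of "a p * b p"] by linarith
  then show ab: "summable (\<lambda>p. a p * b p)"
    by (intro summable_comparison_test'[OF summable_add[OF a b], of 0]) simp
  show "(\<Sum>p. a p * b p)\<^sup>2 \<le> (\<Sum>p. (a p)\<^sup>2) * (\<Sum>p. (b p)\<^sup>2)"
  proof (rule discriminant_le)
    show "0 \<le> (\<Sum>p. (a p)\<^sup>2)" by (intro suminf_nonneg a) simp
    fix x
    have eq: "(\<lambda>p. (x * a p + b p)\<^sup>2) = (\<lambda>p. x\<^sup>2 * (a p)\<^sup>2 + (2 * x) * (a p * b p) + (b p)\<^sup>2)"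
      by (simp add: fun_eq_iff power2_eq_square algebra_simps)
    have s: "(\<lambda>p. (x * a p + b p)\<^sup>2) sums
        (x\<^sup>2 * (\<Sum>p. (a p)\<^sup>2) + (2 * x) * (\<Sum>p. a p * b p) + (\<Sum>p. (b p)\<^sup>2))"
      unfolding eq by (intro sums_add sums_mult summable_sums a b ab)
    have "0 \<le> x\<^sup>2 * (\<Sum>p. (a p)\<^sup>2) + (2 * x) * (\<Sum>p. a p * b p) + (\<Sum>p. (b p)\<^sup>2)"
      by (rule sums_le[OF _ sums_zero s]) simp
    then show "0 \<le> (\<Sum>p. (a p)\<^sup>2) * x\<^sup>2 + 2 * (\<Sum>p. a p * b p) * x + (\<Sum>p. (b p)\<^sup>2)"
      by (simp add: mult.commute mult.left_commute)
  qed
qed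

text \<open>\<open>B\<close> bounds the square of the norm. Summability is part of the notion
  because \<open>suminf\<close> of a divergent series carries no information.\<close>

definition hilbert_schmidt_le :: "(nat \<Rightarrow> nat \<Rightarrow> real) \<Rightarrow> real \<Rightarrow> bool" where
  "hilbert_schmidt_le d B \<longleftrightarrow>
     (\<forall>q. summable (\<lambda>p. (d p q)\<^sup>2)) \<and> summable (\<lambda>q. \<Sum>p. (d p q)\<^sup>2) \<and> (\<Sum>q. \<Sum>p. (d p q)\<^sup>2) \<le> B"

text \<open>Cauchy-Schwarz for each index \<open>q\<close>, then summation over \<open>q\<close>:
  the operator norm is at most the Hilbert-Schmidt norm.\<close>

lemma hilbert_schmidt_le_apply:
  assumes d: "hilbert_schmidt_le d B" and y: "summable (\<lambda>p. (y p)\<^sup>2)"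
  shows "summable (\<lambda>p. d p q * y p)"
    "summable (\<lambda>q. (\<Sum>p. d p q * y p)\<^sup>2)"
    "(\<Sum>q. (\<Sum>p. d p q * y p)\<^sup>2) \<le> B * (\<Sum>p. (y p)\<^sup>2)"
proof -
  have d1: "summable (\<lambda>p. (d p q)\<^sup>2)" for q
    using d by (auto simp: hilbert_schmidt_le_def)
  have d2: "summable (\<lambda>q. \<Sum>p. (d p q)\<^sup>2)"
    and d3: "(\<Sum>q. \<Sum>p. (d p q)\<^sup>2) \<le> B"
    using d by (auto simp: hilbert_schmidt_le_def)
  have y0: "0 \<le> (\<Sum>p. (y p)\<^sup>2)" by (intro suminf_nonneg y) simp
  show "summable (\<lambda>p. d p q * y p)" by (rule suminf_Cauchy_Schwarz[OF d1 y])
  have le: "(\<Sum>p. d p q * y p)\<^sup>2 \<le> (\<Sum>p. (d p q)\<^sup>2) * (\<Sum>p. (y p)\<^sup>2)" for q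
    by (rule suminf_Cauchy_Schwarz[OF d1 y])
  have s: "summable (\<lambda>q. (\<Sum>p. (d p q)\<^sup>2) * (\<Sum>p. (y p)\<^sup>2))" by (intro summable_mult2 d2)
  show s': "summable (\<lambda>q. (\<Sum>p. d p q * y p)\<^sup>2)"
    by (rule summable_comparison_test'[OF s, of 0]) (use le in simp)
  have "(\<Sum>q. (\<Sum>p. d p q * y p)\<^sup>2) \<le> (\<Sum>q. (\<Sum>p. (d p q)\<^sup>2) * (\<Sum>p. (y p)\<^sup>2))"
    by (intro suminf_le le s s')
  also have "\<dots> = (\<Sum>q. \<Sum>p. (d p q)\<^sup>2) * (\<Sum>p. (y p)\<^sup>2)" by (rule suminf_mult2[OF d2, symmetric])
  also have "\<dots> \<le> B * (\<Sum>p. (y p)\<^sup>2)" by (intro mult_right_mono d3 y0)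
  finally show "(\<Sum>q. (\<Sum>p. d p q * y p)\<^sup>2) \<le> B * (\<Sum>p. (y p)\<^sup>2)" .
qed

lemma suminf_split_at:
  fixes f :: "nat \<Rightarrow> real"
  assumes "summable f"
  shows "summable (\<lambda>s. if s = r then 0 else f s)" "suminf f = f r + (\<Sum>s. if s = r then 0 else f s)"
proof -
  have "(\<lambda>s. f s - (if s = r then f s else 0)) sums (suminf f - f r)"
    using assms sums_single[of r f] by (intro sums_diff summable_sums) auto
  moreover have "(\<lambda>s. f s - (if s = r then f s else 0)) = (\<lambda>s. if s = r then 0 else f s)" by auto
  ultimately have "(\<lambda>s. if s = r then 0 else f s) sums (suminf f - f r)" by simp
  then show "summable (\<lambda>s. if s = r then 0 else f s)" "suminf f = f r + (\<Sum>s. if s = r then 0 else f s)"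
    by (auto simp: sums_iff)
qed

section \<open>First order perturbation of an isolated eigenvalue\<close>

text \<open>\<open>x\<close> holds the coordinates of a unit eigenvector of the perturbed operator
  in the unperturbed eigenbasis, \<open>L\<close> is its eigenvalue and \<open>v\<close> the first
  order approximation. Away from \<open>r\<close> the factor \<open>L - l s\<close> is bounded
  below, so the mass of \<open>x\<close> there is of order \<delta>^2 / g^2; unit length and sign
  then put \<open>x r\<close> within that order of 1. Hence \<open>x\<close> is the unit vector at
  \<open>r\<close> up to an error of order \<delta> / g, and applying \<open>d\<close> to this error
  yields a quadratic term.\<close>

lemma eigen_perturbation:
  fixes x l :: "nat \<Rightarrow> real" and d :: "nat \<Rightarrow> nat \<Rightarrow> real"
  assumes x: "(\<lambda>s. (x s)\<^sup>2) sums 1" and xr: "0 \<le> x r"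
    and d: "hilbert_schmidt_le d (\<delta>\<^sup>2)" and d_row: "\<And>s. d r s = d s r"
    and eig: "\<And>s. (L - l s) * x s = (\<Sum>p. d p s * x p)"
    and L: "\<bar>L - l r\<bar> \<le> \<delta>" and gap: "\<And>s. s \<noteq> r \<Longrightarrow> g \<le> \<bar>l r - l s\<bar>"
    and g: "0 < g" and \<delta>: "0 \<le> \<delta>" "\<delta> \<le> g / 4"
  defines "v \<equiv> \<lambda>s. (if s = r then 1 else 0) + (if s = r then 0 else d r s / (l r - l s))"
  shows "\<bar>L - l r - d r r\<bar> \<le> 4 * \<delta>\<^sup>2 / g"
    and "summable (\<lambda>s. (x s - v s)\<^sup>2)" "(\<Sum>s. (x s - v s)\<^sup>2) \<le> 88 * \<delta>^4 / g^4"
proof -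
  \<comment> \<open>The deviation of \<open>x\<close> from the unit vector at \<open>r\<close>;
    \<open>\<zeta>\<close> is its image under \<open>d\<close>. Its squared length is
    \<open>2 - 2 * x r\<close> because \<open>x\<close> is a unit vector.\<close>
  define \<xi> where "\<xi> s = x s - (if s = r then 1 else 0)" for s
  define \<zeta> where "\<zeta> s = (\<Sum>p. d p s * \<xi> p)" for s
  define z where "z s = (\<Sum>p. d p s * x p)" for s
  have x': "summable (\<lambda>s. (x s)\<^sup>2)" "(\<Sum>s. (x s)\<^sup>2) = 1" using x by (auto simp: sums_iff)
  have one: "(\<lambda>s. if s = r then f s else 0) sums f r" for f :: "nat \<Rightarrow> real"
    using sums_single[of r f] by simp
  have "(\<lambda>s. (x s)\<^sup>2 + (if s = r then 1 - 2 * x s else 0)) sums (1 + (1 - 2 * x r))"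
    by (intro sums_add x one)
  moreover have "(\<lambda>s. (x s)\<^sup>2 + (if s = r then 1 - 2 * x s else 0)) = (\<lambda>s. (\<xi> s)\<^sup>2)"
    by (auto simp: \<xi>_def fun_eq_iff power2_eq_square algebra_simps)
  ultimately have \<xi>: "summable (\<lambda>s. (\<xi> s)\<^sup>2)" "(\<Sum>s. (\<xi> s)\<^sup>2) = 2 - 2 * x r"
    by (auto simp: sums_iff)
  have z: "summable (\<lambda>s. (z s)\<^sup>2)" "(\<Sum>s. (z s)\<^sup>2) \<le> \<delta>\<^sup>2"
    using hilbert_schmidt_le_apply[OF d x'(1)] x'(2) unfolding z_def by auto
  have \<zeta>: "summable (\<lambda>s. (\<zeta> s)\<^sup>2)" "(\<Sum>s. (\<zeta> s)\<^sup>2) \<le> \<delta>\<^sup>2 * (2 - 2 * x r)"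
    using hilbert_schmidt_le_apply[OF d \<xi>(1)] \<xi>(2) unfolding \<zeta>_def by auto
  have u: "summable (\<lambda>s. (d r s)\<^sup>2)" "(\<Sum>s. (d r s)\<^sup>2) \<le> \<delta>\<^sup>2"
  proof -
    \<comment> \<open>Row \<open>r\<close> is the image of the unit vector at \<open>r\<close>, so
      the bound for applying \<open>d\<close> to a vector covers it.\<close>
    have dr: "(\<Sum>p. d p s * (if p = r then 1 else 0)) = d r s" for s
    proof -
      have "(\<lambda>p. d p s * (if p = r then 1 else 0)) = (\<lambda>p. if p = r then d p s else 0)" by auto
      then show ?thesis using one[of "\<lambda>p. d p s"] by (simp add: sums_iff)
    qed
    have e2: "(\<lambda>p. (if p = r then 1 else 0 :: real)\<^sup>2) = (\<lambda>p. if p = r then 1 else 0)" by auto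
    have "summable (\<lambda>p. (if p = r then 1 else 0 :: real)\<^sup>2)" "(\<Sum>p. (if p = r then 1 else 0 :: real)\<^sup>2) = 1"
      unfolding e2 using one[of "\<lambda>_. 1"] by (auto simp: sums_iff)
    from hilbert_schmidt_le_apply(2,3)[OF d this(1)] this(2)
    show "summable (\<lambda>s. (d r s)\<^sup>2)" "(\<Sum>s. (d r s)\<^sup>2) \<le> \<delta>\<^sup>2" by (simp_all add: dr)
  qed
  have z_eq: "z s = d r s + \<zeta> s" for s
  proof -
    have "(\<lambda>p. (if p = r then d p s else 0) + d p s * \<xi> p) sums (d r s + \<zeta> s)"
      unfolding \<zeta>_def by (intro sums_add one summable_sums hilbert_schmidt_le_apply[OF d \<xi>(1)])
    moreover have "(\<lambda>p. (if p = r then d p s else 0) + d p s * \<xi> p) = (\<lambda>p. d p s * x p)"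
      by (auto simp: \<xi>_def algebra_simps)
    ultimately show ?thesis unfolding z_def by (simp add: sums_iff)
  qed
  have eig': "(L - l s) * x s = z s" for s using eig by (simp add: z_def)
  \<comment> \<open>\<open>L\<close> is at most g/4 away from \<open>l r\<close>, so 3g/4 of the gap
    remains; g/2 is enough.\<close>
  have Lgap: "g / 2 \<le> \<bar>L - l s\<bar>" if "s \<noteq> r" for s
    using gap[OF that] L \<delta> by linarith

  have x_off: "(\<Sum>s. if s = r then 0 else (x s)\<^sup>2) \<le> 4 * \<delta>\<^sup>2 / g\<^sup>2"
  proof -
    have "(if s = r then 0 else (x s)\<^sup>2) \<le> 4 / g\<^sup>2 * (z s)\<^sup>2" for s
    proof (cases "s = r")
      case False
      have "(g / 2)\<^sup>2 * (x s)\<^sup>2 \<le> \<bar>L - l s\<bar>\<^sup>2 * (x s)\<^sup>2"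
        using Lgap[OF False] g by (intro mult_right_mono power_mono) auto
      also have "\<dots> = (z s)\<^sup>2" by (simp add: power_mult_distrib flip: eig')
      finally show ?thesis using g False by (simp add: field_simps power2_eq_square)
    qed simp
    then have "(\<Sum>s. if s = r then 0 else (x s)\<^sup>2) \<le> (\<Sum>s. 4 / g\<^sup>2 * (z s)\<^sup>2)"
      by (intro suminf_le suminf_split_at x' summable_mult z)
    also have "\<dots> = 4 / g\<^sup>2 * (\<Sum>s. (z s)\<^sup>2)" by (rule suminf_mult[OF z(1)])
    also have "\<dots> \<le> 4 / g\<^sup>2 * \<delta>\<^sup>2" using z(2) by (intro mult_left_mono) auto
    finally show ?thesis by simp
  qed
  have xr2: "1 - (x r)\<^sup>2 \<le> 4 * \<delta>\<^sup>2 / g\<^sup>2"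
    using suminf_split_at(2)[OF x'(1), of r] x'(2) x_off by simp
  have xr_le: "x r \<le> 1"
  proof -
    have "(x r)\<^sup>2 \<le> 1\<^sup>2"
      using sum_le_suminf[OF x'(1), of "{r}"] x'(2) by simp
    then show ?thesis by (rule power2_le_imp_le) simp
  qed
  \<comment> \<open>The sign enters here: for \<open>x r\<close> between 0 and 1 the defect
    \<open>1 - x r\<close> is at most one minus the square of \<open>x r\<close>.\<close>
  have "(x r)\<^sup>2 \<le> x r" using xr xr_le by (simp add: power2_eq_square mult_left_le)
  then have xr1: "1 - x r \<le> 4 * \<delta>\<^sup>2 / g\<^sup>2" using xr2 by simp
  have \<zeta>2: "(\<Sum>s. (\<zeta> s)\<^sup>2) \<le> 8 * \<delta>^4 / g\<^sup>2"
  proof -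
    have "\<delta>\<^sup>2 * (2 - 2 * x r) \<le> \<delta>\<^sup>2 * (8 * \<delta>\<^sup>2 / g\<^sup>2)"
      using xr1 by (intro mult_left_mono) auto
    then show ?thesis using \<zeta>(2) by (simp add: power2_eq_square power4_eq_xxxx algebra_simps)
  qed

  show "\<bar>L - l r - d r r\<bar> \<le> 4 * \<delta>\<^sup>2 / g"
  proof -
    have "(\<zeta> r)\<^sup>2 \<le> (\<Sum>s. (\<zeta> s)\<^sup>2)" using sum_le_suminf[OF \<zeta>(1), of "{r}"] by simp
    \<comment> \<open>8 is rounded up to the perfect square 9, whose root is the 3 below; together
      with a further 1 this gives the constant 4.\<close>
    also have "\<dots> \<le> 9 * \<delta>^4 / g\<^sup>2"
      by (rule order_trans[OF \<zeta>2]) (intro divide_right_mono mult_right_mono; simp)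
    also have "\<dots> = (3 * \<delta>\<^sup>2 / g)\<^sup>2"
      by (simp add: power_divide power_mult_distrib)
    finally have "\<bar>\<zeta> r\<bar> \<le> 3 * \<delta>\<^sup>2 / g"
      using g by (metis abs_le_square_iff abs_of_nonneg divide_nonneg_pos mult_nonneg_nonneg zero_le_numeral zero_le_power2)
    moreover have "\<bar>(L - l r) * (1 - x r)\<bar> \<le> \<delta>\<^sup>2 / g"
    proof -
      have "\<bar>(L - l r) * (1 - x r)\<bar> \<le> \<delta> * (4 * \<delta>\<^sup>2 / g\<^sup>2)"
        unfolding abs_mult using L xr1 xr_le \<delta> by (intro mult_mono) auto
      also have "\<dots> = (4 * \<delta> / g) * (\<delta>\<^sup>2 / g)" by (simp add: power2_eq_square)
      \<comment> \<open>The cubic term is absorbed by \<delta> \<le> g/4.\<close>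
      also have "\<dots> \<le> 1 * (\<delta>\<^sup>2 / g)" using \<delta> g by (intro mult_right_mono) (auto simp: field_simps)
      finally show ?thesis by simp
    qed
    moreover have "L - l r - d r r = (L - l r) * (1 - x r) + \<zeta> r"
      using eig'[of r] z_eq[of r] by (simp add: algebra_simps)
    ultimately show ?thesis by (simp add: abs_le_iff)
  qed

  have pointwise: "(x s - v s)\<^sup>2 \<le> (if s = r then (1 - x s)\<^sup>2 else 0) + (8 / g\<^sup>2 * (\<zeta> s)\<^sup>2 + 8 * \<delta>\<^sup>2 / g^4 * (d r s)\<^sup>2)" for s
  proof (cases "s = r")
    case True
    then have "(x s - v s)\<^sup>2 = (1 - x s)\<^sup>2" by (simp add: v_def power2_commute)
    then show ?thesis using True by simp
  next
    case False
    have nz: "L - l s \<noteq> 0" "l r - l s \<noteq> 0" using Lgap[OF False] gap[OF False] g by auto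
    have "x s = (d r s + \<zeta> s) / (L - l s)" using eig'[of s] z_eq[of s] nz by (simp add: field_simps)
    \<comment> \<open>The second summand is the cost of replacing \<open>L\<close> by
      \<open>l r\<close> in the denominator: a difference of two reciprocals, of order \<delta> /
      g^2.\<close>
    then have "x s - v s = \<zeta> s / (L - l s) + d r s * ((l r - L) / ((L - l s) * (l r - l s)))"
      using False nz by (simp add: v_def divide_simps) (simp add: algebra_simps)
    then have "(x s - v s)\<^sup>2 \<le> 2 * (\<zeta> s / (L - l s))\<^sup>2 + 2 * (d r s * ((l r - L) / ((L - l s) * (l r - l s))))\<^sup>2"
      by (simp add: power2_add_le)
    also have "\<dots> \<le> 2 * (4 / g\<^sup>2 * (\<zeta> s)\<^sup>2) + 2 * ((d r s)\<^sup>2 * (4 * \<delta>\<^sup>2 / g^4))"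
    proof (intro add_mono mult_left_mono)
      have "(g / 2)\<^sup>2 \<le> \<bar>L - l s\<bar>\<^sup>2" using Lgap[OF False] g by (intro power_mono) auto
      then have b1: "1 / (L - l s)\<^sup>2 \<le> 4 / g\<^sup>2"
        using g nz by (simp add: divide_simps)
      then show "(\<zeta> s / (L - l s))\<^sup>2 \<le> 4 / g\<^sup>2 * (\<zeta> s)\<^sup>2"
        using mult_right_mono[OF b1, of "(\<zeta> s)\<^sup>2"] by (simp add: power_divide)
      have "g\<^sup>2 \<le> \<bar>l r - l s\<bar>\<^sup>2" using gap[OF False] g by (intro power_mono) auto
      then have b2: "1 / (l r - l s)\<^sup>2 \<le> 1 / g\<^sup>2"
        using g nz by (simp add: divide_simps)
      have b3: "(l r - L)\<^sup>2 \<le> \<delta>\<^sup>2" using L by (simp add: abs_le_square_iff[symmetric] abs_minus_commute)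
      have "((l r - L) / ((L - l s) * (l r - l s)))\<^sup>2 = (l r - L)\<^sup>2 * (1 / (L - l s)\<^sup>2 * (1 / (l r - l s)\<^sup>2))"
        by (simp add: power_divide power_mult_distrib)
      also have "\<dots> \<le> \<delta>\<^sup>2 * (4 / g\<^sup>2 * (1 / g\<^sup>2))"
        using b1 b2 b3 by (intro mult_mono) auto
      also have "\<dots> = 4 * \<delta>\<^sup>2 / g^4" by (simp add: power4_eq_xxxx power2_eq_square mult_ac)
      finally show "(d r s * ((l r - L) / ((L - l s) * (l r - l s))))\<^sup>2 \<le> (d r s)\<^sup>2 * (4 * \<delta>\<^sup>2 / g^4)"
        unfolding power_mult_distrib by (intro mult_left_mono) auto
    qed auto
    finally show ?thesis using False by (simp add: mult_ac)
  qed
  have S: "summable (\<lambda>s. (if s = r then (1 - x s)\<^sup>2 else 0) + (8 / g\<^sup>2 * (\<zeta> s)\<^sup>2 + 8 * \<delta>\<^sup>2 / g^4 * (d r s)\<^sup>2))"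
    using one[of "\<lambda>s. (1 - x s)\<^sup>2"] by (intro summable_add summable_mult \<zeta> u) (auto simp: sums_iff)
  show S': "summable (\<lambda>s. (x s - v s)\<^sup>2)"
    by (rule summable_comparison_test'[OF S, of 0]) (use pointwise in simp)
  have "(\<Sum>s. (x s - v s)\<^sup>2) \<le> (\<Sum>s. (if s = r then (1 - x s)\<^sup>2 else 0) + (8 / g\<^sup>2 * (\<zeta> s)\<^sup>2 + 8 * \<delta>\<^sup>2 / g^4 * (d r s)\<^sup>2))"
    by (intro suminf_le pointwise S S')
  also have "\<dots> = (1 - x r)\<^sup>2 + (8 / g\<^sup>2 * (\<Sum>s. (\<zeta> s)\<^sup>2) + 8 * \<delta>\<^sup>2 / g^4 * (\<Sum>s. (d r s)\<^sup>2))"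
    by (intro sums_unique[symmetric] sums_add one sums_mult summable_sums \<zeta> u)
  also have "\<dots> \<le> (4 * \<delta>\<^sup>2 / g\<^sup>2)\<^sup>2 + (8 / g\<^sup>2 * (8 * \<delta>^4 / g\<^sup>2) + 8 * \<delta>\<^sup>2 / g^4 * \<delta>\<^sup>2)"
    using xr1 xr_le \<zeta>2 u(2) by (intro add_mono mult_left_mono power_mono) auto
  \<comment> \<open>88 = 16 + 64 + 8: the defect at \<open>r\<close>, the quadratic term
    \<open>\<zeta>\<close> and the changed denominator.\<close>
  also have "\<dots> = 88 * \<delta>^4 / g^4"
    using g by (simp add: power_divide power_mult_distrib power4_eq_xxxx power2_eq_square field_simps)
  finally show "(\<Sum>s. (x s - v s)\<^sup>2) \<le> 88 * \<delta>^4 / g^4" .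
qed

section \<open>Homogeneous linear systems\<close>

text \<open>Gaussian elimination by induction on the equations. In both Weyl inequalities it
  supplies a nonzero combination of \<open>r + 1\<close> functions that is orthogonal to
  \<open>r\<close> given ones.\<close>

lemma homogeneous_system_nontrivial:
  fixes A :: "'k \<Rightarrow> 'j \<Rightarrow> real"
  assumes "finite J" "finite K" "card J < card K"
  shows "\<exists>a. (\<exists>k\<in>K. a k \<noteq> 0) \<and> (\<forall>j\<in>J. (\<Sum>k\<in>K. a k * A k j) = 0)"
  using assms
proof (induction J arbitrary: K A rule: finite_induct)
  case empty
  then obtain k where "k \<in> K" by (metis card_eq_0_iff ex_in_conv less_irrefl_nat card.empty)
  then show ?case by (intro exI[of _ "\<lambda>_. 1"]) auto
next
  case (insert j J)
  show ?case
  proof (cases "\<forall>k\<in>K. A k j = 0")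
    case True
    from insert.IH[of K A] insert.prems insert.hyps obtain a
      where "\<exists>k\<in>K. a k \<noteq> 0" "\<forall>j\<in>J. (\<Sum>k\<in>K. a k * A k j) = 0" by auto
    with True show ?thesis by (intro exI[of _ a]) auto
  next
    case False
    then obtain k0 where k0: "k0 \<in> K" "A k0 j \<noteq> 0" by auto
    \<comment> \<open>Equation \<open>j\<close> is solved for the pivot unknown \<open>k0\<close>
      and substituted into the others.\<close>
    define A' where "A' k i = A k i - A k j / A k0 j * A k0 i" for k i
    have "card J < card (K - {k0})" using insert.prems insert.hyps k0 by simp
    from insert.IH[of "K - {k0}" A', OF _ this] insert.prems obtain a where
      a: "\<exists>k\<in>K-{k0}. a k \<noteq> 0" "\<forall>j\<in>J. (\<Sum>k\<in>K-{k0}. a k * A' k j) = 0" by auto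
    define a' where "a' k = (if k = k0 then - (\<Sum>k\<in>K-{k0}. a k * A k j) / A k0 j else a k)" for k
    have eq: "(\<Sum>k\<in>K. a' k * A k i) = (\<Sum>k\<in>K-{k0}. a k * A' k i)" for i
    proof -
      have "(\<Sum>k\<in>K. a' k * A k i) = a' k0 * A k0 i + (\<Sum>k\<in>K-{k0}. a k * A k i)"
        using insert.prems k0 by (subst sum.remove[of K k0]) (auto simp: a'_def intro!: sum.cong)
      also have "a' k0 * A k0 i = - (\<Sum>k\<in>K-{k0}. a k * (A k j / A k0 j * A k0 i))"
        by (simp add: a'_def sum_distrib_left sum_divide_distrib sum_negf mult.commute mult.left_commute)
      finally show ?thesis by (simp add: A'_def sum_subtractf right_diff_distrib)
    qed
    have "A' k j = 0" for k using k0 by (simp add: A'_def)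
    then have "(\<Sum>k\<in>K. a' k * A k i) = 0" if "i \<in> insert j J" for i
      using a(2) that by (auto simp: eq)
    moreover have "\<exists>k\<in>K. a' k \<noteq> 0" using a(1) by (auto simp: a'_def)
    ultimately show ?thesis by blast
  qed
qed

text \<open>Bolzano-Weierstrass for one index after another; this is all the compactness that a
  finite rank operator requires.\<close>

lemma finite_family_convergent_subseq:
  fixes a :: "'i \<Rightarrow> nat \<Rightarrow> real"
  assumes "finite I" and "\<And>i k. i \<in> I \<Longrightarrow> \<bar>a i k\<bar> \<le> B"
  shows "\<exists>\<rho>::nat\<Rightarrow>nat. strict_mono \<rho> \<and> (\<forall>i\<in>I. \<exists>l. (\<lambda>k. a i (\<rho> k)) \<longlonglongrightarrow> l)"
  using assms
proof (induction I rule: finite_induct)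
  case empty
  show ?case by (intro exI[of _ id]) (auto simp: strict_mono_def)
next
  case (insert i I)
  then obtain \<rho> :: "nat \<Rightarrow> nat" where \<rho>: "strict_mono \<rho>" "\<forall>i\<in>I. \<exists>l. (\<lambda>k. a i (\<rho> k)) \<longlonglongrightarrow> l" by auto
  have "bounded (range (\<lambda>k. a i (\<rho> k)))"
    using insert.prems by (auto simp: bounded_iff intro!: exI[of _ B])
  then obtain l \<rho>' where \<rho>': "strict_mono \<rho>'" "((\<lambda>k. a i (\<rho> k)) \<circ> \<rho>') \<longlonglongrightarrow> l"
    using bounded_imp_convergent_subsequence by blast
  have "\<exists>l. (\<lambda>k. a j (\<rho> (\<rho>' k))) \<longlonglongrightarrow> l" if j: "j \<in> insert i I" for j
  proof (cases "j = i")
    case True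
    then show ?thesis using \<rho>'(2) by (auto simp: comp_def)
  next
    case False
    then obtain l where "(\<lambda>k. a j (\<rho> k)) \<longlonglongrightarrow> l" using \<rho>(2) j by auto
    from LIMSEQ_subseq_LIMSEQ[OF this \<rho>'(1)] show ?thesis by (auto simp: comp_def)
  qed
  then show ?case using \<rho>(1) \<rho>'(1)
    by (intro exI[of _ "\<rho> \<circ> \<rho>'"]) (auto simp: strict_mono_def)
qed

section \<open>Finite rank covariance operators\<close>

lemma eigensystem_antimono:
  assumes sys: "eigensystem k lam gam" and r: "1 \<le> r" and "r \<le> j"
  shows "lam j \<le> lam r"
  using \<open>r \<le> j\<close>
proof (induction j rule: dec_induct)
  case (step j)
  then have "lam (j + 1) \<le> lam j" using sys r by (auto simp: eigensystem_def)
  with step.IH show ?case by simp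
qed simp

text \<open>The empirical covariance operator is the instance with the centred observations and
  \<open>c\<close> equal to 1/n.\<close>

locale finite_rank =
  fixes Y :: "nat \<Rightarrow> real \<Rightarrow> real" and I :: "nat set" and c :: real
  assumes finite_I: "finite I" and Y_L2: "\<And>i. i \<in> I \<Longrightarrow> Y i \<in> L2" and c_nonneg: "0 \<le> c"
begin

definition cov_op :: "(real \<Rightarrow> real) \<Rightarrow> real \<Rightarrow> real" where
  "cov_op v t = (\<Sum>i\<in>I. (c * ip (Y i) v) * Y i t)"

definition cov_form :: "(real \<Rightarrow> real) \<Rightarrow> (real \<Rightarrow> real) \<Rightarrow> real" where
  "cov_form v w = (\<Sum>i\<in>I. c * ip (Y i) v * ip (Y i) w)"

lemma cov_op_L2: "cov_op v \<in> L2"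
  unfolding cov_op_def by (intro L2_sum L2_cmult Y_L2)

lemma ip_cov_op: "w \<in> L2 \<Longrightarrow> ip (cov_op v) w = cov_form v w"
  unfolding cov_op_def cov_form_def by (rule ip_lincomb_left) (auto intro: Y_L2)

lemma cov_form_commute: "cov_form v w = cov_form w v"
  by (simp add: cov_form_def mult_ac)

lemma cov_form_self: "cov_form v v = c * (\<Sum>i\<in>I. (ip (Y i) v)\<^sup>2)"
  by (simp add: cov_form_def power2_eq_square sum_distrib_left mult.assoc)

lemma cov_form_nonneg: "0 \<le> cov_form v v"
  unfolding cov_form_self by (intro mult_nonneg_nonneg sum_nonneg c_nonneg) simp

text \<open>Cauchy-Schwarz for the coordinate vectors of \<open>v\<close> and \<open>w\<close> with
  respect to the \<open>Y i\<close>; it will be applied with \<open>w\<close> the image of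
  \<open>v\<close>.\<close>

lemma cov_form_Cauchy_Schwarz: "(cov_form v w)\<^sup>2 \<le> cov_form v v * cov_form w w"
proof -
  have "(cov_form v w)\<^sup>2 = c\<^sup>2 * (\<Sum>i\<in>I. ip (Y i) v * ip (Y i) w)\<^sup>2"
    by (simp add: cov_form_def sum_distrib_left mult.assoc flip: power_mult_distrib)
  also have "\<dots> \<le> c\<^sup>2 * ((\<Sum>i\<in>I. (ip (Y i) v)\<^sup>2) * (\<Sum>i\<in>I. (ip (Y i) w)\<^sup>2))"
    by (intro mult_left_mono Cauchy_Schwarz_ineq_sum) simp
  also have "\<dots> = cov_form v v * cov_form w w"
    by (simp add: cov_form_self power2_eq_square mult_ac)
  finally show ?thesis .
qed

lemma cov_form_le: "v \<in> L2 \<Longrightarrow> cov_form v v \<le> (c * (\<Sum>i\<in>I. ip (Y i) (Y i))) * ip v v"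
  unfolding cov_form_self mult.assoc sum_distrib_right
  by (intro mult_left_mono sum_mono ip_Cauchy_Schwarz Y_L2 c_nonneg)

lemma cov_form_lincomb_left:
  assumes "\<And>k. k \<in> K \<Longrightarrow> f k \<in> L2"
  shows "cov_form (\<lambda>t. \<Sum>k\<in>K. a k * f k t) w = (\<Sum>k\<in>K. a k * cov_form (f k) w)"
proof -
  have "cov_form (\<lambda>t. \<Sum>k\<in>K. a k * f k t) w = (\<Sum>i\<in>I. \<Sum>k\<in>K. c * (a k * ip (Y i) (f k)) * ip (Y i) w)"
    unfolding cov_form_def
    by (intro sum.cong refl) (simp add: ip_lincomb_right assms Y_L2 sum_distrib_left sum_distrib_right)
  also have "\<dots> = (\<Sum>k\<in>K. a k * cov_form (f k) w)"
    unfolding cov_form_def by (subst sum.swap) (simp add: sum_distrib_left mult_ac)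
  finally show ?thesis .
qed

lemma int_op_eq_cov_op:
  assumes v: "v \<in> L2" and k: "\<And>t s. k t s = c * (\<Sum>i\<in>I. Y i t * Y i s)"
  shows "int_op k v t = cov_op v t"
proof -
  have "int_op k v t = (\<integral>s. (\<Sum>i\<in>I. (c * Y i t) * (Y i s * v s)) \<partial>unit_leb)"
    unfolding int_op_def k
    by (intro Bochner_Integration.integral_cong refl) (simp add: sum_distrib_left sum_distrib_right mult_ac)
  also have "\<dots> = (\<Sum>i\<in>I. (c * Y i t) * ip (Y i) v)"
    by (subst Bochner_Integration.integral_sum) (auto simp: ip_def intro!: L2_integrable_mult v Y_L2)
  finally show ?thesis by (simp add: cov_op_def mult_ac)
qed

text \<open>
  A maximising sequence for the quadratic form has, along a subsequence, convergent coordinates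
  with respect to the finitely many \<open>Y i\<close>; the images under the operator therefore
  converge, and their limit is an eigenfunction for the supremum.
\<close>

lemma exists_top_eigenfunction:
  fixes f :: "nat \<Rightarrow> real \<Rightarrow> real" and K :: "nat set"
  assumes f: "\<And>k. k \<in> K \<Longrightarrow> f k \<in> L2"
    and eig: "\<And>k t. k \<in> K \<Longrightarrow> t \<in> {0..1} \<Longrightarrow> cov_op (f k) t = L k * f k t"
    and v0: "v0 \<in> L2" "\<forall>k\<in>K. ip v0 (f k) = 0" and gt: "\<rho>0 * ip v0 v0 < cov_form v0 v0" and \<rho>0: "0 \<le> \<rho>0"
  shows "\<exists>\<rho> w. \<rho>0 < \<rho> \<and> w \<in> L2 \<and> (\<forall>k\<in>K. ip w (f k) = 0) \<and> 0 < ip w w \<and> (\<forall>t. cov_op w t = \<rho> * w t)"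
proof -
  define U where "U = {v \<in> L2. (\<forall>k\<in>K. ip v (f k) = 0) \<and> ip v v = 1}"
  define \<rho> where "\<rho> = (SUP v\<in>U. cov_form v v)"
  have v0_pos: "0 < ip v0 v0"
  proof (rule ccontr)
    assume "\<not> 0 < ip v0 v0"
    then have "ip v0 v0 = 0" using ip_nonneg[of v0] by simp
    then show False using gt cov_form_le[OF v0(1)] by simp
  qed
  have normalise: "(\<lambda>t. (1 / sqrt (ip v v)) * v t) \<in> U"
      "cov_form (\<lambda>t. (1 / sqrt (ip v v)) * v t) (\<lambda>t. (1 / sqrt (ip v v)) * v t) = cov_form v v / ip v v"
    if "v \<in> L2" "\<forall>k\<in>K. ip v (f k) = 0" "0 < ip v v" for v
  proof -
    define b where "b = 1 / sqrt (ip v v)"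
    have b: "b * b * ip v v = 1" using that(3) by (simp add: b_def real_divide_square_eq)
    then have b': "b\<^sup>2 = 1 / ip v v" using that(3) by (simp add: power2_eq_square field_simps)
    show "(\<lambda>t. (1 / sqrt (ip v v)) * v t) \<in> U"
      using that b unfolding b_def[symmetric] U_def by (auto simp: L2_cmult ip_cmult_left ip_cmult_right)
    show "cov_form (\<lambda>t. (1 / sqrt (ip v v)) * v t) (\<lambda>t. (1 / sqrt (ip v v)) * v t) = cov_form v v / ip v v"
      unfolding b_def[symmetric] cov_form_self
      by (simp add: ip_cmult_right power_mult_distrib b' flip: sum_distrib_left sum_divide_distrib)
  qed
  have bdd: "bdd_above ((\<lambda>v. cov_form v v) ` U)"
    using cov_form_le by (intro bdd_aboveI[of _ "c * (\<Sum>i\<in>I. ip (Y i) (Y i))"]) (force simp: U_def)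
  have "\<rho>0 < cov_form v0 v0 / ip v0 v0" using gt v0_pos by (simp add: field_simps)
  also have "\<dots> \<le> \<rho>"
    using cSUP_upper[OF normalise(1)[OF v0 v0_pos] bdd] unfolding \<rho>_def normalise(2)[OF v0 v0_pos] .
  finally have \<rho>: "\<rho>0 < \<rho>" .
  have form_le: "cov_form v v \<le> \<rho> * ip v v" if v: "v \<in> L2" "\<forall>k\<in>K. ip v (f k) = 0" for v
  proof (cases "ip v v = 0")
    case True
    then show ?thesis using cov_form_le[OF v(1)] by simp
  next
    case False
    then have pos: "0 < ip v v" using ip_nonneg[of v] by simp
    have "cov_form v v / ip v v \<le> \<rho>"
      using cSUP_upper[OF normalise(1)[OF v pos] bdd] unfolding \<rho>_def normalise(2)[OF v pos] .
    then show ?thesis using pos by (simp add: field_simps)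
  qed
  have "\<exists>v\<in>U. \<rho> - 1 / real (Suc k) < cov_form v v" for k
  proof -
    have "U \<noteq> {}" using normalise(1)[OF v0 v0_pos] by auto
    moreover have "\<rho> - 1 / real (Suc k) < \<rho>" by simp
    ultimately show ?thesis unfolding \<rho>_def using less_cSUP_iff[OF _ bdd] by blast
  qed
  then obtain V where V: "\<And>k. V k \<in> U" "\<And>k. \<rho> - 1 / real (Suc k) < cov_form (V k) (V k)" by metis
  have VL2: "V k \<in> L2" and Vone: "ip (V k) (V k) = 1" and Vorth: "j \<in> K \<Longrightarrow> ip (V k) (f j) = 0" for k j
    using V(1)[of k] by (auto simp: U_def)
  define B where "B = (MAX i\<in>insert 0 I. ip (Y i) (Y i))"
  have a_bound: "\<bar>ip (Y i) (V k)\<bar> \<le> 1 + B" if "i \<in> I" for i k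
  proof -
    have "\<bar>ip (Y i) (V k)\<bar>\<^sup>2 \<le> ip (Y i) (Y i)"
      using ip_Cauchy_Schwarz[OF Y_L2[OF that] VL2[of k]] Vone by simp
    also have "\<dots> \<le> B" unfolding B_def using finite_I that by (intro Max_ge) auto
    finally have "\<bar>ip (Y i) (V k)\<bar>\<^sup>2 \<le> B" .
    moreover have "2 * \<bar>ip (Y i) (V k) * 1\<bar> \<le> (ip (Y i) (V k))\<^sup>2 + 1\<^sup>2" by (rule two_abs_mult_le)
    ultimately show ?thesis by auto
  qed
  obtain \<theta> :: "nat \<Rightarrow> nat" where \<theta>: "strict_mono \<theta>"
    and "\<forall>i\<in>I. \<exists>l. (\<lambda>k. ip (Y i) (V (\<theta> k))) \<longlonglongrightarrow> l"
    using finite_family_convergent_subseq[OF finite_I, of "\<lambda>i k. ip (Y i) (V k)"] a_bound by blast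
  then obtain a where a: "\<And>i. i \<in> I \<Longrightarrow> (\<lambda>k. ip (Y i) (V (\<theta> k))) \<longlonglongrightarrow> a i" by metis
  \<comment> \<open>The limit of the images, written as a combination of the \<open>Y i\<close>; the
    maximisers themselves are not claimed to converge. The explicit formula makes the eigenvalue
    equation hold at every argument.\<close>
  define w where "w t = (\<Sum>i\<in>I. (c * a i) * Y i t)" for t
  have w: "w \<in> L2" unfolding w_def by (intro L2_sum L2_cmult Y_L2)
  have ip_w: "(\<lambda>k. ip (cov_op (V (\<theta> k))) u) \<longlonglongrightarrow> ip w u" if "u \<in> L2" for u
    unfolding cov_op_def w_def using that Y_L2
    by (simp add: ip_lincomb_left) (intro tendsto_intros a)
  have residual: "(\<lambda>k. ip (\<lambda>t. cov_op (V (\<theta> k)) t - \<rho> * V (\<theta> k) t) (\<lambda>t. cov_op (V (\<theta> k)) t - \<rho> * V (\<theta> k) t)) \<longlonglongrightarrow> 0"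
  proof -
    \<comment> \<open>The squared residual is at most \<rho> times the shortfall of the form from
      its supremum: almost maximisers are almost eigenfunctions.\<close>
    have le: "ip (\<lambda>t. cov_op (V k) t - \<rho> * V k t) (\<lambda>t. cov_op (V k) t - \<rho> * V k t) \<le> \<rho> * (1 / real (Suc k))" for k
    proof -
      define TT where "TT = ip (cov_op (V k)) (cov_op (V k))"
      have TT: "TT = cov_form (V k) (cov_op (V k))" unfolding TT_def by (rule ip_cov_op) (rule cov_op_L2)
      \<comment> \<open>By symmetry the orthogonal complement of eigenfunctions is invariant under
        the operator, so \<open>form_le\<close> applies to the image.\<close>
      have "ip (cov_op (V k)) (f j) = 0" if "j \<in> K" for j
      proof -
        have "ip (cov_op (V k)) (f j) = ip (cov_op (f j)) (V k)"
          by (simp add: ip_cov_op f that VL2 cov_form_commute)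
        also have "\<dots> = ip (\<lambda>t. L j * f j t) (V k)"
          unfolding ip_def using eig[OF that] by (intro Bochner_Integration.integral_cong) auto
        finally show ?thesis using Vorth[OF that, of k] by (simp add: ip_cmult_left ip_commute)
      qed
      then have "cov_form (cov_op (V k)) (cov_op (V k)) \<le> \<rho> * TT"
        unfolding TT_def by (intro form_le cov_op_L2 ballI) blast
      moreover have "TT * TT \<le> cov_form (V k) (V k) * cov_form (cov_op (V k)) (cov_op (V k))"
        using cov_form_Cauchy_Schwarz[of "V k" "cov_op (V k)"] by (simp add: TT power2_eq_square)
      ultimately have "TT * TT \<le> cov_form (V k) (V k) * (\<rho> * TT)"
        by (meson cov_form_nonneg mult_left_mono order_trans)
      moreover have "0 \<le> TT" unfolding TT_def by (rule ip_nonneg)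
      \<comment> \<open>One factor \<open>TT\<close> is cancelled; for \<open>TT = 0\<close> the
        claim is nonnegativity of the form.\<close>
      ultimately have TT_le: "TT \<le> \<rho> * cov_form (V k) (V k)"
        using \<rho> \<rho>0 cov_form_nonneg[of "V k"] by (cases "TT = 0") (auto simp: mult_ac)
      have "ip (\<lambda>t. cov_op (V k) t - \<rho> * V k t) (\<lambda>t. cov_op (V k) t - \<rho> * V k t)
          = TT - 2 * \<rho> * cov_form (V k) (V k) + \<rho>\<^sup>2"
        unfolding TT_def
        by (simp add: ip_diff_left ip_diff_right L2_diff L2_cmult cov_op_L2 VL2 ip_cmult_left ip_cmult_right Vone
            ip_commute[of "V k" "cov_op (V k)"] ip_cov_op[OF VL2] power2_eq_square right_diff_distrib)
      also have "\<dots> \<le> \<rho> * (\<rho> - cov_form (V k) (V k))" using TT_le by (simp add: power2_eq_square algebra_simps)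
      also have "\<dots> \<le> \<rho> * (1 / real (Suc k))"
        using V(2)[of k] \<rho> \<rho>0 by (intro mult_left_mono) auto
      finally show ?thesis .
    qed
    have "(\<lambda>k. \<rho> * (1 / real (Suc k))) \<longlonglongrightarrow> \<rho> * 0"
      by (intro tendsto_mult tendsto_const lim_1_over_n[THEN LIMSEQ_Suc])
    then have lim: "(\<lambda>k. \<rho> * (1 / real (Suc k))) \<longlonglongrightarrow> 0" by simp
    have "(\<lambda>k. ip (\<lambda>t. cov_op (V k) t - \<rho> * V k t) (\<lambda>t. cov_op (V k) t - \<rho> * V k t)) \<longlonglongrightarrow> 0"
      by (rule tendsto_sandwich[OF _ _ tendsto_const lim]) (use le in \<open>auto intro!: always_eventually ip_nonneg\<close>)
    from LIMSEQ_subseq_LIMSEQ[OF this \<theta>] show ?thesis by (simp add: comp_def)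
  qed
  \<comment> \<open>The coordinate of the images along \<open>Y i\<close> tends to that of
    \<open>w\<close>; as the residuals vanish, it also tends to \<rho> times the limit of the
    coordinates of the maximisers.\<close>
  have ip_Y_w: "ip (Y i) w = \<rho> * a i" if i: "i \<in> I" for i
  proof (rule LIMSEQ_unique)
    show "(\<lambda>k. ip (cov_op (V (\<theta> k))) (Y i)) \<longlonglongrightarrow> ip (Y i) w"
      using ip_w[OF Y_L2[OF i]] by (simp add: ip_commute)
    have "(\<lambda>k. ip (\<lambda>t. cov_op (V (\<theta> k)) t - \<rho> * V (\<theta> k) t) (Y i)) \<longlonglongrightarrow> 0"
    proof (rule Lim_null_comparison[OF always_eventually, rule_format])
      fix k
      show "norm (ip (\<lambda>t. cov_op (V (\<theta> k)) t - \<rho> * V (\<theta> k) t) (Y i))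
        \<le> sqrt (ip (\<lambda>t. cov_op (V (\<theta> k)) t - \<rho> * V (\<theta> k) t) (\<lambda>t. cov_op (V (\<theta> k)) t - \<rho> * V (\<theta> k) t) * ip (Y i) (Y i))"
        by (auto intro!: real_le_rsqrt ip_Cauchy_Schwarz L2_diff L2_cmult cov_op_L2 VL2 Y_L2 i)
      have "(\<lambda>k. sqrt (ip (\<lambda>t. cov_op (V (\<theta> k)) t - \<rho> * V (\<theta> k) t) (\<lambda>t. cov_op (V (\<theta> k)) t - \<rho> * V (\<theta> k) t) * ip (Y i) (Y i)))
        \<longlonglongrightarrow> sqrt (0 * ip (Y i) (Y i))" by (intro tendsto_intros residual)
      then show "(\<lambda>k. sqrt (ip (\<lambda>t. cov_op (V (\<theta> k)) t - \<rho> * V (\<theta> k) t) (\<lambda>t. cov_op (V (\<theta> k)) t - \<rho> * V (\<theta> k) t) * ip (Y i) (Y i)))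
        \<longlonglongrightarrow> 0" by simp
    qed
    from tendsto_add[OF this tendsto_mult[OF tendsto_const a[OF i], of \<rho>]]
    show "(\<lambda>k. ip (cov_op (V (\<theta> k))) (Y i)) \<longlonglongrightarrow> \<rho> * a i"
      by (simp add: ip_diff_left L2_cmult cov_op_L2 VL2 Y_L2 i ip_cmult_left ip_commute[of "V _" "Y i"])
  qed
  have "cov_op w t = \<rho> * w t" for t
    unfolding cov_op_def w_def[of t] sum_distrib_left by (intro sum.cong refl) (simp add: ip_Y_w)
  moreover have "ip w (f j) = 0" if j: "j \<in> K" for j
  proof (rule LIMSEQ_unique[OF ip_w[OF f[OF j]]])
    have "ip (cov_op (V (\<theta> k))) (f j) = 0" for k
    proof -
      have "ip (cov_op (V (\<theta> k))) (f j) = ip (cov_op (f j)) (V (\<theta> k))"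
        by (simp add: ip_cov_op f j VL2 cov_form_commute)
      also have "\<dots> = ip (\<lambda>t. L j * f j t) (V (\<theta> k))"
        unfolding ip_def using eig[OF j] by (intro Bochner_Integration.integral_cong) auto
      finally show ?thesis using Vorth[OF j, of "\<theta> k"] by (simp add: ip_cmult_left ip_commute)
    qed
    then show "(\<lambda>k. ip (cov_op (V (\<theta> k))) (f j)) \<longlonglongrightarrow> 0" by simp
  qed
  moreover have "0 < ip w w"
  proof -
    have lim1: "(\<lambda>k. cov_form (V (\<theta> k)) (V (\<theta> k))) \<longlonglongrightarrow> c * (\<Sum>i\<in>I. (a i)\<^sup>2)"
      unfolding cov_form_self by (intro tendsto_intros a)
    have "(\<lambda>k. \<rho> - 1 / real (Suc k)) \<longlonglongrightarrow> \<rho> - 0"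
      by (intro tendsto_diff tendsto_const lim_1_over_n[THEN LIMSEQ_Suc])
    from LIMSEQ_subseq_LIMSEQ[OF this \<theta>] have lim2: "(\<lambda>k. \<rho> - 1 / real (Suc (\<theta> k))) \<longlonglongrightarrow> \<rho>"
      by (simp add: comp_def)
    \<comment> \<open>The form survives the limit because it depends only on the convergent
      coordinates; being at least \<rho> > 0 in the limit, it excludes a vanishing
      \<open>w\<close>.\<close>
    have "\<rho> \<le> c * (\<Sum>i\<in>I. (a i)\<^sup>2)"
      by (rule LIMSEQ_le[OF lim2 lim1]) (use V(2) in \<open>auto intro: less_imp_le\<close>)
    moreover have "ip w w = \<rho> * (c * (\<Sum>i\<in>I. (a i)\<^sup>2))"
    proof -
      have "ip (\<lambda>t. \<Sum>i\<in>I. (c * a i) * Y i t) w = (\<Sum>i\<in>I. (c * a i) * ip (Y i) w)"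
        by (rule ip_lincomb_left) (rule Y_L2 w; assumption?)+
      also have "\<dots> = \<rho> * (c * (\<Sum>i\<in>I. (a i)\<^sup>2))"
        unfolding sum_distrib_left by (intro sum.cong refl) (simp add: ip_Y_w power2_eq_square)
      finally show ?thesis unfolding w_def[abs_def, symmetric] .
    qed
    ultimately show ?thesis using \<rho> \<rho>0 by (simp add: mult_pos_pos)
  qed
  ultimately show ?thesis using \<rho> w by blast
qed

text \<open>Half of the Courant-Fischer principle. Were the form larger,
  \<open>exists_top_eigenfunction\<close> would give an eigenfunction for some \<rho> above
  \<open>lam r\<close>, orthogonal to the first ones. It is orthogonal to the later ones as well,
  since their eigenvalues differ from \<rho>, and this contradicts the last clause of
  \<open>eigensystem\<close>.\<close>

lemma cov_form_le_eigenvalue: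
  assumes sys: "eigensystem k lam gam" and k: "\<And>t s. k t s = c * (\<Sum>i\<in>I. Y i t * Y i s)"
    and r: "1 \<le> r" and v: "v \<in> L2" "\<And>j. 1 \<le> j \<Longrightarrow> j < r \<Longrightarrow> ip v (gam j) = 0"
  shows "cov_form v v \<le> lam r * ip v v"
proof (rule ccontr)
  assume "\<not> cov_form v v \<le> lam r * ip v v"
  have gam: "gam j \<in> L2" if "1 \<le> j" for j
    using sys that by (auto simp: eigensystem_def eigenfunction_def)
  have eig: "cov_op (gam j) t = lam j * gam j t" if "1 \<le> j" "t \<in> {0..1}" for j t
  proof -
    have "int_op k (gam j) t = lam j * gam j t"
      using sys that by (auto simp: eigensystem_def eigenfunction_def)
    then show ?thesis using int_op_eq_cov_op[OF gam[OF that(1)] k, of t] by simp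
  qed
  have eig_ip: "cov_form (gam j) u = lam j * ip (gam j) u" if "1 \<le> j" "u \<in> L2" for j u
  proof -
    have "cov_form (gam j) u = ip (cov_op (gam j)) u" using ip_cov_op that by simp
    also have "\<dots> = ip (\<lambda>t. lam j * gam j t) u"
      unfolding ip_def using eig that by (intro Bochner_Integration.integral_cong) auto
    finally show ?thesis by (simp add: ip_cmult_left)
  qed
  \<comment> \<open>This keeps the new eigenvalue away from 0; the clause to be contradicted speaks
    only of nonzero eigenvalues.\<close>
  have "0 \<le> lam r"
    using eig_ip[OF r gam[OF r]] cov_form_nonneg[of "gam r"] sys r by (simp add: eigensystem_def)
  then obtain \<rho> w where \<rho>: "lam r < \<rho>" and w: "w \<in> L2" "\<forall>j\<in>{1..<r}. ip w (gam j) = 0" "0 < ip w w"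
    and w_eig: "\<And>t. cov_op w t = \<rho> * w t"
    using exists_top_eigenfunction[of "{1..<r}" gam lam v "lam r"] gam eig v \<open>\<not> _ \<le> _\<close>
    by (auto simp: not_le)
  have "ip w (gam j) = 0" if j: "1 \<le> j" for j
  proof (cases "j < r")
    case False
    have "lam j \<le> lam r"
      using eigensystem_antimono[OF sys r] False by simp
    then have "lam j < \<rho>" using \<rho> by simp
    have "\<rho> * ip w (gam j) = ip (\<lambda>t. \<rho> * w t) (gam j)" by (simp add: ip_cmult_left)
    also have "\<dots> = cov_form w (gam j)" using ip_cov_op[OF gam[OF j], of w] w_eig by (simp flip: w_eig)
    also have "\<dots> = lam j * ip w (gam j)" using eig_ip[OF j w(1)] by (simp add: cov_form_commute ip_commute)
    finally show ?thesis using \<open>lam j < \<rho>\<close> by simp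
  qed (use w j in auto)
  moreover have "eigenfunction k \<rho> w"
    unfolding eigenfunction_def using w w_eig int_op_eq_cov_op[OF w(1) k] ip_self_eq_0_iff[OF w(1)] by auto
  moreover have "\<rho> \<noteq> 0" using \<open>0 \<le> lam r\<close> \<rho> by simp
  ultimately show False using sys unfolding eigensystem_def by blast
qed

end

section \<open>Weyl's inequality and first order expansions for sample covariances\<close>

text \<open>\<open>dh\<close> is the matrix, in the population eigenbasis \<open>e\<close>, of the
  empirical minus the population covariance operator; \<delta> bounds its Hilbert-Schmidt
  norm.\<close>

locale sample_covariance = finite_rank Y I c + orthonormal_basis e
  for Y :: "nat \<Rightarrow> real \<Rightarrow> real" and I c and e :: "nat \<Rightarrow> real \<Rightarrow> real" +
  fixes k :: "real \<Rightarrow> real \<Rightarrow> real" and lamh :: "nat \<Rightarrow> real" and gamh :: "nat \<Rightarrow> real \<Rightarrow> real"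
    and l :: "nat \<Rightarrow> real" and \<delta> :: real and dh :: "nat \<Rightarrow> nat \<Rightarrow> real"
  assumes kernel: "\<And>t s. k t s = c * (\<Sum>i\<in>I. Y i t * Y i s)"
    and sys: "eigensystem k lamh gamh"
    and l_antimono: "\<And>p q. p \<le> q \<Longrightarrow> l q \<le> l p" and l_nonneg: "\<And>p. 0 \<le> l p"
    and dh_eq: "\<And>p q. dh p q = (\<Sum>i\<in>I. c * ip (Y i) (e p) * ip (Y i) (e q)) - (if p = q then l p else 0)"
    and hs: "hilbert_schmidt_le dh (\<delta>\<^sup>2)" and \<delta>: "0 \<le> \<delta>"
begin

abbreviation "G j \<equiv> gamh (Suc j)"
abbreviation "Lh j \<equiv> lamh (Suc j)"

lemma G_L2: "G j \<in> L2"
  using sys by (auto simp: eigensystem_def eigenfunction_def)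

lemma G_orthonormal: "ip (G i) (G j) = (if i = j then 1 else 0)"
  using sys by (auto simp: eigensystem_def)

lemma cov_form_G: "v \<in> L2 \<Longrightarrow> cov_form (G j) v = Lh j * ip (G j) v"
proof -
  assume v: "v \<in> L2"
  have "cov_op (G j) t = Lh j * G j t" if "t \<in> {0..1}" for t
    using int_op_eq_cov_op[OF G_L2 kernel, of j t] sys that by (auto simp: eigensystem_def eigenfunction_def)
  then have "ip (cov_op (G j)) v = ip (\<lambda>t. Lh j * G j t) v"
    unfolding ip_def by (intro Bochner_Integration.integral_cong) auto
  then show ?thesis by (simp add: ip_cov_op[OF v] ip_cmult_left)
qed

lemma summable_coefficients: "v \<in> L2 \<Longrightarrow> summable (\<lambda>p. (ip v (e p))\<^sup>2)"
  using Parseval_square sums_summable by blast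

text \<open>Parseval's identity for each inner product of \<open>Y i\<close> with \<open>v\<close>
  turns the operator into its matrix.\<close>

lemma cov_form_basis:
  assumes v: "v \<in> L2"
  shows "cov_form v (e q) = l q * ip v (e q) + (\<Sum>p. dh p q * ip v (e p))"
proof -
  have "(\<lambda>p. \<Sum>i\<in>I. c * (ip (Y i) (e p) * ip v (e p)) * ip (Y i) (e q)) sums cov_form v (e q)"
    unfolding cov_form_def by (intro sums_sum sums_mult sums_mult2 Parseval v Y_L2)
  moreover have "(\<lambda>p. if p = q then l q * ip v (e q) else 0) sums (l q * ip v (e q))"
    by (rule sums_single)
  ultimately have "(\<lambda>p. (\<Sum>i\<in>I. c * (ip (Y i) (e p) * ip v (e p)) * ip (Y i) (e q)) -
      (if p = q then l q * ip v (e q) else 0)) sums (cov_form v (e q) - l q * ip v (e q))"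
    by (rule sums_diff)
  moreover have "(\<Sum>i\<in>I. c * (ip (Y i) (e p) * ip v (e p)) * ip (Y i) (e q)) -
      (if p = q then l q * ip v (e q) else 0) = dh p q * ip v (e p)" for p
    by (simp add: dh_eq left_diff_distrib right_diff_distrib sum_distrib_left mult_ac)
  ultimately show ?thesis by (simp add: sums_iff)
qed

text \<open>In coordinates the form is a diagonal one plus the quadratic form of \<open>dh\<close>,
  and Cauchy-Schwarz bounds the latter by the operator norm.\<close>

lemma cov_form_expansion:
  assumes v: "v \<in> L2"
  shows "summable (\<lambda>q. l q * (ip v (e q))\<^sup>2)"
    and "\<bar>cov_form v v - (\<Sum>q. l q * (ip v (e q))\<^sup>2)\<bar> \<le> \<delta> * ip v v"
proof -
  let ?z = "\<lambda>q. \<Sum>p. dh p q * ip v (e p)"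
  have "(\<lambda>q. ip (cov_op v) (e q) * ip v (e q)) sums ip (cov_op v) v"
    by (intro Parseval cov_op_L2 v)
  then have 1: "(\<lambda>q. (l q * ip v (e q) + ?z q) * ip v (e q)) sums cov_form v v"
    by (simp add: ip_cov_op v basis_L2 cov_form_basis)
  have n: "(\<Sum>q. (ip v (e q))\<^sup>2) = ip v v" using Parseval_square[OF v] by (simp add: sums_iff)
  note z = hilbert_schmidt_le_apply[OF hs summable_coefficients[OF v], unfolded n]
  note cs = suminf_Cauchy_Schwarz[OF z(2) summable_coefficients[OF v], unfolded n]
  have "(\<lambda>q. (l q * ip v (e q) + ?z q) * ip v (e q) - ?z q * ip v (e q)) sums (cov_form v v - (\<Sum>q. ?z q * ip v (e q)))"
    by (intro sums_diff 1 summable_sums cs)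
  then have "(\<lambda>q. l q * (ip v (e q))\<^sup>2) sums (cov_form v v - (\<Sum>q. ?z q * ip v (e q)))"
    by (simp add: algebra_simps power2_eq_square)
  then show "summable (\<lambda>q. l q * (ip v (e q))\<^sup>2)"
    and "\<bar>cov_form v v - (\<Sum>q. l q * (ip v (e q))\<^sup>2)\<bar> \<le> \<delta> * ip v v"
  proof (simp_all add: sums_iff)
    have "(\<Sum>q. ?z q * ip v (e q))\<^sup>2 \<le> (\<delta>\<^sup>2 * ip v v) * ip v v"
      using cs(2) mult_right_mono[OF z(3) ip_nonneg[of v]] by (rule order_trans)
    also have "\<dots> = (\<delta> * ip v v)\<^sup>2" by (simp add: power2_eq_square)
    finally show "\<bar>\<Sum>q. ?z q * ip v (e q)\<bar> \<le> \<delta> * ip v v"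
      using \<delta> ip_nonneg[of v] by (subst (asm) power2_le_iff_abs_le) auto
  qed
qed

lemma orthonormal_lincomb:
  assumes f: "\<And>j. f j \<in> L2" "\<And>i j. ip (f i) (f j) = (if i = j then 1 else 0)"
  shows "ip (\<lambda>t. \<Sum>j\<le>(r::nat). a j * f j t) (f i) = (if i \<le> r then a i else 0)"
    "ip (\<lambda>t. \<Sum>j\<le>r. a j * f j t) (\<lambda>t. \<Sum>j\<le>r. a j * f j t) = (\<Sum>j\<le>r. (a j)\<^sup>2)"
proof -
  have L: "(\<lambda>t. \<Sum>j\<le>r. a j * f j t) \<in> L2" by (intro L2_sum L2_cmult f)
  show 1: "ip (\<lambda>t. \<Sum>j\<le>r. a j * f j t) (f i) = (if i \<le> r then a i else 0)" for i
  proof -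
    have "ip (\<lambda>t. \<Sum>j\<le>r. a j * f j t) (f i) = (\<Sum>j\<le>r. a j * ip (f j) (f i))"
      by (rule ip_lincomb_left) (rule f)+
    also have "\<dots> = (\<Sum>j\<le>r. if j = i then a j else 0)" by (intro sum.cong refl) (simp add: f)
    finally show ?thesis by simp
  qed
  have "ip (\<lambda>t. \<Sum>j\<le>r. a j * f j t) (\<lambda>t. \<Sum>j\<le>r. a j * f j t)
      = (\<Sum>j\<le>r. a j * ip (\<lambda>t. \<Sum>j\<le>r. a j * f j t) (f j))"
    by (rule ip_lincomb_right) (rule f L)+
  then show "ip (\<lambda>t. \<Sum>j\<le>r. a j * f j t) (\<lambda>t. \<Sum>j\<le>r. a j * f j t) = (\<Sum>j\<le>r. (a j)\<^sup>2)"
    unfolding 1 by (simp add: power2_eq_square)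
qed

text \<open>A nonzero \<open>v\<close> in the span of the first \<open>r + 1\<close> empirical
  eigenfunctions and orthogonal to the first \<open>r\<close> population ones has, per unit of
  squared norm, empirical form at least \<open>Lh r\<close> and population form at most
  \<open>l r\<close>.\<close>

lemma Weyl_upper: "Lh r \<le> l r + \<delta>"
proof -
  obtain a where a: "\<exists>j\<in>{..r}. a j \<noteq> 0" "\<forall>q\<in>{..<r}. (\<Sum>j\<in>{..r}. a j * ip (G j) (e q)) = 0"
    using homogeneous_system_nontrivial[of "{..<r}" "{..r}" "\<lambda>j q. ip (G j) (e q)"] by auto
  define v where "v t = (\<Sum>j\<le>r. a j * G j t)" for t
  have v: "v \<in> L2" unfolding v_def by (intro L2_sum L2_cmult G_L2)
  have vv: "ip v v = (\<Sum>j\<le>r. (a j)\<^sup>2)" and vG: "ip v (G j) = (if j \<le> r then a j else 0)" for j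
    unfolding v_def[abs_def] by (rule orthonormal_lincomb; simp add: G_L2 G_orthonormal)+
  have pos: "0 < ip v v" unfolding vv using a(1) by (auto intro!: sum_pos2)
  have v0: "ip v (e q) = 0" if "q < r" for q
    unfolding v_def[abs_def] using a(2) that by (subst ip_lincomb_left) (auto simp: G_L2 basis_L2)
  have "Lh r * ip v v \<le> cov_form v v"
  proof -
    have "Lh r \<le> Lh j" if "j \<le> r" for j using eigensystem_antimono[OF sys, of "Suc j" "Suc r"] that by simp
    then have "Lh r * ip v v \<le> (\<Sum>j\<le>r. Lh j * (a j)\<^sup>2)"
      unfolding vv sum_distrib_left by (intro sum_mono mult_right_mono) auto
    also have "\<dots> = (\<Sum>j\<le>r. a j * cov_form (G j) v)"
      by (intro sum.cong refl) (simp add: cov_form_G v ip_commute[of "G _" v] vG power2_eq_square)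
    also have "\<dots> = cov_form v v"
      by (subst (2) v_def[abs_def]) (simp add: cov_form_lincomb_left G_L2)
    finally show ?thesis .
  qed
  also have "cov_form v v \<le> (\<Sum>q. l q * (ip v (e q))\<^sup>2) + \<delta> * ip v v"
    using cov_form_expansion(2)[OF v] by (simp add: abs_le_iff)
  also have "(\<Sum>q. l q * (ip v (e q))\<^sup>2) \<le> (\<Sum>q. l r * (ip v (e q))\<^sup>2)"
  proof (intro suminf_le cov_form_expansion v summable_mult summable_coefficients)
    fix q show "l q * (ip v (e q))\<^sup>2 \<le> l r * (ip v (e q))\<^sup>2"
      using l_antimono[of r q] v0[of q] by (cases "q < r") (auto intro: mult_right_mono)
  qed
  also have "(\<Sum>q. l r * (ip v (e q))\<^sup>2) = l r * ip v v"
    using sums_mult[OF Parseval_square[OF v], of "l r"] by (simp add: sums_iff)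
  finally have "Lh r * ip v v \<le> (l r + \<delta>) * ip v v" by (simp add: algebra_simps)
  then show ?thesis using pos by (simp add: mult_le_cancel_right)
qed

text \<open>The roles in \<open>Weyl_upper\<close> are exchanged. The upper bound for the empirical
  form now comes from \<open>cov_form_le_eigenvalue\<close>, because the empirical eigenfunctions
  need not be complete.\<close>

lemma Weyl_lower: "l r - \<delta> \<le> Lh r"
proof -
  obtain a where a: "\<exists>j\<in>{..r}. a j \<noteq> 0" "\<forall>q\<in>{..<r}. (\<Sum>j\<in>{..r}. a j * ip (e j) (G q)) = 0"
    using homogeneous_system_nontrivial[of "{..<r}" "{..r}" "\<lambda>j q. ip (e j) (G q)"] by auto
  define v where "v t = (\<Sum>j\<le>r. a j * e j t)" for t
  have v: "v \<in> L2" unfolding v_def by (intro L2_sum L2_cmult basis_L2)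
  have vv: "ip v v = (\<Sum>j\<le>r. (a j)\<^sup>2)" and ve: "ip v (e j) = (if j \<le> r then a j else 0)" for j
    unfolding v_def[abs_def] by (rule orthonormal_lincomb; simp add: basis_L2 orthonormal)+
  have pos: "0 < ip v v" unfolding vv using a(1) by (auto intro!: sum_pos2)
  have "l r * ip v v = (\<Sum>q. l r * (ip v (e q))\<^sup>2)"
    using sums_mult[OF Parseval_square[OF v], of "l r"] by (simp add: sums_iff)
  also have "\<dots> \<le> (\<Sum>q. l q * (ip v (e q))\<^sup>2)"
  proof (intro suminf_le cov_form_expansion v summable_mult summable_coefficients)
    fix q show "l r * (ip v (e q))\<^sup>2 \<le> l q * (ip v (e q))\<^sup>2"
      using l_antimono[of q r] by (cases "q \<le> r") (auto intro: mult_right_mono simp: ve)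
  qed
  also have "\<dots> \<le> cov_form v v + \<delta> * ip v v"
    using cov_form_expansion(2)[OF v] by (simp add: abs_le_iff)
  also have "cov_form v v \<le> Lh r * ip v v"
  proof (rule cov_form_le_eigenvalue[OF sys kernel _ v])
    fix j :: nat assume j: "1 \<le> j" "j < Suc r"
    then obtain q where q: "j = Suc q" "q < r" by (cases j) auto
    show "ip v (gamh j) = 0"
      unfolding v_def[abs_def] using a(2) q by (subst ip_lincomb_left) (auto simp: G_L2 basis_L2)
  qed simp
  finally have "l r * ip v v \<le> (Lh r + \<delta>) * ip v v" by (simp add: algebra_simps)
  then have "l r \<le> Lh r + \<delta>" using pos by (simp add: mult_le_cancel_right)
  then show ?thesis by simp
qed

text \<open>The eigenvalue equation in coordinates results from evaluating the form at
  \<open>G r\<close> and \<open>e s\<close> in two ways; Weyl's inequalities locate the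
  eigenvalue.\<close>

lemma expansion:
  assumes gap: "\<And>s. s \<noteq> r \<Longrightarrow> g \<le> \<bar>l r - l s\<bar>" and g: "0 < g" "\<delta> \<le> g / 4"
    and sign: "0 \<le> ip (e r) (G r)"
  defines "v \<equiv> \<lambda>s. (if s = r then 1 else 0) + (if s = r then 0 else dh r s / (l r - l s))"
  shows "\<bar>Lh r - l r - dh r r\<bar> \<le> 4 * \<delta>\<^sup>2 / g"
    and "summable (\<lambda>s. (ip (G r) (e s) - v s)\<^sup>2)"
    and "(\<Sum>s. (ip (G r) (e s) - v s)\<^sup>2) \<le> 88 * \<delta>^4 / g^4"
proof -
  have 1: "(\<lambda>s. (ip (G r) (e s))\<^sup>2) sums 1" using Parseval_square[OF G_L2, of r] by (simp add: G_orthonormal)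
  have 2: "0 \<le> ip (G r) (e r)" using sign by (simp add: ip_commute)
  have 3: "dh r s = dh s r" for s by (auto simp: dh_eq mult_ac)
  have 4: "(Lh r - l s) * ip (G r) (e s) = (\<Sum>p. dh p s * ip (G r) (e p))" for s
    using cov_form_basis[OF G_L2, of r s] cov_form_G[OF basis_L2, of r s] by (simp add: algebra_simps)
  have 5: "\<bar>Lh r - l r\<bar> \<le> \<delta>" using Weyl_upper[of r] Weyl_lower[of r] by (simp add: abs_le_iff)
  note * = eigen_perturbation[where x="\<lambda>s. ip (G r) (e s)" and l=l and d=dh and L="Lh r",
      OF 1 2 hs 3 4 5 gap g(1) \<delta> g(2)]
  show "\<bar>Lh r - l r - dh r r\<bar> \<le> 4 * \<delta>\<^sup>2 / g"
    and "summable (\<lambda>s. (ip (G r) (e s) - v s)\<^sup>2)"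
    and "(\<Sum>s. (ip (G r) (e s) - v s)\<^sup>2) \<le> 88 * \<delta>^4 / g^4"
    using * unfolding v_def by simp_all
qed

end

section \<open>Deterministic bounds for a sample centred at its own average\<close>

lemma summable_ennreal_le:
  fixes f :: "nat \<Rightarrow> real"
  assumes "\<And>p. 0 \<le> f p" "(\<Sum>p. ennreal (f p)) \<le> ennreal B" "0 \<le> B"
  shows "summable f" "suminf f \<le> B"
proof -
  have "(\<Sum>p. ennreal (f p)) \<noteq> top" using assms(2) by (metis ennreal_neq_top neq_top_trans)
  then show s: "summable f" by (intro summable_suminf_not_top assms)
  then have "ennreal (suminf f) \<le> ennreal B" using assms by (simp add: suminf_ennreal2)
  then show "suminf f \<le> B" using assms(3) by simp
qed

text \<open>Expectations of double series are computed in the extended nonnegative reals, where sums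
  always exist; finiteness of the total recovers every real summability claim.\<close>

lemma hilbert_schmidt_leI:
  assumes "(\<Sum>q. \<Sum>p. ennreal ((d p q)\<^sup>2)) \<le> ennreal B" "0 \<le> B"
  shows "hilbert_schmidt_le d B"
proof -
  have "(\<Sum>p. ennreal ((d p q)\<^sup>2)) \<le> ennreal B" for q
  proof -
    have "(\<Sum>q\<in>{q}. \<Sum>p. ennreal ((d p q)\<^sup>2)) \<le> (\<Sum>q. \<Sum>p. ennreal ((d p q)\<^sup>2))"
      by (rule sum_le_suminf[OF summableI]) auto
    then have "(\<Sum>p. ennreal ((d p q)\<^sup>2)) \<le> (\<Sum>q. \<Sum>p. ennreal ((d p q)\<^sup>2))" by simp
    then show ?thesis using assms(1) by (rule order_trans)
  qed
  then have s: "summable (\<lambda>p. (d p q)\<^sup>2)" for q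
    by (intro summable_ennreal_le(1)[of _ B]) (auto simp: assms)
  then have eq: "(\<Sum>p. ennreal ((d p q)\<^sup>2)) = ennreal (\<Sum>p. (d p q)\<^sup>2)" for q
    by (simp add: suminf_ennreal2)
  have nn: "0 \<le> (\<Sum>p. (d p q)\<^sup>2)" for q by (intro suminf_nonneg s) simp
  have "(\<Sum>q. ennreal (\<Sum>p. (d p q)\<^sup>2)) \<le> ennreal B" using assms(1) unfolding eq .
  from summable_ennreal_le[OF nn this assms(2)] s show ?thesis
    unfolding hilbert_schmidt_le_def by blast
qed

text \<open>Deterministic core of both expansions. The entries of \<open>a\<close> use the
  \<open>Z i\<close> as they are, whereas the kernel is centred at their average; \<tau> controls
  the deviation of \<open>a\<close> and also the rank one correction for the centring. Only the
  coefficients of \<open>R\<close> are prescribed, so its norm is found by Parseval's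
  identity.\<close>

lemma sample_eigen_expansion:
  fixes Z :: "nat \<Rightarrow> real \<Rightarrow> real" and e :: "nat \<Rightarrow> real \<Rightarrow> real" and l :: "nat \<Rightarrow> real" and n :: nat
  assumes onb: "orthonormal_basis e" and n: "1 \<le> n" and Z: "\<And>i. 1 \<le> i \<Longrightarrow> Z i \<in> L2"
    and sys: "eigensystem k lamh gamh"
    and kernel: "\<And>t s. k t s = (1 / real n) * (\<Sum>i=1..n. (Z i t - (1 / real n) * (\<Sum>j=1..n. Z j t)) *
        (Z i s - (1 / real n) * (\<Sum>j=1..n. Z j s)))"
    and l: "\<And>p q. p \<le> q \<Longrightarrow> l q \<le> l p" "\<And>p. 0 \<le> l p"
    and gap: "\<And>s. s \<noteq> r \<Longrightarrow> g \<le> \<bar>l r - l s\<bar>" and g: "0 < g"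
    and sign: "0 \<le> ip (e r) (gamh (Suc r))"
  defines "a \<equiv> \<lambda>p q. (1 / real n) * (\<Sum>i=1..n. ip (Z i) (e p) * ip (Z i) (e q))"
  assumes small: "(\<Sum>q. \<Sum>p. ennreal ((a p q - (if p = q then l p else 0))\<^sup>2)) +
        (\<Sum>p. ennreal (((1 / real n) * (\<Sum>i=1..n. ip (Z i) (e p)))\<^sup>2)) \<le> ennreal \<tau>"
    and \<tau>: "0 \<le> \<tau>" "\<tau> \<le> 1" "\<tau> \<le> g\<^sup>2 / 32"
    and R: "R \<in> L2" "\<And>s. ip R (e s) = ip (gamh (Suc r)) (e s) - (if s = r then 1 else a s r / (l r - l s))"
  shows "\<bar>lamh (Suc r) - a r r\<bar> \<le> (8 / g + 1) * \<tau>" "ip R R \<le> (704 / g^4 + 2 / g\<^sup>2) * \<tau>\<^sup>2"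
proof -
  interpret orthonormal_basis e by (rule onb)
  define zb where "zb t = (1 / real n) * (\<Sum>j=1..n. Z j t)" for t
  define Y where "Y i t = Z i t - zb t" for i t
  define m where "m p = (1 / real n) * (\<Sum>i=1..n. ip (Z i) (e p))" for p
  define d where "d p q = a p q - (if p = q then l p else 0)" for p q
  define dh where "dh p q = d p q - m p * m q" for p q
  have n0: "real n \<noteq> 0" using n by simp
  have zb: "zb \<in> L2" unfolding zb_def by (intro L2_cmult L2_sum Z) simp
  have Y_L2: "Y i \<in> L2" if "i \<in> {1..n}" for i
    unfolding Y_def using that by (intro L2_diff zb Z) simp
  have Ye: "ip (Y i) (e p) = ip (Z i) (e p) - m p" if "i \<in> {1..n}" for i p
  proof -
    have "ip zb (e p) = m p"
      unfolding zb_def m_def ip_cmult_left by (subst ip_sum_left) (auto intro: Z basis_L2)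
    moreover have "ip (Y i) (e p) = ip (Z i) (e p) - ip zb (e p)"
      unfolding Y_def using that by (intro ip_diff_left zb Z basis_L2) simp
    ultimately show ?thesis by simp
  qed
  have small': "(\<Sum>q. \<Sum>p. ennreal ((d p q)\<^sup>2)) + (\<Sum>p. ennreal ((m p)\<^sup>2)) \<le> ennreal \<tau>"
    using small unfolding d_def m_def .
  then have m_le: "(\<Sum>p. ennreal ((m p)\<^sup>2)) \<le> ennreal \<tau>" by (rule order_trans[rotated]) simp
  then have m1: "(\<Sum>p. ennreal ((m p)\<^sup>2)) \<le> 1"
    using \<tau>(2) by (metis ennreal_1 ennreal_leI order_trans)
  have m_sum: "summable (\<lambda>p. (m p)\<^sup>2)" "(\<Sum>p. (m p)\<^sup>2) \<le> \<tau>"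
    using summable_ennreal_le[OF _ m_le \<tau>(1)] by auto
  have "(\<Sum>q. \<Sum>p. ennreal ((dh p q)\<^sup>2)) \<le> (\<Sum>q. \<Sum>p. 2 * ennreal ((d p q)\<^sup>2) + 2 * (ennreal ((m p)\<^sup>2) * ennreal ((m q)\<^sup>2)))"
  proof (intro suminf_le summableI)
    fix p q
    have "(dh p q)\<^sup>2 \<le> 2 * (d p q)\<^sup>2 + 2 * ((m p)\<^sup>2 * (m q)\<^sup>2)"
      unfolding dh_def using power2_add_le[of "d p q" "- (m p * m q)"] by (simp add: power_mult_distrib)
    then have "ennreal ((dh p q)\<^sup>2) \<le> ennreal (2 * (d p q)\<^sup>2 + 2 * ((m p)\<^sup>2 * (m q)\<^sup>2))" by (rule ennreal_leI)
    then show "ennreal ((dh p q)\<^sup>2) \<le> 2 * ennreal ((d p q)\<^sup>2) + 2 * (ennreal ((m p)\<^sup>2) * ennreal ((m q)\<^sup>2))"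
      by (simp add: ennreal_plus ennreal_mult)
  qed
  also have "\<dots> = 2 * (\<Sum>q. \<Sum>p. ennreal ((d p q)\<^sup>2)) + 2 * ((\<Sum>p. ennreal ((m p)\<^sup>2)) * (\<Sum>q. ennreal ((m q)\<^sup>2)))"
    by (simp add: suminf_add[OF summableI summableI, symmetric])
  \<comment> \<open>One of the two factors of the rank one part is bounded by 1, using \<tau> \<le>
    1, so that this part is linear in \<tau> too.\<close>
  also have "\<dots> \<le> 2 * (\<Sum>q. \<Sum>p. ennreal ((d p q)\<^sup>2)) + 2 * (1 * (\<Sum>q. ennreal ((m q)\<^sup>2)))"
    by (intro add_mono mult_left_mono mult_right_mono m1) auto
  also have "\<dots> = 2 * ((\<Sum>q. \<Sum>p. ennreal ((d p q)\<^sup>2)) + (\<Sum>p. ennreal ((m p)\<^sup>2)))"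
    by (simp add: distrib_left)
  also have "\<dots> \<le> 2 * ennreal \<tau>" by (intro mult_left_mono small') simp
  also have "\<dots> = ennreal ((sqrt (2 * \<tau>))\<^sup>2)" using \<tau>(1) by (simp add: ennreal_mult)
  finally have hs: "hilbert_schmidt_le dh ((sqrt (2 * \<tau>))\<^sup>2)" by (rule hilbert_schmidt_leI) simp
  interpret sample_covariance Y "{1..n}" "1 / real n" e k lamh gamh l "sqrt (2 * \<tau>)" dh
  proof
    fix p q :: nat
    have "(\<Sum>i=1..n. (ip (Z i) (e p) - m p) * (ip (Z i) (e q) - m q))
        = (\<Sum>i=1..n. ip (Z i) (e p) * ip (Z i) (e q)) - m p * (\<Sum>i=1..n. ip (Z i) (e q))
          - m q * (\<Sum>i=1..n. ip (Z i) (e p)) + real n * (m p * m q)"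
      by (simp add: algebra_simps sum.distrib sum_subtractf sum_distrib_left)
    also have "\<dots> = real n * (a p q - m p * m q)"
      using n0 by (simp add: a_def m_def field_simps)
    finally show "dh p q = (\<Sum>i=1..n. (1 / real n) * ip (Y i) (e p) * ip (Y i) (e q)) - (if p = q then l p else 0)"
      using n0 by (simp add: dh_def d_def Ye mult.assoc flip: sum_divide_distrib)
  qed (use Y_L2 kernel sys l hs \<tau> in \<open>auto simp: Y_def zb_def\<close>)
  \<comment> \<open>The condition \<tau> \<le> g^2 / 32 is exactly what makes the norm bound at most
    g/4.\<close>
  have "sqrt (2 * \<tau>) \<le> sqrt ((g / 4)\<^sup>2)"
    using \<tau>(3) by (intro real_sqrt_le_mono) (simp add: power_divide)
  then have small_sqrt: "sqrt (2 * \<tau>) \<le> g / 4" using g by simp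
  note ex = expansion[OF gap g small_sqrt sign]
  have sq: "(sqrt (2 * \<tau>))\<^sup>2 = 2 * \<tau>" "(sqrt (2 * \<tau>))^4 = 4 * \<tau>\<^sup>2"
    using \<tau>(1) power_mult[of "sqrt (2 * \<tau>)" 2 2] by (simp_all add: power_mult_distrib)
  have mr: "(m r)\<^sup>2 \<le> \<tau>"
    using sum_le_suminf[OF m_sum(1), of "{r}"] m_sum(2) by simp
  show "\<bar>lamh (Suc r) - a r r\<bar> \<le> (8 / g + 1) * \<tau>"
  proof -
    \<comment> \<open>\<open>dh r r\<close> differs from the deviation of \<open>a r r\<close> by
      the square of \<open>m r\<close>, which accounts for the additional 1 in the constant; 8/g is
      4/g times the factor 2 in the norm bound.\<close>
    have "lamh (Suc r) - l r - dh r r = lamh (Suc r) - a r r + (m r)\<^sup>2"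
      by (simp add: dh_def d_def power2_eq_square)
    then have "\<bar>lamh (Suc r) - a r r + (m r)\<^sup>2\<bar> \<le> 8 / g * \<tau>" using ex(1) by (simp add: sq)
    then show ?thesis using mr zero_le_power2[of "m r"] unfolding distrib_right abs_le_iff by linarith
  qed
  define v where "v s = (if s = r then 1 else 0) + (if s = r then 0 else dh r s / (l r - l s))" for s
  \<comment> \<open>\<open>v\<close> is formed with \<open>dh\<close>, the coefficients of
    \<open>R\<close> with \<open>a\<close>; the discrepancy is the product of two mean scores over
    the eigenvalue difference.\<close>
  have R_le: "(ip R (e s))\<^sup>2 \<le> 2 * (ip (gamh (Suc r)) (e s) - v s)\<^sup>2 + (2 * \<tau> / g\<^sup>2) * (m s)\<^sup>2" for s
  proof (cases "s = r")
    case True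
    then show ?thesis using R(2)[of s] \<tau>(1) by (simp add: v_def)
  next
    case False
    have "l r - l s \<noteq> 0" using gap[OF False] g by auto
    have "a s r = a r s" by (simp add: a_def mult.commute)
    then have "ip R (e s) = (ip (gamh (Suc r)) (e s) - v s) + (- (m r * m s) / (l r - l s))"
      using R(2)[of s] False \<open>l r - l s \<noteq> 0\<close> by (simp add: v_def dh_def d_def diff_divide_distrib)
    then have "(ip R (e s))\<^sup>2 \<le> 2 * (ip (gamh (Suc r)) (e s) - v s)\<^sup>2 + 2 * (- (m r * m s) / (l r - l s))\<^sup>2"
      using power2_add_le by metis
    also have "(- (m r * m s) / (l r - l s))\<^sup>2 = (m r)\<^sup>2 * (m s)\<^sup>2 / \<bar>l r - l s\<bar>\<^sup>2"
      by (simp add: power_divide power_mult_distrib)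
    also have "\<dots> \<le> \<tau> * (m s)\<^sup>2 / g\<^sup>2"
      using gap[OF False] g \<tau>(1) mr by (intro frac_le mult_right_mono power_mono) auto
    finally show ?thesis by simp
  qed
  have S: "summable (\<lambda>s. 2 * (ip (gamh (Suc r)) (e s) - v s)\<^sup>2 + (2 * \<tau> / g\<^sup>2) * (m s)\<^sup>2)"
    using ex(2) by (intro summable_add summable_mult m_sum) (simp_all add: v_def)
  have "ip R R = (\<Sum>s. (ip R (e s))\<^sup>2)" using Parseval_square[OF R(1)] by (simp add: sums_iff)
  also have "\<dots> \<le> (\<Sum>s. 2 * (ip (gamh (Suc r)) (e s) - v s)\<^sup>2 + (2 * \<tau> / g\<^sup>2) * (m s)\<^sup>2)"
    by (intro suminf_le R_le S summable_coefficients R(1))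
  also have "\<dots> = 2 * (\<Sum>s. (ip (gamh (Suc r)) (e s) - v s)\<^sup>2) + (2 * \<tau> / g\<^sup>2) * (\<Sum>s. (m s)\<^sup>2)"
    using ex(2) by (intro sums_unique[symmetric] sums_add sums_mult summable_sums m_sum) (simp_all add: v_def)
  also have "\<dots> \<le> 2 * (88 * (4 * \<tau>\<^sup>2) / g^4) + (2 * \<tau> / g\<^sup>2) * \<tau>"
    using ex(3) \<tau>(1) by (intro add_mono mult_left_mono m_sum) (simp_all add: v_def sq)
  \<comment> \<open>704 = 2 * 88 * 4, the last factor coming from the fourth power of
    \<open>sqrt (2 * \<tau>)\<close>.\<close>
  also have "\<dots> = (704 / g^4 + 2 / g\<^sup>2) * \<tau>\<^sup>2"
    by (simp add: algebra_simps power2_eq_square)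
  finally show "ip R R \<le> (704 / g^4 + 2 / g\<^sup>2) * \<tau>\<^sup>2" .
qed

section \<open>Convergence in distribution\<close>

lemma cmod_iexp_diff_le: "cmod (iexp a - iexp b) \<le> \<bar>a - b\<bar>"
proof -
  have "iexp a - iexp b = iexp b * (iexp (a - b) - 1)"
    by (simp add: algebra_simps flip: exp_add)
  then have "cmod (iexp a - iexp b) = cmod (iexp (a - b) - 1)" by (simp add: norm_mult)
  also have "\<dots> \<le> \<bar>a - b\<bar>" using iexp_approx1[of "a - b" 0] by simp
  finally show ?thesis .
qed

lemma iexp_measurable:
  assumes [measurable]: "Y \<in> borel_measurable M"
  shows "(\<lambda>\<omega>. iexp (t * Y \<omega>)) \<in> borel_measurable M"
  by measurable

lemma char_distr: "Y \<in> borel_measurable M \<Longrightarrow> char (distr M borel Y) t = (CLINT \<omega>|M. iexp (t * Y \<omega>))"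
  unfolding char_def by (subst integral_distr) auto

text \<open>Scaling a standard normal variable by 0 gives the point mass, so characteristic
  functions need no distinction between degenerate and proper normal laws.\<close>

lemma normal_law_eq_distr:
  assumes "0 \<le> v"
  shows "normal_law 0 v = distr std_normal_distribution borel (\<lambda>x. sqrt v * x)"
proof -
  interpret std: real_distribution std_normal_distribution by (rule real_dist_normal_dist)
  show ?thesis
  proof (cases "v = 0")
    case True
    have "distr std_normal_distribution borel (\<lambda>x. 0) = return borel 0"
    proof (rule measure_eqI)
      fix A assume "A \<in> sets (distr std_normal_distribution borel (\<lambda>x. 0))"
      then show "emeasure (distr std_normal_distribution borel (\<lambda>x. 0)) A = emeasure (return borel 0) A"
        using std.emeasure_space_1 by (auto simp: emeasure_distr indicator_def)
    qed simp
    then show ?thesis using True by (simp add: normal_law_def)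
  next
    case False
    then have "0 < v" using assms by simp
    have "distributed std_normal_distribution lborel (\<lambda>x. x) std_normal_density"
      by (simp add: distributed_def distr_id2)
    from std.normal_density_affine[OF this, of "sqrt v" 0]
    have "distr std_normal_distribution lborel (\<lambda>x. sqrt v * x) = density lborel (normal_density 0 (sqrt v))"
      using \<open>0 < v\<close> by (simp add: distributed_def)
    moreover have "distr std_normal_distribution lborel (\<lambda>x. sqrt v * x) = distr std_normal_distribution borel (\<lambda>x. sqrt v * x)"
      by (rule distr_cong) auto
    ultimately show ?thesis using False by (simp add: normal_law_def)
  qed
qed

lemma real_distribution_normal_law: "0 \<le> v \<Longrightarrow> real_distribution (normal_law 0 v)"
proof -
  interpret std: real_distribution std_normal_distribution by (rule real_dist_normal_dist)
  assume "0 \<le> v"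
  then show ?thesis by (simp add: normal_law_eq_distr std.real_distribution_distr)
qed

lemma char_normal_law: "0 \<le> v \<Longrightarrow> char (normal_law 0 v) t = char std_normal_distribution (t * sqrt v)"
  by (subst normal_law_eq_distr, assumption, subst char_distr) (auto simp: char_def mult.assoc)

context prob_space
begin

text \<open>Levy's continuity theorem in both directions. The shift by one reflects that
  measurability is only assumed from sample size 1 on.\<close>

lemma conv_in_dist_iff_char:
  assumes Y: "\<And>n. 1 \<le> n \<Longrightarrow> Y n \<in> borel_measurable M" and L: "real_distribution L"
  shows "conv_in_dist M Y L \<longleftrightarrow> (\<forall>t. (\<lambda>n. CLINT \<omega>|M. iexp (t * Y (Suc n) \<omega>)) \<longlonglongrightarrow> char L t)"
proof -
  have d: "real_distribution (distr M borel (Y (Suc n)))" for n using Y by (intro real_distribution_distr) simp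
  have *: "(\<lambda>n. cdf (distr M borel (Y (Suc n))) x) \<longlonglongrightarrow> c \<longleftrightarrow> (\<lambda>n. cdf (distr M borel (Y n)) x) \<longlonglongrightarrow> c" for x c
    by (rule filterlim_sequentially_Suc)
  have "conv_in_dist M Y L \<longleftrightarrow> weak_conv_m (\<lambda>n. distr M borel (Y (Suc n))) L"
    using Y by (simp add: conv_in_dist_def weak_conv_m_def weak_conv_def *)
  also have "\<dots> \<longleftrightarrow> (\<forall>t. (\<lambda>n. char (distr M borel (Y (Suc n))) t) \<longlonglongrightarrow> char L t)"
    using levy_continuity1[of "\<lambda>n. distr M borel (Y (Suc n))" L, OF d L]
      levy_continuity[of "\<lambda>n. distr M borel (Y (Suc n))" L, OF d L] by blast
  finally show ?thesis using Y by (simp add: char_distr)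
qed

text \<open>The difference of the characteristic functions is split at the event that
  \<open>Z n\<close> and \<open>Y n\<close> are more than \<epsilon> apart: off it the integrand is
  Lipschitz, on it the integrand is at most 2.\<close>

lemma conv_in_dist_Slutsky:
  assumes Y: "conv_in_dist M Y L" and L: "real_distribution L"
    and Z: "\<And>n. 1 \<le> n \<Longrightarrow> Z n \<in> borel_measurable M"
    and lim: "\<And>\<epsilon>. 0 < \<epsilon> \<Longrightarrow> (\<lambda>n. prob {\<omega>\<in>space M. \<epsilon> < \<bar>Z n \<omega> - Y n \<omega>\<bar>}) \<longlonglongrightarrow> 0"
  shows "conv_in_dist M Z L"
proof -
  have Ym: "Y n \<in> borel_measurable M" if "1 \<le> n" for n using Y that by (simp add: conv_in_dist_def)
  note [measurable] = Ym[of "Suc _", simplified] Z[of "Suc _", simplified]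
  have "(\<lambda>n. CLINT \<omega>|M. iexp (t * Z (Suc n) \<omega>)) \<longlonglongrightarrow> char L t" for t
  proof -
    have "(\<lambda>n. (CLINT \<omega>|M. iexp (t * Z (Suc n) \<omega>)) - (CLINT \<omega>|M. iexp (t * Y (Suc n) \<omega>))) \<longlonglongrightarrow> 0"
    proof (rule LIMSEQ_I)
      fix \<eta> :: real assume \<eta>: "0 < \<eta>"
      \<comment> \<open>Makes the Lipschitz part at most \<eta>/2; the 1 guards against
        \<open>t = 0\<close>. The exceptional event has weight 2 and will have probability below
        \<eta>/4.\<close>
      define \<epsilon> where "\<epsilon> = \<eta> / (2 * (\<bar>t\<bar> + 1))"
      have \<epsilon>: "0 < \<epsilon>" and t\<epsilon>: "\<bar>t\<bar> * \<epsilon> \<le> \<eta> / 2" using \<eta> by (auto simp: \<epsilon>_def field_simps)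
      have "(\<lambda>n. prob {\<omega>\<in>space M. \<epsilon> < \<bar>Z (Suc n) \<omega> - Y (Suc n) \<omega>\<bar>}) \<longlonglongrightarrow> 0"
        using lim[OF \<epsilon>] by (rule LIMSEQ_Suc)
      from LIMSEQ_D[OF this, of "\<eta> / 4"] \<eta> obtain N where
        N: "\<And>n. N \<le> n \<Longrightarrow> prob {\<omega>\<in>space M. \<epsilon> < \<bar>Z (Suc n) \<omega> - Y (Suc n) \<omega>\<bar>} < \<eta> / 4" by auto
      show "\<exists>N. \<forall>n\<ge>N. norm ((CLINT \<omega>|M. iexp (t * Z (Suc n) \<omega>)) - (CLINT \<omega>|M. iexp (t * Y (Suc n) \<omega>)) - 0) < \<eta>"
      proof (intro exI allI impI)
        fix n assume n: "N \<le> n"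
        let ?A = "{\<omega>\<in>space M. \<epsilon> < \<bar>Z (Suc n) \<omega> - Y (Suc n) \<omega>\<bar>}"
        have A[measurable]: "?A \<in> sets M" by measurable
        have iZ: "integrable M (\<lambda>\<omega>. iexp (t * Z (Suc n) \<omega>))" and iY: "integrable M (\<lambda>\<omega>. iexp (t * Y (Suc n) \<omega>))"
          by (auto intro!: integrable_const_bound[of _ 1])
        have "norm ((CLINT \<omega>|M. iexp (t * Z (Suc n) \<omega>)) - (CLINT \<omega>|M. iexp (t * Y (Suc n) \<omega>)))
            = norm (CLINT \<omega>|M. iexp (t * Z (Suc n) \<omega>) - iexp (t * Y (Suc n) \<omega>))"
          using iZ iY by (simp only: Bochner_Integration.integral_diff)
        also have "\<dots> \<le> (\<integral>\<omega>. norm (iexp (t * Z (Suc n) \<omega>) - iexp (t * Y (Suc n) \<omega>)) \<partial>M)"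
          by (rule integral_norm_bound)
        also have "\<dots> \<le> (\<integral>\<omega>. \<bar>t\<bar> * \<epsilon> + 2 * indicator ?A \<omega> \<partial>M)"
        proof (rule integral_mono)
          show "integrable M (\<lambda>\<omega>. norm (iexp (t * Z (Suc n) \<omega>) - iexp (t * Y (Suc n) \<omega>)))"
            using iZ iY by (intro integrable_norm Bochner_Integration.integrable_diff)
          show "integrable M (\<lambda>\<omega>. \<bar>t\<bar> * \<epsilon> + 2 * indicat_real ?A \<omega>)"
            by (intro Bochner_Integration.integrable_add) (auto simp: emeasure_eq_measure)
          fix \<omega> assume \<omega>: "\<omega> \<in> space M"
          have te: "0 \<le> \<bar>t\<bar> * \<epsilon>" using \<epsilon> by simp
          show "norm (iexp (t * Z (Suc n) \<omega>) - iexp (t * Y (Suc n) \<omega>)) \<le> \<bar>t\<bar> * \<epsilon> + 2 * indicat_real ?A \<omega>"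
          proof (cases "\<omega> \<in> ?A")
            case True
            have "norm (iexp (t * Z (Suc n) \<omega>) - iexp (t * Y (Suc n) \<omega>)) \<le> 1 + 1"
              by (rule order_trans[OF norm_triangle_ineq4]) simp
            then show ?thesis using True te by simp
          next
            case False
            then have "\<bar>Z (Suc n) \<omega> - Y (Suc n) \<omega>\<bar> \<le> \<epsilon>" using \<omega> by auto
            then have "\<bar>t\<bar> * \<bar>Z (Suc n) \<omega> - Y (Suc n) \<omega>\<bar> \<le> \<bar>t\<bar> * \<epsilon>" by (intro mult_left_mono) auto
            moreover have "norm (iexp (t * Z (Suc n) \<omega>) - iexp (t * Y (Suc n) \<omega>)) \<le> \<bar>t * Z (Suc n) \<omega> - t * Y (Suc n) \<omega>\<bar>"
              by (rule cmod_iexp_diff_le)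
            ultimately show ?thesis using False by (simp add: abs_mult flip: right_diff_distrib)
          qed
        qed
        also have "\<dots> = \<bar>t\<bar> * \<epsilon> + 2 * prob ?A"
          by (subst Bochner_Integration.integral_add) (auto simp: prob_space emeasure_eq_measure)
        also have "\<dots> < \<eta>" using t\<epsilon> N[OF n] \<eta> by linarith
        finally show "norm ((CLINT \<omega>|M. iexp (t * Z (Suc n) \<omega>)) - (CLINT \<omega>|M. iexp (t * Y (Suc n) \<omega>)) - 0) < \<eta>"
          by simp
      qed
    qed
    moreover have "(\<lambda>n. CLINT \<omega>|M. iexp (t * Y (Suc n) \<omega>)) \<longlonglongrightarrow> char L t"
      using Y conv_in_dist_iff_char[of Y L, OF Ym L] by blast
    ultimately show ?thesis using tendsto_add by fastforce
  qed
  then show ?thesis using conv_in_dist_iff_char[of Z L, OF Z L] by blast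
qed

text \<open>The central limit theorem is applied to sequences indexed from 0, whereas observations
  start at 1.\<close>

lemma indep_vars_Suc:
  assumes "indep_vars (\<lambda>_. N) X {1..}"
  shows "indep_vars (\<lambda>_. N) (\<lambda>i. X (Suc i)) UNIV"
proof -
  let ?F = "\<lambda>i. {X i -` A \<inter> space M | A. A \<in> sets N}"
  have X: "random_variable N (X (Suc i))" for i using assms by (auto simp: indep_vars_def2)
  have F: "indep_sets ?F {1..}" using assms by (simp add: indep_vars_def2)
  have "indep_sets (\<lambda>i. ?F (Suc i)) UNIV"
  proof (rule indep_setsI)
    fix i show "?F (Suc i) \<subseteq> events" using X[of i] by (auto intro: measurable_sets)
  next
    fix A and J :: "nat set" assume J: "J \<noteq> {}" "finite J" "\<forall>j\<in>J. A j \<in> ?F (Suc j)"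
    have "prob (\<Inter>j\<in>Suc ` J. A (j - 1)) = (\<Prod>j\<in>Suc ` J. prob (A (j - 1)))"
      using J by (intro indep_setsD[OF F]) auto
    then show "prob (\<Inter>j\<in>J. A j) = (\<Prod>j\<in>J. prob (A j))" by (simp add: prod.reindex)
  qed
  then show ?thesis using X by (simp add: indep_vars_def2)
qed

end

section \<open>Functionals of independent identically distributed variables\<close>

locale iid_sequence = prob_space M for M :: "'a measure" +
  fixes N :: "'b measure" and P :: "nat \<Rightarrow> 'a \<Rightarrow> 'b"
  assumes indep: "indep_vars (\<lambda>_. N) P {1..}"
    and same_distr: "\<And>i j. 1 \<le> i \<Longrightarrow> 1 \<le> j \<Longrightarrow> distr M N (P i) = distr M N (P j)"
begin

lemma P_measurable: "1 \<le> i \<Longrightarrow> P i \<in> measurable M N"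
  using indep by (auto simp: indep_vars_def2)

lemma AE_P_iff:
  assumes "1 \<le> i" "1 \<le> j" and [measurable]: "Measurable.pred N Q"
  shows "(AE \<omega> in M. Q (P i \<omega>)) \<longleftrightarrow> (AE \<omega> in M. Q (P j \<omega>))"
proof -
  have *: "(AE \<omega> in M. Q (P i \<omega>)) \<longleftrightarrow> (AE x in distr M N (P i). Q x)" if "1 \<le> i" for i
    using P_measurable[OF that] by (subst AE_distr_iff) auto
  show ?thesis unfolding *[OF assms(1)] *[OF assms(2)] same_distr[OF assms(1,2)] ..
qed

lemma integral_P_eq:
  fixes f :: "'b \<Rightarrow> real"
  assumes "1 \<le> i" "1 \<le> j" and f: "f \<in> borel_measurable N"
  shows "(\<integral>\<omega>. f (P i \<omega>) \<partial>M) = (\<integral>\<omega>. f (P j \<omega>) \<partial>M)"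
    "integrable M (\<lambda>\<omega>. f (P i \<omega>)) \<longleftrightarrow> integrable M (\<lambda>\<omega>. f (P j \<omega>))"
  using integral_distr[OF P_measurable f] integrable_distr_eq[OF P_measurable f] same_distr[OF assms(1,2)] assms(1,2)
  by metis+

end

text \<open>\<open>Z i\<close> itself need not be a measurable function of the path. Its almost sure
  version \<open>h (P i)\<close> carries independence and equality in law, and the moments of
  \<open>Z i\<close> are transferred through it.\<close>

locale iid_functional = iid_sequence M N P for M :: "'a measure" and N :: "'b measure" and P +
  fixes Z :: "nat \<Rightarrow> 'a \<Rightarrow> real" and h :: "'b \<Rightarrow> real"
  assumes Z_measurable: "\<And>i. 1 \<le> i \<Longrightarrow> Z i \<in> borel_measurable M"
    and h_measurable: "h \<in> borel_measurable N"
    and Z_eq: "\<And>i. 1 \<le> i \<Longrightarrow> AE \<omega> in M. Z i \<omega> = h (P i \<omega>)"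
    and square_integrable: "integrable M (\<lambda>\<omega>. (Z 1 \<omega>)\<^sup>2)" and centred: "expectation (Z 1) = 0"
begin

lemma h_P_measurable: "1 \<le> i \<Longrightarrow> (\<lambda>\<omega>. h (P i \<omega>)) \<in> borel_measurable M"
  using P_measurable h_measurable by (rule measurable_compose)

lemma Z_sq_int: "1 \<le> i \<Longrightarrow> Z i \<in> sq_int M"
  and Z_expectation: "1 \<le> i \<Longrightarrow> expectation (Z i) = 0"
  and Z_second_moment: "1 \<le> i \<Longrightarrow> expectation (\<lambda>\<omega>. (Z i \<omega>)\<^sup>2) = expectation (\<lambda>\<omega>. (Z 1 \<omega>)\<^sup>2)"
proof -
  assume i: "1 \<le> i"
  have h2: "(\<lambda>x. (h x)\<^sup>2) \<in> borel_measurable N" using h_measurable by (rule borel_measurable_power)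
  have eq2: "AE \<omega> in M. (Z j \<omega>)\<^sup>2 = (h (P j \<omega>))\<^sup>2" if "1 \<le> j" for j
    using Z_eq[OF that] by eventually_elim simp
  have int: "integrable M (\<lambda>\<omega>. (Z j \<omega>)\<^sup>2) \<longleftrightarrow> integrable M (\<lambda>\<omega>. (h (P j \<omega>))\<^sup>2)"
    "expectation (\<lambda>\<omega>. (Z j \<omega>)\<^sup>2) = expectation (\<lambda>\<omega>. (h (P j \<omega>))\<^sup>2)"
    "expectation (Z j) = expectation (\<lambda>\<omega>. h (P j \<omega>))" if "1 \<le> j" for j
    using eq2[OF that] Z_eq[OF that] Z_measurable[OF that] h_P_measurable[OF that]
    by - (rule integrable_cong_AE integral_cong_AE; auto)+
  show "Z i \<in> sq_int M"
    using Z_measurable[OF i] int(1)[OF i] int(1)[of 1] integral_P_eq(2)[OF i _ h2, of 1] square_integrable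
    by (simp add: sq_int_def)
  show "expectation (Z i) = 0"
    using int(3)[OF i] int(3)[of 1] integral_P_eq(1)[OF i _ h_measurable, of 1] centred by simp
  show "expectation (\<lambda>\<omega>. (Z i \<omega>)\<^sup>2) = expectation (\<lambda>\<omega>. (Z 1 \<omega>)\<^sup>2)"
    using int(2)[OF i] int(2)[of 1] integral_P_eq(1)[OF i _ h2, of 1] by simp
qed

lemma Z_uncorrelated:
  assumes ij: "1 \<le> i" "1 \<le> j" "i \<noteq> j"
  shows "expectation (\<lambda>\<omega>. Z i \<omega> * Z j \<omega>) = 0"
proof -
  have "indep_vars (\<lambda>_. borel) (\<lambda>i \<omega>. h (P i \<omega>)) {1..}"
    using indep by (rule indep_vars_compose2) (rule h_measurable)
  then have "indep_vars (\<lambda>_. borel) (\<lambda>i \<omega>. h (P i \<omega>)) {i, j}"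
    by (rule indep_vars_subset) (use ij in auto)
  moreover have int: "integrable M (\<lambda>\<omega>. h (P k \<omega>))" if "1 \<le> k" for k
    using sq_int_imp_integrable[OF Z_sq_int[OF that]] Z_eq[OF that] Z_measurable[OF that] h_P_measurable[OF that]
    by (subst integrable_cong_AE[where g="Z k"]) (auto elim!: eventually_mono)
  ultimately have "expectation (\<lambda>\<omega>. \<Prod>k\<in>{i, j}. h (P k \<omega>)) = (\<Prod>k\<in>{i, j}. expectation (\<lambda>\<omega>. h (P k \<omega>)))"
    using ij by (intro indep_vars_lebesgue_integral) auto
  moreover have "expectation (\<lambda>\<omega>. h (P k \<omega>)) = 0" if "1 \<le> k" for k
    using Z_expectation[OF that] Z_eq[OF that] Z_measurable[OF that] h_P_measurable[OF that]
    by (subst integral_cong_AE[where g="Z k"]) (auto elim!: eventually_mono)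
  ultimately have "expectation (\<lambda>\<omega>. h (P i \<omega>) * h (P j \<omega>)) = 0" using ij by simp
  moreover have "expectation (\<lambda>\<omega>. Z i \<omega> * Z j \<omega>) = expectation (\<lambda>\<omega>. h (P i \<omega>) * h (P j \<omega>))"
    using ij Z_measurable h_P_measurable Z_eq[OF ij(1)] Z_eq[OF ij(2)]
    by (intro integral_cong_AE) (auto elim!: eventually_elim2 intro!: borel_measurable_times)
  ultimately show ?thesis by simp
qed

lemma sum_second_moment: "expectation (\<lambda>\<omega>. (\<Sum>i=1..n. Z i \<omega>)\<^sup>2) = real n * expectation (\<lambda>\<omega>. (Z 1 \<omega>)\<^sup>2)"
proof -
  have "expectation (\<lambda>\<omega>. (\<Sum>i=1..n. Z i \<omega>)\<^sup>2) = expectation (\<lambda>\<omega>. \<Sum>i=1..n. \<Sum>j=1..n. Z i \<omega> * Z j \<omega>)"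
    by (simp add: power2_eq_square sum_product)
  also have "\<dots> = (\<Sum>i=1..n. \<Sum>j=1..n. expectation (\<lambda>\<omega>. Z i \<omega> * Z j \<omega>))"
    by (subst Bochner_Integration.integral_sum Bochner_Integration.integrable_sum)+
       (auto intro!: sq_int_integrable_mult Z_sq_int Bochner_Integration.integrable_sum sum.cong Bochner_Integration.integral_sum)
  also have "\<dots> = (\<Sum>i=1..n. \<Sum>j=1..n. if i = j then expectation (\<lambda>\<omega>. (Z 1 \<omega>)\<^sup>2) else 0)"
  proof (intro sum.cong refl)
    fix i j assume ij: "i \<in> {1..n}" "j \<in> {1..n}"
    then show "expectation (\<lambda>\<omega>. Z i \<omega> * Z j \<omega>) = (if i = j then expectation (\<lambda>\<omega>. (Z 1 \<omega>)\<^sup>2) else 0)"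
      using Z_uncorrelated[of i j] Z_second_moment[of i] by (cases "i = j") (simp_all add: power2_eq_square)
  qed
  also have "\<dots> = real n * expectation (\<lambda>\<omega>. (Z 1 \<omega>)\<^sup>2)" by simp
  finally show ?thesis .
qed

text \<open>Normalising by the standard deviation excludes \<open>v = 0\<close>; in that case all
  summands vanish almost surely and the limit is the point mass at 0.\<close>

lemma scaled_sum_conv_in_dist:
  "conv_in_dist M (\<lambda>n \<omega>. (1 / sqrt (real n)) * (\<Sum>i=1..n. Z i \<omega>)) (normal_law 0 (expectation (\<lambda>\<omega>. (Z 1 \<omega>)\<^sup>2)))"
proof -
  define v where "v = expectation (\<lambda>\<omega>. (Z 1 \<omega>)\<^sup>2)"
  have v: "0 \<le> v" unfolding v_def by simp
  have S: "(\<lambda>\<omega>. (1 / sqrt (real n)) * (\<Sum>i=1..n. Z i \<omega>)) \<in> borel_measurable M" for n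
    using Z_measurable by (intro borel_measurable_times borel_measurable_const borel_measurable_sum) auto
  define H where "H i \<omega> = h (P (Suc i) \<omega>)" for i \<omega>
  have H[measurable]: "H i \<in> borel_measurable M" for i unfolding H_def by (rule h_P_measurable) simp
  have Z_H: "AE \<omega> in M. Z (Suc i) \<omega> = H i \<omega>" for i unfolding H_def by (rule Z_eq) simp
  have sum_H: "AE \<omega> in M. (\<Sum>i=1..n. Z i \<omega>) = (\<Sum>i<n. H i \<omega>)" for n
  proof -
    have "AE \<omega> in M. \<forall>i. Z (Suc i) \<omega> = H i \<omega>" unfolding AE_all_countable using Z_H by blast
    then show ?thesis by eventually_elim (simp add: sum.atLeast1_atMost_eq)
  qed
  have "(\<lambda>n. CLINT \<omega>|M. iexp (t * ((1 / sqrt (real (Suc n))) * (\<Sum>i=1..Suc n. Z i \<omega>)))) \<longlonglongrightarrow> char (normal_law 0 v) t" for t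
  proof -
    have eq: "(CLINT \<omega>|M. iexp (t * ((1 / sqrt (real n)) * (\<Sum>i=1..n. Z i \<omega>))))
       = (CLINT \<omega>|M. iexp (t * ((1 / sqrt (real n)) * (\<Sum>i<n. H i \<omega>))))" for n
    proof (rule integral_cong_AE)
      show "AE \<omega> in M. iexp (t * ((1 / sqrt (real n)) * (\<Sum>i=1..n. Z i \<omega>))) = iexp (t * ((1 / sqrt (real n)) * (\<Sum>i<n. H i \<omega>)))"
        using sum_H[of n] by eventually_elim (simp only:)
    qed (intro iexp_measurable S, measurable)
    show ?thesis
    proof (cases "v = 0")
      case True
      have "AE \<omega> in M. Z (Suc i) \<omega> = 0" for i
      proof -
        have "expectation (\<lambda>\<omega>. (Z (Suc i) \<omega>)\<^sup>2) = 0" using Z_second_moment[of "Suc i"] True v_def by simp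
        then show ?thesis
          using sq_int_integrable[OF Z_sq_int[of "Suc i"]] by (subst (asm) integral_nonneg_eq_0_iff_AE) auto
      qed
      then have "AE \<omega> in M. \<forall>i. Z (Suc i) \<omega> = 0" unfolding AE_all_countable by blast
      then have sum0: "AE \<omega> in M. (\<Sum>i=1..n. Z i \<omega>) = 0" for n
        by eventually_elim (simp add: sum.atLeast1_atMost_eq)
      have AE0: "AE \<omega> in M. iexp (t * ((1 / sqrt (real n)) * (\<Sum>i=1..n. Z i \<omega>))) = 1" for n
        using sum0[of n] by eventually_elim (simp only: mult_zero_right of_real_0 exp_zero)
      have "(CLINT \<omega>|M. iexp (t * ((1 / sqrt (real n)) * (\<Sum>i=1..n. Z i \<omega>)))) = (CLINT \<omega>|M. 1)" for n
        by (rule integral_cong_AE[OF iexp_measurable[OF S] _ AE0]) simp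
      moreover have "char (normal_law 0 v) t = 1"
        using char_normal_law[of v t] True real_distribution.char_zero[OF real_dist_normal_dist] by simp
      moreover have "(CLINT \<omega>|M. 1) = 1" by (simp add: prob_space)
      ultimately show ?thesis by (simp only: tendsto_const)
    next
      case False
      then have pos: "0 < v" using v by simp
      have HZ: "expectation (H i) = expectation (Z (Suc i))" "expectation (\<lambda>\<omega>. (H i \<omega>)\<^sup>2) = expectation (\<lambda>\<omega>. (Z (Suc i) \<omega>)\<^sup>2)"
        "integrable M (\<lambda>\<omega>. (H i \<omega>)\<^sup>2) = integrable M (\<lambda>\<omega>. (Z (Suc i) \<omega>)\<^sup>2)" for i
        using Z_H[of i] Z_measurable[of "Suc i"]
        by - (rule integrable_cong_AE integral_cong_AE; auto elim!: eventually_mono)+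
      have "weak_conv_m (\<lambda>n. distr M borel (\<lambda>\<omega>. (\<Sum>i<n. H i \<omega>) / sqrt (real n * (sqrt v)\<^sup>2))) std_normal_distribution"
      proof (rule central_limit_theorem_zero_mean)
        show "indep_vars (\<lambda>i. borel) H UNIV"
          unfolding H_def using indep_vars_Suc[OF indep] by (rule indep_vars_compose2) (rule h_measurable)
        show "distr M borel (H n) = distr M borel (H 0)" for n
        proof -
          have "distr M borel (H i) = distr (distr M N (P (Suc i))) borel h" for i
            unfolding H_def using h_measurable P_measurable[of "Suc i"] by (simp add: distr_distr comp_def)
          then show ?thesis using same_distr[of "Suc n" "Suc 0"] by simp
        qed
        show "expectation (H n) = 0" for n using Z_expectation[of "Suc n"] HZ by simp
        then show "variance (H n) = (sqrt v)\<^sup>2" for n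
          using Z_second_moment[of "Suc n"] HZ v by (simp add: v_def)
        show "integrable M (\<lambda>x. (H n x)\<^sup>2)" for n
          using sq_int_integrable[OF Z_sq_int[of "Suc n"]] HZ(3) by simp
      qed (use pos in simp)
      \<comment> \<open>Taking the characteristic functions at \<open>t * sqrt v\<close> undoes the
        normalisation.\<close>
      then have "(\<lambda>n. char (distr M borel (\<lambda>\<omega>. (\<Sum>i<n. H i \<omega>) / sqrt (real n * (sqrt v)\<^sup>2))) (t * sqrt v)) \<longlonglongrightarrow> char (normal_law 0 v) t"
        unfolding char_normal_law[OF v]
        by (intro levy_continuity1) (auto intro!: real_dist_normal_dist)
      moreover have "char (distr M borel (\<lambda>\<omega>. (\<Sum>i<n. H i \<omega>) / sqrt (real n * (sqrt v)\<^sup>2))) (t * sqrt v)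
          = (CLINT \<omega>|M. iexp (t * ((1 / sqrt (real n)) * (\<Sum>i<n. H i \<omega>))))" for n
      proof -
        have "(t * sqrt v) * ((\<Sum>i<n. H i \<omega>) / sqrt (real n * (sqrt v)\<^sup>2)) = t * ((1 / sqrt (real n)) * (\<Sum>i<n. H i \<omega>))" for \<omega>
          using pos by (simp add: real_sqrt_mult)
        then show ?thesis by (subst char_distr) (simp_all only:, measurable)
      qed
      ultimately have "(\<lambda>n. CLINT \<omega>|M. iexp (t * ((1 / sqrt (real n)) * (\<Sum>i<n. H i \<omega>)))) \<longlonglongrightarrow> char (normal_law 0 v) t"
        by (simp only:)
      then show ?thesis unfolding eq by (rule LIMSEQ_Suc)
    qed
  qed
  then show ?thesis
    unfolding v_def[symmetric] by (subst conv_in_dist_iff_char[OF S real_distribution_normal_law[OF v]]) blast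
qed

end

lemma emeasure_unit_leb: "emeasure unit_leb {0..1} = 1"
  by (simp add: emeasure_restrict_space)

section \<open>The functional model\<close>

text \<open>
  Eigenvalues, eigenfunctions and scores are re-indexed from 0 here
  (\<open>l s\<close>, \<open>e s\<close> and \<open>b s\<close> correspond to the index \<open>s + 1\<close> of the
  paper); the observations keep their index \<open>i \<ge> 1\<close>.
\<close>

locale functional_sample = prob_space M for M :: "'a measure" +
  fixes X :: "nat \<Rightarrow> 'a \<Rightarrow> real \<Rightarrow> real" and \<mu> :: "real \<Rightarrow> real" and \<sigma> :: "real \<Rightarrow> real \<Rightarrow> real"
    and l :: "nat \<Rightarrow> real" and e :: "nat \<Rightarrow> real \<Rightarrow> real"
  assumes iid: "iid_random_functions M X"
    and second_moments: "\<And>i t. i \<ge> 1 \<Longrightarrow> t \<in> {0..1} \<Longrightarrow> integrable M (\<lambda>\<omega>. (X i \<omega> t)\<^sup>2)"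
    and mean: "\<And>i t. i \<ge> 1 \<Longrightarrow> t \<in> {0..1} \<Longrightarrow> \<mu> t = (\<integral>\<omega>. X i \<omega> t \<partial>M)"
    and cov: "\<And>i t s. i \<ge> 1 \<Longrightarrow> t \<in> {0..1} \<Longrightarrow> s \<in> {0..1} \<Longrightarrow>
        \<sigma> t s = (\<integral>\<omega>. (X i \<omega> t - \<mu> t) * (X i \<omega> s - \<mu> s) \<partial>M)"
    and cov_cont: "continuous_on ({0..1} \<times> {0..1}) (\<lambda>(t, s). \<sigma> t s)"
    and basis: "orthonormal_basis e"
    and e_eigen: "\<And>s t. t \<in> {0..1} \<Longrightarrow> int_op \<sigma> (e s) t = l s * e s t"
    and l_antimono: "\<And>p q. p \<le> q \<Longrightarrow> l q \<le> l p"
    and e_bounded: "\<exists>C. \<forall>s. \<forall>t\<in>{0..1}. \<bar>e s t\<bar> \<le> C"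
begin

sublocale basis: orthonormal_basis e by (rule basis)

sublocale MU: pair_prob_space M unit_leb ..

definition Y :: "nat \<Rightarrow> 'a \<Rightarrow> real \<Rightarrow> real" where "Y i \<omega> t = X i \<omega> t - \<mu> t"

definition b :: "nat \<Rightarrow> nat \<Rightarrow> 'a \<Rightarrow> real" where "b s i \<omega> = ip (Y i \<omega>) (e s)"

abbreviation path_space :: "(real \<Rightarrow> real) measure" where "path_space \<equiv> Pi\<^sub>M {0..1} (\<lambda>_. borel)"

definition path :: "nat \<Rightarrow> 'a \<Rightarrow> real \<Rightarrow> real" where "path i \<omega> = restrict (X i \<omega>) {0..1}"

sublocale paths: iid_sequence M path_space path
proof
  show "indep_vars (\<lambda>_. path_space) path {1..}"
    using iid unfolding iid_random_functions_def path_def[abs_def] by blast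
  show "1 \<le> i \<Longrightarrow> 1 \<le> j \<Longrightarrow> distr M path_space (path i) = distr M path_space (path j)" for i j
    using iid unfolding iid_random_functions_def path_def[abs_def] by blast
qed

definition C_e :: real where "C_e = (SOME C. \<forall>s. \<forall>t\<in>{0..1}. \<bar>e s t\<bar> \<le> C)"

lemma e_le: "t \<in> {0..1} \<Longrightarrow> \<bar>e s t\<bar> \<le> C_e"
  unfolding C_e_def by (rule someI_ex[OF e_bounded, rule_format])

lemma C_e_nonneg: "0 \<le> C_e"
  using order_trans[OF abs_ge_zero e_le[of 0 0]] by simp

lemma e_measurable[measurable]: "e s \<in> borel_measurable unit_leb"
  using basis.basis_L2[of s] by (simp add: L2_def)

lemma X_joint: "1 \<le> i \<Longrightarrow> (\<lambda>(\<omega>, t). X i \<omega> t) \<in> borel_measurable (M \<Otimes>\<^sub>M unit_leb)"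
  and X_L2: "1 \<le> i \<Longrightarrow> \<omega> \<in> space M \<Longrightarrow> X i \<omega> \<in> L2"
  using iid by (auto simp: iid_random_functions_def random_function_def)

lemma X_measurable: "1 \<le> i \<Longrightarrow> t \<in> {0..1} \<Longrightarrow> (\<lambda>\<omega>. X i \<omega> t) \<in> borel_measurable M"
  using measurable_Pair1[OF X_joint, of i t] by simp

lemma X_sq_int: "1 \<le> i \<Longrightarrow> t \<in> {0..1} \<Longrightarrow> (\<lambda>\<omega>. X i \<omega> t) \<in> sq_int M"
  by (intro sq_intI X_measurable second_moments)

lemma Y_sq_int: "1 \<le> i \<Longrightarrow> t \<in> {0..1} \<Longrightarrow> (\<lambda>\<omega>. Y i \<omega> t) \<in> sq_int M"
  unfolding Y_def by (intro sq_int_diff X_sq_int bounded_sq_int[of _ "\<bar>\<mu> t\<bar>"]) auto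

lemma Y_expectation: "1 \<le> i \<Longrightarrow> t \<in> {0..1} \<Longrightarrow> expectation (\<lambda>\<omega>. Y i \<omega> t) = 0"
proof -
  assume i: "1 \<le> i" and t: "t \<in> {0..1}"
  show ?thesis
    unfolding Y_def using sq_int_imp_integrable[OF X_sq_int[OF i t]] mean[OF i t] by (simp add: prob_space)
qed

lemma Y_covariance: "1 \<le> i \<Longrightarrow> t \<in> {0..1} \<Longrightarrow> s \<in> {0..1} \<Longrightarrow> expectation (\<lambda>\<omega>. Y i \<omega> t * Y i \<omega> s) = \<sigma> t s"
  unfolding Y_def by (rule cov[symmetric])

lemma Y_second_moment: "1 \<le> i \<Longrightarrow> t \<in> {0..1} \<Longrightarrow> expectation (\<lambda>\<omega>. (Y i \<omega> t)\<^sup>2) = \<sigma> t t"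
  unfolding power2_eq_square by (rule Y_covariance)

text \<open>Joint measurability of the first observation is inherited by the mean when the sample
  point is integrated out.\<close>

lemma \<mu>_measurable[measurable]: "\<mu> \<in> borel_measurable unit_leb"
proof -
  have "(\<lambda>t. \<integral>\<omega>. X 1 \<omega> t \<partial>M) \<in> borel_measurable unit_leb"
    using measurable_pair_swap[OF X_joint[of 1]] by (intro borel_measurable_lebesgue_integral) (simp add: split_beta')
  then show ?thesis using mean[of 1] by (subst measurable_cong) auto
qed

lemma Y_joint: "1 \<le> i \<Longrightarrow> (\<lambda>(\<omega>, t). Y i \<omega> t) \<in> borel_measurable (M \<Otimes>\<^sub>M unit_leb)"
proof -
  assume "1 \<le> i"
  note [measurable] = X_joint[OF this]
  show ?thesis unfolding Y_def by measurable
qed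

definition C_\<sigma> :: real where "C_\<sigma> = (SOME C. \<forall>t\<in>{0..1}. \<forall>s\<in>{0..1}. \<bar>\<sigma> t s\<bar> \<le> C)"

lemma \<sigma>_le: "t \<in> {0..1} \<Longrightarrow> s \<in> {0..1} \<Longrightarrow> \<bar>\<sigma> t s\<bar> \<le> C_\<sigma>"
proof -
  have "compact ((\<lambda>(t, s). \<sigma> t s) ` ({0..1} \<times> {0..1}))"
    by (intro compact_continuous_image cov_cont compact_Times compact_Icc)
  then obtain C where "\<forall>y\<in>(\<lambda>(t, s). \<sigma> t s) ` ({0..1} \<times> {0..1}). norm y \<le> C"
    using compact_imp_bounded bounded_iff by metis
  then have "\<exists>C. \<forall>t\<in>{0..1}. \<forall>s\<in>{0..1}. \<bar>\<sigma> t s\<bar> \<le> C" by auto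
  from someI_ex[OF this] show "t \<in> {0..1} \<Longrightarrow> s \<in> {0..1} \<Longrightarrow> \<bar>\<sigma> t s\<bar> \<le> C_\<sigma>" unfolding C_\<sigma>_def by blast
qed

lemma nn_integral_Y_square:
  assumes i: "1 \<le> i"
  shows "(\<integral>\<^sup>+\<omega>. \<integral>\<^sup>+t. ennreal ((Y i \<omega> t)\<^sup>2) \<partial>unit_leb \<partial>M) = (\<integral>\<^sup>+t. ennreal (\<sigma> t t) \<partial>unit_leb)"
proof -
  note [measurable] = Y_joint[OF i]
  have "(\<integral>\<^sup>+\<omega>. \<integral>\<^sup>+t. ennreal ((Y i \<omega> t)\<^sup>2) \<partial>unit_leb \<partial>M) = (\<integral>\<^sup>+t. \<integral>\<^sup>+\<omega>. ennreal ((Y i \<omega> t)\<^sup>2) \<partial>M \<partial>unit_leb)"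
    by (rule MU.Fubini'[symmetric]) measurable
  also have "\<dots> = (\<integral>\<^sup>+t. ennreal (\<sigma> t t) \<partial>unit_leb)"
    by (intro nn_integral_cong)
       (simp add: nn_integral_eq_integral sq_int_integrable[OF Y_sq_int[OF i]] Y_second_moment[OF i])
  finally show ?thesis .
qed

lemma Y_joint_sq_int: "1 \<le> i \<Longrightarrow> (\<lambda>(\<omega>, t). Y i \<omega> t) \<in> sq_int (M \<Otimes>\<^sub>M unit_leb)"
proof (rule sq_intI)
  assume i: "1 \<le> i"
  show m[measurable]: "(\<lambda>(\<omega>, t). Y i \<omega> t) \<in> borel_measurable (M \<Otimes>\<^sub>M unit_leb)" by (rule Y_joint[OF i])
  have "(\<integral>\<^sup>+x. ennreal ((case x of (\<omega>, t) \<Rightarrow> Y i \<omega> t)\<^sup>2) \<partial>(M \<Otimes>\<^sub>M unit_leb)) = (\<integral>\<^sup>+t. ennreal (\<sigma> t t) \<partial>unit_leb)"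
    by (subst unit_leb.nn_integral_fst[symmetric]) (simp_all add: nn_integral_Y_square[OF i])
  also have "\<dots> \<le> (\<integral>\<^sup>+t. ennreal C_\<sigma> \<partial>unit_leb)"
    using \<sigma>_le by (intro nn_integral_mono ennreal_leI) (force simp: abs_le_iff)
  also have "\<dots> < \<infinity>" by (simp add: emeasure_unit_leb)
  finally show "integrable (M \<Otimes>\<^sub>M unit_leb) (\<lambda>x. (case x of (\<omega>, t) \<Rightarrow> Y i \<omega> t)\<^sup>2)"
    by (intro integrableI_nonneg) auto
qed

text \<open>Almost every centred path is square integrable, hence at least one is; subtracting it
  from the square integrable observation leaves the mean.\<close>

lemma \<mu>_L2: "\<mu> \<in> L2"
proof -
  have "AE \<omega> in M. integrable unit_leb (\<lambda>t. (Y 1 \<omega> t)\<^sup>2)"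
    using MU.AE_integrable_fst'[OF sq_int_integrable[OF Y_joint_sq_int[of 1]]] by simp
  then have ae: "AE \<omega> in M. \<omega> \<in> space M \<and> integrable unit_leb (\<lambda>t. (Y 1 \<omega> t)\<^sup>2)" by auto
  obtain \<omega> where \<omega>: "\<omega> \<in> space M" "integrable unit_leb (\<lambda>t. (Y 1 \<omega> t)\<^sup>2)"
  proof (rule ccontr)
    assume "\<not> thesis"
    then have none: "\<not> (\<omega> \<in> space M \<and> integrable unit_leb (\<lambda>t. (Y 1 \<omega> t)\<^sup>2))" for \<omega> using that by blast
    from ae have "AE \<omega> in M. False" by eventually_elim (use none in blast)
    then show False by simp
  qed
  have "Y 1 \<omega> \<in> L2"
    unfolding L2_def using \<omega> measurable_Pair2[OF Y_joint[of 1], of \<omega>] by simp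
  from L2_diff[OF X_L2[of 1 \<omega>] this] \<omega> show ?thesis by (simp add: Y_def)
qed

lemma Y_L2: "1 \<le> i \<Longrightarrow> \<omega> \<in> space M \<Longrightarrow> Y i \<omega> \<in> L2"
  using L2_diff[OF X_L2 \<mu>_L2] by (simp add: Y_def[abs_def])

section \<open>Scores: integrability, moments and the trace identity\<close>

lemma b_measurable: "1 \<le> i \<Longrightarrow> b s i \<in> borel_measurable M"
proof -
  assume i: "1 \<le> i"
  note [measurable] = Y_joint[OF i]
  show ?thesis unfolding b_def[abs_def] ip_def by measurable
qed

lemma Y_norm_measurable: "1 \<le> i \<Longrightarrow> (\<lambda>\<omega>. ip (Y i \<omega>) (Y i \<omega>)) \<in> borel_measurable M"
proof -
  assume i: "1 \<le> i"
  note [measurable] = Y_joint[OF i]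
  show ?thesis unfolding ip_def by measurable
qed

lemma Y_norm_integrable:
  assumes i: "1 \<le> i"
  shows "integrable M (\<lambda>\<omega>. ip (Y i \<omega>) (Y i \<omega>))"
proof (rule integrableI_nonneg)
  have "(\<integral>\<^sup>+\<omega>. ennreal (ip (Y i \<omega>) (Y i \<omega>)) \<partial>M) = (\<integral>\<^sup>+\<omega>. \<integral>\<^sup>+t. ennreal ((Y i \<omega> t)\<^sup>2) \<partial>unit_leb \<partial>M)"
    using Y_L2[OF i] by (intro nn_integral_cong) (simp add: ip_self nn_integral_eq_integral L2_def)
  also have "\<dots> = (\<integral>\<^sup>+t. ennreal (\<sigma> t t) \<partial>unit_leb)" by (rule nn_integral_Y_square[OF i])
  also have "\<dots> \<le> (\<integral>\<^sup>+t. ennreal C_\<sigma> \<partial>unit_leb)"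
    using \<sigma>_le by (intro nn_integral_mono ennreal_leI) (force simp: abs_le_iff)
  also have "\<dots> < \<infinity>" by (simp add: emeasure_unit_leb)
  finally show "(\<integral>\<^sup>+\<omega>. ennreal (ip (Y i \<omega>) (Y i \<omega>)) \<partial>M) < \<infinity>" .
qed (simp_all add: ip_nonneg Y_norm_measurable[OF i])

lemma b_square_le: "1 \<le> i \<Longrightarrow> \<omega> \<in> space M \<Longrightarrow> (b s i \<omega>)\<^sup>2 \<le> ip (Y i \<omega>) (Y i \<omega>)"
  using ip_Cauchy_Schwarz[OF Y_L2 basis.basis_L2, of i \<omega> s] by (simp add: b_def basis.orthonormal)

lemma b_sq_int: "1 \<le> i \<Longrightarrow> b s i \<in> sq_int M"
proof (rule sq_intI)
  assume i: "1 \<le> i"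
  show "b s i \<in> borel_measurable M" by (rule b_measurable[OF i])
  then show "integrable M (\<lambda>\<omega>. (b s i \<omega>)\<^sup>2)"
    by (intro Bochner_Integration.integrable_bound[OF Y_norm_integrable[OF i]])
       (auto simp: ip_nonneg b_square_le[OF i])
qed

lemma b_sums_norm: "1 \<le> i \<Longrightarrow> \<omega> \<in> space M \<Longrightarrow> (\<lambda>s. (b s i \<omega>)\<^sup>2) sums ip (Y i \<omega>) (Y i \<omega>)"
  using basis.Parseval_square[OF Y_L2] by (simp add: b_def)

text \<open>Fubini's theorem. With \<open>Z\<close> constant, a value of the observation or another
  score, it yields the mean and the covariances of the scores.\<close>

lemma expectation_score_mult:
  assumes i: "1 \<le> i" and Z: "Z \<in> sq_int M"
  shows "expectation (\<lambda>\<omega>. b s i \<omega> * Z \<omega>) = (\<integral>t. expectation (\<lambda>\<omega>. Y i \<omega> t * Z \<omega>) * e s t \<partial>unit_leb)"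
proof -
  note [measurable] = Y_joint[OF i] sq_int_measurable[OF Z]
  have "(\<lambda>(\<omega>, t). Z \<omega>) \<in> sq_int (M \<Otimes>\<^sub>M unit_leb)"
  proof (rule sq_intI)
    have "(\<integral>\<^sup>+x. ennreal ((case x of (\<omega>, t) \<Rightarrow> Z \<omega>)\<^sup>2) \<partial>(M \<Otimes>\<^sub>M unit_leb)) = (\<integral>\<^sup>+\<omega>. ennreal ((Z \<omega>)\<^sup>2) \<partial>M)"
      by (subst unit_leb.nn_integral_fst[symmetric]) (simp_all add: emeasure_unit_leb)
    also have "\<dots> < \<infinity>" using sq_int_integrable[OF Z] by (simp add: nn_integral_eq_integral)
    finally show "integrable (M \<Otimes>\<^sub>M unit_leb) (\<lambda>x. (case x of (\<omega>, t) \<Rightarrow> Z \<omega>)\<^sup>2)"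
      by (intro integrableI_nonneg) auto
    show "(\<lambda>(\<omega>, t). Z \<omega>) \<in> borel_measurable (M \<Otimes>\<^sub>M unit_leb)"
      unfolding split_beta' by (rule measurable_compose[OF measurable_fst sq_int_measurable[OF Z]])
  qed
  then have "(\<lambda>x. (case x of (\<omega>, t) \<Rightarrow> e s t) * (case x of (\<omega>, t) \<Rightarrow> Z \<omega>)) \<in> sq_int (M \<Otimes>\<^sub>M unit_leb)"
    by (rule sq_int_bounded_mult[where C=C_e]) (auto simp: space_pair_measure e_le)
  from sq_int_integrable_mult[OF Y_joint_sq_int[OF i] this]
  have int: "integrable (M \<Otimes>\<^sub>M unit_leb) (\<lambda>(\<omega>, t). Y i \<omega> t * (e s t * Z \<omega>))" by (simp add: split_beta')
  have "expectation (\<lambda>\<omega>. b s i \<omega> * Z \<omega>) = expectation (\<lambda>\<omega>. \<integral>t. Y i \<omega> t * (e s t * Z \<omega>) \<partial>unit_leb)"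
    unfolding b_def ip_def by (simp flip: mult.assoc)
  also have "\<dots> = (\<integral>t. expectation (\<lambda>\<omega>. Y i \<omega> t * (e s t * Z \<omega>)) \<partial>unit_leb)"
    by (rule MU.Fubini_integral[OF int, symmetric])
  also have "\<dots> = (\<integral>t. expectation (\<lambda>\<omega>. Y i \<omega> t * Z \<omega>) * e s t \<partial>unit_leb)"
    by (simp only: mult.commute[of "e s _"] mult.assoc[symmetric] integral_mult_left_zero)
  finally show ?thesis .
qed

lemma b_expectation:
  assumes i: "1 \<le> i"
  shows "expectation (b s i) = 0"
proof -
  have "expectation (\<lambda>\<omega>. b s i \<omega> * 1) = (\<integral>t. expectation (\<lambda>\<omega>. Y i \<omega> t * 1) * e s t \<partial>unit_leb)"
    by (rule expectation_score_mult[OF i]) (simp add: sq_int_def)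
  also have "\<dots> = (\<integral>t. 0 \<partial>unit_leb)"
    using Y_expectation[OF i] by (intro Bochner_Integration.integral_cong) auto
  finally show ?thesis by simp
qed

lemma b_Y_covariance: "1 \<le> i \<Longrightarrow> t \<in> {0..1} \<Longrightarrow> expectation (\<lambda>\<omega>. b s i \<omega> * Y i \<omega> t) = l s * e s t"
proof -
  assume i: "1 \<le> i" and t: "t \<in> {0..1}"
  have "expectation (\<lambda>\<omega>. b s i \<omega> * Y i \<omega> t) = (\<integral>u. expectation (\<lambda>\<omega>. Y i \<omega> u * Y i \<omega> t) * e s u \<partial>unit_leb)"
    by (rule expectation_score_mult[OF i Y_sq_int[OF i t]])
  also have "\<dots> = (\<integral>u. \<sigma> t u * e s u \<partial>unit_leb)"
    by (intro Bochner_Integration.integral_cong refl) (simp add: Y_covariance[OF i t, symmetric] mult.commute)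
  finally show ?thesis using e_eigen[OF t, of s] by (simp add: int_op_def)
qed

lemma b_covariance: "1 \<le> i \<Longrightarrow> expectation (\<lambda>\<omega>. b p i \<omega> * b q i \<omega>) = (if p = q then l p else 0)"
proof -
  assume i: "1 \<le> i"
  have "expectation (\<lambda>\<omega>. b p i \<omega> * b q i \<omega>) = (\<integral>t. expectation (\<lambda>\<omega>. Y i \<omega> t * b q i \<omega>) * e p t \<partial>unit_leb)"
    by (rule expectation_score_mult[OF i b_sq_int[OF i]])
  also have "\<dots> = (\<integral>t. l q * (e q t * e p t) \<partial>unit_leb)"
    by (intro Bochner_Integration.integral_cong refl)
       (simp add: b_Y_covariance[OF i] mult.commute[of "Y i _ _"])
  also have "\<dots> = l q * ip (e q) (e p)" by (simp add: ip_def)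
  finally show ?thesis by (simp add: basis.orthonormal)
qed

lemma b_second_moment: "1 \<le> i \<Longrightarrow> expectation (\<lambda>\<omega>. (b s i \<omega>)\<^sup>2) = l s"
  using b_covariance[of i s s] by (simp add: power2_eq_square)

lemma l_nonneg: "0 \<le> l s"
proof -
  have "0 \<le> expectation (\<lambda>\<omega>. (b s 1 \<omega>)\<^sup>2)" by simp
  then show ?thesis by (simp only: b_second_moment[OF order_refl])
qed

text \<open>The trace identity: by Parseval and monotone interchange the eigenvalues sum to the
  expected squared norm of a centred observation.\<close>

lemma l_summable: "summable l"
proof (rule summable_ennreal_le)
  show "0 \<le> l s" for s by (rule l_nonneg)
  have "(\<Sum>s. ennreal (l s)) = (\<Sum>s. \<integral>\<^sup>+\<omega>. ennreal ((b s 1 \<omega>)\<^sup>2) \<partial>M)"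
    using sq_int_integrable[OF b_sq_int[of 1]] by (simp add: nn_integral_eq_integral b_second_moment)
  also have "\<dots> = (\<integral>\<^sup>+\<omega>. (\<Sum>s. ennreal ((b s 1 \<omega>)\<^sup>2)) \<partial>M)"
    using b_measurable[of 1] by (subst nn_integral_suminf) (auto intro!: measurable_compose[OF _ measurable_ennreal])
  also have "\<dots> = (\<integral>\<^sup>+\<omega>. ennreal (ip (Y 1 \<omega>) (Y 1 \<omega>)) \<partial>M)"
    using b_sums_norm[of 1] by (intro nn_integral_cong suminf_ennreal_eq) auto
  also have "\<dots> = ennreal (expectation (\<lambda>\<omega>. ip (Y 1 \<omega>) (Y 1 \<omega>)))"
    using Y_norm_integrable[of 1] by (simp add: nn_integral_eq_integral ip_nonneg)
  finally show "(\<Sum>s. ennreal (l s)) \<le> ennreal (expectation (\<lambda>\<omega>. ip (Y 1 \<omega>) (Y 1 \<omega>)))" by simp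
  show "0 \<le> expectation (\<lambda>\<omega>. ip (Y 1 \<omega>) (Y 1 \<omega>))" by (simp add: ip_nonneg)
qed

section \<open>Scores as measurable functionals of the path\<close>

text \<open>
  Independence refers to the product sigma-algebra, for which the integral defining a score
  is not measurable in the path. Replacing the path by its values at the grid points
  \<open>j / m\<close> gives measurable functionals converging to the score in mean square, because
  the process is mean square continuous.
\<close>

definition grid :: "nat \<Rightarrow> real \<Rightarrow> real" where
  "grid m t = real (nat \<lfloor>real (Suc m) * t\<rfloor>) / real (Suc m)"

lemma grid_in: "t \<in> {0..1} \<Longrightarrow> grid m t \<in> {0..1}"
  and grid_dist: "t \<in> {0..1} \<Longrightarrow> \<bar>grid m t - t\<bar> \<le> 1 / real (Suc m)"
  and grid_index: "t \<in> {0..1} \<Longrightarrow> nat \<lfloor>real (Suc m) * t\<rfloor> \<in> {..Suc m}"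
proof -
  assume t: "t \<in> {0..1}"
  define K where "K = real (Suc m)"
  have K: "0 < K" by (simp add: K_def)
  have t0: "0 \<le> K * t" and t1: "K * t \<le> K" using t K by (auto simp: mult_left_le)
  have f: "real (nat \<lfloor>K * t\<rfloor>) \<le> K * t" "K * t - 1 < real (nat \<lfloor>K * t\<rfloor>)"
    using t0 by linarith+
  then have fK: "real (nat \<lfloor>K * t\<rfloor>) \<le> K" using t1 by linarith
  then show "nat \<lfloor>real (Suc m) * t\<rfloor> \<in> {..Suc m}"
    unfolding K_def by (simp only: of_nat_le_iff atMost_iff)
  show "grid m t \<in> {0..1}" unfolding grid_def K_def[symmetric] using fK K by simp
  have "\<bar>real (nat \<lfloor>K * t\<rfloor>) - K * t\<bar> \<le> 1" using f by linarith
  moreover have "grid m t - t = (real (nat \<lfloor>K * t\<rfloor>) - K * t) / K"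
    unfolding grid_def K_def[symmetric] using K by (simp add: diff_divide_distrib)
  ultimately have "\<bar>grid m t - t\<bar> \<le> 1 / K"
    using K by (simp add: divide_right_mono)
  then show "\<bar>grid m t - t\<bar> \<le> 1 / real (Suc m)" unfolding K_def .
qed

lemma grid_tendsto: "t \<in> {0..1} \<Longrightarrow> (\<lambda>m. grid m t) \<longlonglongrightarrow> t"
proof -
  assume t: "t \<in> {0..1}"
  have "(\<lambda>m. grid m t - t) \<longlonglongrightarrow> 0"
    by (rule Lim_null_comparison[OF always_eventually lim_1_over_n[THEN LIMSEQ_Suc]])
       (use grid_dist[OF t] in auto)
  then show ?thesis by (simp add: LIM_zero_iff)
qed

text \<open>The rounded argument takes countably many values, so joint measurability follows from
  measurability at single arguments. Evaluation of a path at a varying argument is not jointly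
  measurable on the path space, hence the rounding.\<close>

lemma grid_measurable:
  assumes f: "\<And>u. u \<in> {0..1} \<Longrightarrow> f u \<in> borel_measurable N"
  shows "(\<lambda>(x, t). f (grid m t) x :: real) \<in> borel_measurable (N \<Otimes>\<^sub>M unit_leb)"
proof -
  \<comment> \<open>The default 0 beyond \<open>Suc m\<close> keeps every piece measurable, as
    \<open>f\<close> is only controlled on the unit interval.\<close>
  let ?f = "\<lambda>j x. if j \<le> Suc m then f (real j / real (Suc m)) (fst x) else 0"
  have "(\<lambda>x. ?f (nat \<lfloor>real (Suc m) * snd x\<rfloor>) x) \<in> borel_measurable (N \<Otimes>\<^sub>M unit_leb)"
  proof (rule measurable_compose_countable[where f="?f"])
    fix j :: nat
    show "?f j \<in> borel_measurable (N \<Otimes>\<^sub>M unit_leb)"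
    proof (cases "j \<le> Suc m")
      case True
      then have "real j / real (Suc m) \<in> {0..1}" by (auto simp: divide_le_eq_1 simp del: of_nat_Suc)
      from measurable_compose[OF measurable_fst f[OF this]] show ?thesis using True by simp
    qed simp
  next
    have "(\<lambda>t. nat \<lfloor>real (Suc m) * t\<rfloor>) \<in> measurable unit_leb (count_space UNIV)"
    proof -
      have [measurable]: "(\<lambda>t. t) \<in> borel_measurable unit_leb"
        by (intro measurable_restrict_space1) (simp add: measurable_completion)
      show ?thesis by measurable
    qed
    then show "(\<lambda>x. nat \<lfloor>real (Suc m) * snd x\<rfloor>) \<in> measurable (N \<Otimes>\<^sub>M unit_leb) (count_space UNIV)"
      by (rule measurable_compose[OF measurable_snd])
  qed
  moreover have "?f (nat \<lfloor>real (Suc m) * snd x\<rfloor>) x = (case x of (x, t) \<Rightarrow> f (grid m t) x)"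
    if "x \<in> space (N \<Otimes>\<^sub>M unit_leb)" for x
    using that grid_index[of "snd x" m] by (auto simp: space_pair_measure grid_def)
  ultimately show ?thesis by (subst measurable_cong) (auto simp only:)
qed

end

context functional_sample
begin

definition grid_score :: "nat \<Rightarrow> nat \<Rightarrow> (real \<Rightarrow> real) \<Rightarrow> real" where
  "grid_score s m x = (\<integral>t. (x (grid m t) - \<mu> (grid m t)) * e s t \<partial>unit_leb)"

lemma grid_score_measurable: "grid_score s m \<in> borel_measurable path_space"
proof -
  have "(\<lambda>x. x u - \<mu> u) \<in> borel_measurable path_space" if "u \<in> {0..1}" for u
    by (intro borel_measurable_diff borel_measurable_const measurable_component_singleton that)
  from grid_measurable[of "\<lambda>u x. x u - \<mu> u" path_space m, OF this]
  have [measurable]: "(\<lambda>(x, t). x (grid m t) - \<mu> (grid m t)) \<in> borel_measurable (path_space \<Otimes>\<^sub>M unit_leb)" by simp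
  show ?thesis unfolding grid_score_def[abs_def]
    by (rule unit_leb.borel_measurable_lebesgue_integral) measurable
qed

lemma grid_score_path: "\<omega> \<in> space M \<Longrightarrow> grid_score s m (path i \<omega>) = ip (\<lambda>t. Y i \<omega> (grid m t)) (e s)"
  unfolding grid_score_def ip_def Y_def path_def
  using grid_in by (intro Bochner_Integration.integral_cong) auto

lemma Y_measurable: "1 \<le> i \<Longrightarrow> t \<in> {0..1} \<Longrightarrow> (\<lambda>\<omega>. Y i \<omega> t) \<in> borel_measurable M"
  by (rule sq_int_measurable[OF Y_sq_int])

lemma Y_grid_joint: "1 \<le> i \<Longrightarrow> (\<lambda>(\<omega>, t). Y i \<omega> (grid m t)) \<in> borel_measurable (M \<Otimes>\<^sub>M unit_leb)"
  using grid_measurable[of "\<lambda>u \<omega>. Y i \<omega> u" M m] Y_measurable by simp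

lemma Y_grid_L2:
  assumes i: "1 \<le> i" and \<omega>: "\<omega> \<in> space M"
  shows "(\<lambda>t. Y i \<omega> (grid m t)) \<in> L2"
  unfolding L2_eq_sq_int
proof (rule unit_leb.bounded_sq_int)
  show "(\<lambda>t. Y i \<omega> (grid m t)) \<in> borel_measurable unit_leb"
    using measurable_Pair2[OF Y_grid_joint[OF i] \<omega>] by simp
  fix t assume "t \<in> space unit_leb"
  then have "nat \<lfloor>real (Suc m) * t\<rfloor> \<in> {..Suc m}" by (intro grid_index) simp
  then have "(\<lambda>j. \<bar>Y i \<omega> (real j / real (Suc m))\<bar>) (nat \<lfloor>real (Suc m) * t\<rfloor>) \<le> (\<Sum>j\<le>Suc m. \<bar>Y i \<omega> (real j / real (Suc m))\<bar>)"
    by (intro member_le_sum) auto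
  then show "\<bar>Y i \<omega> (grid m t)\<bar> \<le> (\<Sum>j\<le>Suc m. \<bar>Y i \<omega> (real j / real (Suc m))\<bar>)"
    by (simp only: grid_def)
qed

text \<open>Links mean square continuity of the process to continuity of the covariance
  function.\<close>

lemma Y_increment:
  assumes i: "1 \<le> i" and t: "t \<in> {0..1}" and u: "u \<in> {0..1}"
  shows "(\<integral>\<^sup>+\<omega>. ennreal ((Y i \<omega> t - Y i \<omega> u)\<^sup>2) \<partial>M) = ennreal (\<sigma> t t - 2 * \<sigma> t u + \<sigma> u u)"
proof -
  have "(\<integral>\<^sup>+\<omega>. ennreal ((Y i \<omega> t - Y i \<omega> u)\<^sup>2) \<partial>M) = ennreal (expectation (\<lambda>\<omega>. (Y i \<omega> t - Y i \<omega> u)\<^sup>2))"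
    using sq_int_integrable[OF sq_int_diff[OF Y_sq_int[OF i t] Y_sq_int[OF i u]]]
    by (simp add: nn_integral_eq_integral)
  also have "expectation (\<lambda>\<omega>. (Y i \<omega> t - Y i \<omega> u)\<^sup>2)
      = expectation (\<lambda>\<omega>. (Y i \<omega> t)\<^sup>2 - 2 * (Y i \<omega> t * Y i \<omega> u) + (Y i \<omega> u)\<^sup>2)"
    by (intro Bochner_Integration.integral_cong refl) (simp add: power2_diff)
  also have "\<dots> = \<sigma> t t - 2 * \<sigma> t u + \<sigma> u u"
    using sq_int_integrable[OF Y_sq_int[OF i t]] sq_int_integrable[OF Y_sq_int[OF i u]]
      sq_int_integrable_mult[OF Y_sq_int[OF i t] Y_sq_int[OF i u]]
    by (simp add: Y_second_moment[OF i t] Y_second_moment[OF i u] Y_covariance[OF i t u])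
  finally show ?thesis .
qed

text \<open>Cauchy-Schwarz against \<open>e s\<close> bounds the squared error by the integrated
  squared increment of the path. The expectation of that is the integral of \<open>F m\<close>,
  which vanishes in the limit by dominated convergence, the covariance being continuous and
  bounded.\<close>

lemma grid_score_mean_square:
  assumes i: "1 \<le> i"
  shows "(\<lambda>\<omega>. grid_score s m (path i \<omega>)) \<in> sq_int M"
    and "(\<lambda>m. expectation (\<lambda>\<omega>. (grid_score s m (path i \<omega>) - b s i \<omega>)\<^sup>2)) \<longlonglongrightarrow> 0"
proof -
  define F where "F m t = (\<integral>\<^sup>+\<omega>. ennreal ((Y i \<omega> t - Y i \<omega> (grid m t))\<^sup>2) \<partial>M)" for m t
  note [measurable] = Y_joint[OF i] Y_grid_joint[OF i]
  have gm[measurable]: "(\<lambda>\<omega>. grid_score s m (path i \<omega>)) \<in> borel_measurable M" for m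
    using paths.P_measurable[OF i] grid_score_measurable by (rule measurable_compose)
  note b_measurable[OF i, measurable]
  have F_meas: "F m \<in> borel_measurable unit_leb" for m
  proof -
    have "(\<lambda>(t, \<omega>). ennreal ((Y i \<omega> t - Y i \<omega> (grid m t))\<^sup>2)) \<in> borel_measurable (unit_leb \<Otimes>\<^sub>M M)"
      using measurable_pair_swap[of "\<lambda>(\<omega>, t). ennreal ((Y i \<omega> t - Y i \<omega> (grid m t))\<^sup>2)" M unit_leb borel]
      by (simp add: split_beta')
    then show ?thesis unfolding F_def by (rule borel_measurable_nn_integral)
  qed
  have F_eq: "F m t = ennreal (\<sigma> t t - 2 * \<sigma> t (grid m t) + \<sigma> (grid m t) (grid m t))" if "t \<in> {0..1}" for m t
    unfolding F_def by (rule Y_increment[OF i that grid_in[OF that]])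
  have F_lim: "(\<lambda>m. F m t) \<longlonglongrightarrow> 0" if t: "t \<in> {0..1}" for t
  proof -
    have "(\<lambda>m. (\<lambda>(t, s). \<sigma> t s) (grid m t, grid m t)) \<longlonglongrightarrow> (\<lambda>(t, s). \<sigma> t s) (t, t)"
      by (rule continuous_on_tendsto_compose[OF cov_cont tendsto_Pair]) (use t grid_in[OF t] grid_tendsto[OF t] in auto)
    moreover have "(\<lambda>m. (\<lambda>(t, s). \<sigma> t s) (t, grid m t)) \<longlonglongrightarrow> (\<lambda>(t, s). \<sigma> t s) (t, t)"
      by (rule continuous_on_tendsto_compose[OF cov_cont tendsto_Pair]) (use t grid_in[OF t] grid_tendsto[OF t] in auto)
    ultimately have "(\<lambda>m. \<sigma> (grid m t) (grid m t)) \<longlonglongrightarrow> \<sigma> t t" "(\<lambda>m. \<sigma> t (grid m t)) \<longlonglongrightarrow> \<sigma> t t"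
      by simp_all
    then have "(\<lambda>m. \<sigma> t t - 2 * \<sigma> t (grid m t) + \<sigma> (grid m t) (grid m t)) \<longlonglongrightarrow> \<sigma> t t - 2 * \<sigma> t t + \<sigma> t t"
      by (intro tendsto_intros) auto
    then have "(\<lambda>m. ennreal (\<sigma> t t - 2 * \<sigma> t (grid m t) + \<sigma> (grid m t) (grid m t))) \<longlonglongrightarrow> ennreal 0"
      by (intro tendsto_ennrealI) simp
    then show ?thesis by (simp add: F_eq[OF t])
  qed
  have F_le: "F m t \<le> ennreal (4 * C_\<sigma>)" if t: "t \<in> {0..1}" for m t
    unfolding F_eq[OF t]
    using \<sigma>_le[OF t t] \<sigma>_le[OF t grid_in[OF t], of m] \<sigma>_le[OF grid_in[OF t] grid_in[OF t], of m m]
    by (intro ennreal_leI) (simp add: abs_le_iff)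
  have "(\<lambda>m. \<integral>\<^sup>+t. F m t \<partial>unit_leb) \<longlonglongrightarrow> (\<integral>\<^sup>+t. 0 \<partial>unit_leb)"
  proof (rule nn_integral_dominated_convergence[where w="\<lambda>_. ennreal (4 * C_\<sigma>)"])
    show "AE t in unit_leb. F m t \<le> ennreal (4 * C_\<sigma>)" for m
      using F_le by (intro AE_I2) simp
    show "(\<integral>\<^sup>+t. ennreal (4 * C_\<sigma>) \<partial>unit_leb) < \<infinity>"
      by (simp add: emeasure_unit_leb)
    show "AE t in unit_leb. (\<lambda>m. F m t) \<longlonglongrightarrow> 0" using F_lim by (intro AE_I2) simp
  qed (use F_meas in auto)
  then have F0: "(\<lambda>m. \<integral>\<^sup>+t. F m t \<partial>unit_leb) \<longlonglongrightarrow> 0" by simp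
  have le: "(\<integral>\<^sup>+\<omega>. ennreal ((grid_score s m (path i \<omega>) - b s i \<omega>)\<^sup>2) \<partial>M) \<le> (\<integral>\<^sup>+t. F m t \<partial>unit_leb)" for m
  proof -
    have "(\<integral>\<^sup>+\<omega>. ennreal ((grid_score s m (path i \<omega>) - b s i \<omega>)\<^sup>2) \<partial>M)
        \<le> (\<integral>\<^sup>+\<omega>. \<integral>\<^sup>+t. ennreal ((Y i \<omega> t - Y i \<omega> (grid m t))\<^sup>2) \<partial>unit_leb \<partial>M)"
    proof (rule nn_integral_mono)
      fix \<omega> assume \<omega>: "\<omega> \<in> space M"
      define D where "D t = Y i \<omega> t - Y i \<omega> (grid m t)" for t
      have D: "D \<in> L2" unfolding D_def by (intro L2_diff Y_L2 Y_grid_L2 i \<omega>)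
      have "grid_score s m (path i \<omega>) - b s i \<omega> = - ip D (e s)"
        unfolding D_def b_def grid_score_path[OF \<omega>]
        by (subst ip_diff_left) (auto intro: Y_L2 Y_grid_L2 i \<omega> basis.basis_L2)
      then have "(grid_score s m (path i \<omega>) - b s i \<omega>)\<^sup>2 \<le> ip D D"
        using ip_Cauchy_Schwarz[OF D basis.basis_L2, of s] by (simp add: basis.orthonormal)
      then have "ennreal ((grid_score s m (path i \<omega>) - b s i \<omega>)\<^sup>2) \<le> ennreal (ip D D)" by (rule ennreal_leI)
      also have "\<dots> = (\<integral>\<^sup>+t. ennreal ((D t)\<^sup>2) \<partial>unit_leb)"
        using D by (simp add: ip_self nn_integral_eq_integral L2_def)
      finally show "ennreal ((grid_score s m (path i \<omega>) - b s i \<omega>)\<^sup>2)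
          \<le> (\<integral>\<^sup>+t. ennreal ((Y i \<omega> t - Y i \<omega> (grid m t))\<^sup>2) \<partial>unit_leb)" by (simp add: D_def)
    qed
    also have "\<dots> = (\<integral>\<^sup>+t. F m t \<partial>unit_leb)"
      unfolding F_def by (rule MU.Fubini'[symmetric]) measurable
    finally show ?thesis .
  qed
  have F_fin: "(\<integral>\<^sup>+t. F m t \<partial>unit_leb) \<le> ennreal (4 * C_\<sigma>)" for m
  proof -
    have "(\<integral>\<^sup>+t. F m t \<partial>unit_leb) \<le> (\<integral>\<^sup>+t. ennreal (4 * C_\<sigma>) \<partial>unit_leb)"
      using F_le by (intro nn_integral_mono) simp
    then show ?thesis by (simp add: emeasure_unit_leb)
  qed
  have d: "(\<lambda>\<omega>. grid_score s m (path i \<omega>) - b s i \<omega>) \<in> sq_int M" for m :: nat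
  proof (rule sq_intI)
    show "integrable M (\<lambda>\<omega>. (grid_score s m (path i \<omega>) - b s i \<omega>)\<^sup>2)"
    proof (rule integrableI_nonneg)
      show "(\<integral>\<^sup>+\<omega>. ennreal ((grid_score s m (path i \<omega>) - b s i \<omega>)\<^sup>2) \<partial>M) < \<infinity>"
        using order_trans[OF le F_fin] by (rule le_less_trans) simp
    qed auto
  qed measurable
  from sq_int_add[OF d b_sq_int[OF i, of s]] show "(\<lambda>\<omega>. grid_score s m (path i \<omega>)) \<in> sq_int M" by simp
  have "(\<lambda>m. \<integral>\<^sup>+\<omega>. ennreal ((grid_score s m (path i \<omega>) - b s i \<omega>)\<^sup>2) \<partial>M) \<longlonglongrightarrow> 0"
    by (rule tendsto_sandwich[OF _ _ tendsto_const F0]) (auto intro!: always_eventually le)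
  then have "(\<lambda>m. ennreal (expectation (\<lambda>\<omega>. (grid_score s m (path i \<omega>) - b s i \<omega>)\<^sup>2))) \<longlonglongrightarrow> ennreal 0"
    using sq_int_integrable[OF d] by (simp add: nn_integral_eq_integral)
  then show "(\<lambda>m. expectation (\<lambda>\<omega>. (grid_score s m (path i \<omega>) - b s i \<omega>)\<^sup>2)) \<longlonglongrightarrow> 0"
    by (rule tendsto_ennrealD) auto
qed

text \<open>A single functional must serve all observations. The subsequence is selected for the
  first one; its Cauchy property depends only on the law of the path and so carries over. For every
  other observation, mean square convergence identifies the limit with its own score.\<close>

lemma score_path_functional:
  "\<exists>g. g \<in> borel_measurable path_space \<and> (\<forall>i\<ge>1. AE \<omega> in M. b s i \<omega> = g (path i \<omega>))"
proof -
  obtain r :: "nat \<Rightarrow> nat" where r: "strict_mono r"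
    and lim1: "AE \<omega> in M. (\<lambda>k. grid_score s (r k) (path 1 \<omega>)) \<longlonglongrightarrow> b s 1 \<omega>"
    using sq_int_conv_AE_subseq[OF grid_score_mean_square(1)[OF order_refl] b_sq_int[OF order_refl]
        grid_score_mean_square(2)[OF order_refl]] by blast
  define g where "g x = lim (\<lambda>k. grid_score s (r k) x)" for x
  note grid_score_measurable[measurable]
  have cauchy_pred: "Measurable.pred path_space (\<lambda>x. Cauchy (\<lambda>k. grid_score s (r k) x))"
    unfolding pred_def by (rule sets_Collect_Cauchy) (rule grid_score_measurable)
  have "g \<in> borel_measurable path_space" unfolding g_def[abs_def] by measurable
  moreover have "AE \<omega> in M. b s i \<omega> = g (path i \<omega>)" if i: "1 \<le> i" for i
  proof -
    have "AE \<omega> in M. Cauchy (\<lambda>k. grid_score s (r k) (path 1 \<omega>))"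
      using lim1 by eventually_elim (rule LIMSEQ_imp_Cauchy)
    then have cauchy: "AE \<omega> in M. Cauchy (\<lambda>k. grid_score s (r k) (path i \<omega>))"
      by (subst paths.AE_P_iff[OF i order_refl cauchy_pred])
    have "(\<lambda>k. expectation (\<lambda>\<omega>. (grid_score s (r k) (path i \<omega>) - b s i \<omega>)\<^sup>2)) \<longlonglongrightarrow> 0"
      using LIMSEQ_subseq_LIMSEQ[OF grid_score_mean_square(2)[OF i, of s] r] by (simp add: comp_def)
    from sq_int_conv_AE_subseq[OF grid_score_mean_square(1)[OF i] b_sq_int[OF i] this]
    obtain r' :: "nat \<Rightarrow> nat" where r': "strict_mono r'"
      and lim: "AE \<omega> in M. (\<lambda>k. grid_score s (r (r' k)) (path i \<omega>)) \<longlonglongrightarrow> b s i \<omega>" by auto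
    show ?thesis using cauchy lim
    proof eventually_elim
      case (elim \<omega>)
      have "(\<lambda>k. grid_score s (r k) (path i \<omega>)) \<longlonglongrightarrow> g (path i \<omega>)"
        using elim(1) by (simp add: g_def Cauchy_convergent_iff convergent_LIMSEQ_iff)
      from LIMSEQ_subseq_LIMSEQ[OF this r'] have "(\<lambda>k. grid_score s (r (r' k)) (path i \<omega>)) \<longlonglongrightarrow> g (path i \<omega>)"
        by (simp add: comp_def)
      then show ?case using elim(2) LIMSEQ_unique by blast
    qed
  qed
  ultimately show ?thesis by blast
qed

definition score_fun :: "nat \<Rightarrow> (real \<Rightarrow> real) \<Rightarrow> real" where
  "score_fun s = (SOME g. g \<in> borel_measurable path_space \<and> (\<forall>i\<ge>1. AE \<omega> in M. b s i \<omega> = g (path i \<omega>)))"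

lemma score_fun_measurable[measurable]: "score_fun s \<in> borel_measurable path_space"
  and b_eq_score_fun: "1 \<le> i \<Longrightarrow> AE \<omega> in M. b s i \<omega> = score_fun s (path i \<omega>)"
  using someI_ex[OF score_path_functional[of s]] unfolding score_fun_def by auto

lemma AE_all_scores: "1 \<le> i \<Longrightarrow> AE \<omega> in M. \<forall>s. b s i \<omega> = score_fun s (path i \<omega>)"
  unfolding AE_all_countable using b_eq_score_fun by blast

text \<open>The countably many score identities hold simultaneously almost surely, so a functional
  of all scores can be checked on one event.\<close>

lemma iid_functionalI:
  assumes "\<And>i. 1 \<le> i \<Longrightarrow> Z i \<in> borel_measurable M" "h \<in> borel_measurable path_space"
    and "\<And>i \<omega>. 1 \<le> i \<Longrightarrow> \<omega> \<in> space M \<Longrightarrow> (\<forall>s. b s i \<omega> = score_fun s (path i \<omega>)) \<Longrightarrow> Z i \<omega> = h (path i \<omega>)"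
    and "integrable M (\<lambda>\<omega>. (Z 1 \<omega>)\<^sup>2)" "expectation (Z 1) = 0"
  shows "iid_functional M path_space path Z h"
proof
  show "AE \<omega> in M. Z i \<omega> = h (path i \<omega>)" if "1 \<le> i" for i
    using AE_all_scores[OF that] AE_space by eventually_elim (rule assms(3)[OF that])
qed (use assms in auto)

lemma iid_functional_Y:
  assumes t: "t \<in> {0..1}"
  shows "iid_functional M path_space path (\<lambda>i \<omega>. Y i \<omega> t) (\<lambda>x. x t - \<mu> t)"
proof (rule iid_functionalI)
  show "(\<lambda>x. x t - \<mu> t) \<in> borel_measurable path_space"
    by (intro borel_measurable_diff borel_measurable_const measurable_component_singleton t)
  show "Y i \<omega> t = path i \<omega> t - \<mu> t" for i \<omega> using t by (simp add: Y_def path_def)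
  show "integrable M (\<lambda>\<omega>. (Y 1 \<omega> t)\<^sup>2)" by (intro sq_int_integrable Y_sq_int t) simp
qed (use t in \<open>simp_all add: Y_measurable Y_expectation\<close>)

lemma iid_functional_b: "iid_functional M path_space path (b s) (score_fun s)"
  by (rule iid_functionalI) (auto simp: b_measurable b_expectation score_fun_measurable intro!: sq_int_integrable b_sq_int)

end

section \<open>Moments of the empirical coefficient matrix\<close>

text \<open>Finite rectangles connect unordered summation over pairs with iterated series.\<close>

lemma double_suminf_ennreal_le_infsum:
  fixes a :: "nat \<Rightarrow> nat \<Rightarrow> real"
  assumes nn: "\<And>p q. 0 \<le> a p q" and s: "(\<lambda>(p, q). a p q) summable_on UNIV"
  shows "(\<Sum>q. \<Sum>p. ennreal (a p q)) \<le> ennreal (\<Sum>\<^sub>\<infinity>(p, q). a p q)"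
proof (rule suminf_le_const[OF summableI])
  fix Q
  have "(\<Sum>q<Q. \<Sum>p. ennreal (a p q)) = (\<Sum>p. \<Sum>q<Q. ennreal (a p q))"
    by (rule suminf_sum[symmetric]) (rule summableI)
  also have "\<dots> \<le> ennreal (\<Sum>\<^sub>\<infinity>(p, q). a p q)"
  proof (rule suminf_le_const[OF summableI])
    fix P
    have "(\<Sum>p<P. \<Sum>q<Q. a p q) = (\<Sum>(p, q)\<in>{..<P} \<times> {..<Q}. a p q)" by (simp add: sum.cartesian_product)
    also have "\<dots> \<le> (\<Sum>\<^sub>\<infinity>(p, q). a p q)" by (intro finite_sum_le_infsum s) (auto simp: nn)
    finally show "(\<Sum>p<P. \<Sum>q<Q. ennreal (a p q)) \<le> ennreal (\<Sum>\<^sub>\<infinity>(p, q). a p q)"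
      using nn by (simp add: sum_nonneg ennreal_leI)
  qed
  finally show "(\<Sum>q<Q. \<Sum>p. ennreal (a p q)) \<le> ennreal (\<Sum>\<^sub>\<infinity>(p, q). a p q)" .
qed

locale functional_sample_moments = functional_sample +
  assumes karhunen_loeve: "\<And>i t. 1 \<le> i \<Longrightarrow> t \<in> {0..1} \<Longrightarrow>
      (\<lambda>N. expectation (\<lambda>\<omega>. ((\<Sum>s<N. b s i \<omega> * e s t) - Y i \<omega> t)\<^sup>2)) \<longlonglongrightarrow> 0"
    and fourth_integrable: "\<And>i p q. 1 \<le> i \<Longrightarrow> integrable M (\<lambda>\<omega>. (b p i \<omega>)\<^sup>2 * (b q i \<omega>)\<^sup>2)"
    and fourth_summable: "(\<lambda>(p, q). expectation (\<lambda>\<omega>. (b p 1 \<omega>)\<^sup>2 * (b q 1 \<omega>)\<^sup>2)) summable_on UNIV"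
    and mixed_summable: "\<And>i r. 1 \<le> i \<Longrightarrow>
      (\<lambda>(q, s). expectation (\<lambda>\<omega>. (b r i \<omega>)\<^sup>2 * b q i \<omega> * b s i \<omega>)) summable_on UNIV"
begin

lemma b_mult_sq_int: "1 \<le> i \<Longrightarrow> (\<lambda>\<omega>. b p i \<omega> * b q i \<omega>) \<in> sq_int M"
  using fourth_integrable b_measurable
  by (intro sq_intI borel_measurable_times) (auto simp: power_mult_distrib)

definition cov_dev :: "nat \<Rightarrow> nat \<Rightarrow> nat \<Rightarrow> 'a \<Rightarrow> real" where
  "cov_dev n p q \<omega> = (1 / real n) * (\<Sum>i=1..n. b p i \<omega> * b q i \<omega>) - (if p = q then l p else 0)"

definition mean_dev :: "nat \<Rightarrow> nat \<Rightarrow> 'a \<Rightarrow> real" where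
  "mean_dev n p \<omega> = (1 / real n) * (\<Sum>i=1..n. b p i \<omega>)"

definition total_dev :: "nat \<Rightarrow> 'a \<Rightarrow> ennreal" where
  "total_dev n \<omega> = (\<Sum>q. \<Sum>p. ennreal ((cov_dev n p q \<omega>)\<^sup>2)) + (\<Sum>p. ennreal ((mean_dev n p \<omega>)\<^sup>2))"

text \<open>n times the expectation of \<open>total_dev n\<close> is at most this number: the fourth
  moments bound the matrix part, and the trace \<open>suminf l\<close> is the contribution of the
  mean scores.\<close>

definition total_dev_const :: real where
  "total_dev_const = (\<Sum>\<^sub>\<infinity>(p, q). expectation (\<lambda>\<omega>. (b p 1 \<omega>)\<^sup>2 * (b q 1 \<omega>)\<^sup>2)) + suminf l"

lemma iid_functional_product:
  "iid_functional M path_space path (\<lambda>i \<omega>. b p i \<omega> * b q i \<omega> - (if p = q then l p else 0))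
     (\<lambda>x. score_fun p x * score_fun q x - (if p = q then l p else 0))"
proof (rule iid_functionalI)
  have *: "(\<lambda>\<omega>. b p i \<omega> * b q i \<omega> - (if p = q then l p else 0)) \<in> sq_int M" if "1 \<le> i" for i
    by (intro sq_int_diff b_mult_sq_int that) (rule bounded_sq_int[of _ "\<bar>if p = q then l p else 0\<bar>"], auto)
  show "1 \<le> i \<Longrightarrow> (\<lambda>\<omega>. b p i \<omega> * b q i \<omega> - (if p = q then l p else 0)) \<in> borel_measurable M" for i
    by (rule sq_int_measurable[OF *])
  show "integrable M (\<lambda>\<omega>. (b p 1 \<omega> * b q 1 \<omega> - (if p = q then l p else 0))\<^sup>2)"
    by (rule sq_int_integrable[OF *]) simp
  show "expectation (\<lambda>\<omega>. b p 1 \<omega> * b q 1 \<omega> - (if p = q then l p else 0)) = 0"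
    using sq_int_imp_integrable[OF b_mult_sq_int[of 1 p q]] b_covariance[of 1 p q] by (simp add: prob_space)
qed (simp_all add: score_fun_measurable)

lemma cov_dev_sq_int: "1 \<le> n \<Longrightarrow> cov_dev n p q \<in> sq_int M"
proof -
  have "(\<lambda>\<omega>. (1 / real n) * (\<Sum>i=1..n. b p i \<omega> * b q i \<omega>) - (if p = q then l p else 0)) \<in> sq_int M"
    by (intro sq_int_diff sq_int_cmult sq_int_sum b_mult_sq_int)
       (auto intro: bounded_sq_int[of _ "\<bar>if p = q then l p else 0\<bar>"])
  then show ?thesis by (simp add: cov_dev_def[abs_def])
qed

lemma mean_dev_sq_int: "mean_dev n p \<in> sq_int M"
proof -
  have "(\<lambda>\<omega>. (1 / real n) * (\<Sum>i=1..n. b p i \<omega>)) \<in> sq_int M"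
    by (intro sq_int_cmult sq_int_sum b_sq_int) simp
  then show ?thesis by (simp add: mean_dev_def[abs_def])
qed

text \<open>The deviation is an average of n uncorrelated centred terms, and the variance of one
  product is at most its raw second moment.\<close>

lemma cov_dev_second_moment:
  assumes n: "1 \<le> n"
  shows "expectation (\<lambda>\<omega>. (cov_dev n p q \<omega>)\<^sup>2) \<le> (1 / real n) * expectation (\<lambda>\<omega>. (b p 1 \<omega>)\<^sup>2 * (b q 1 \<omega>)\<^sup>2)"
proof -
  define c where "c = (if p = q then l p else 0)"
  interpret Z: iid_functional M path_space path "\<lambda>i \<omega>. b p i \<omega> * b q i \<omega> - c" "\<lambda>x. score_fun p x * score_fun q x - c"
    unfolding c_def by (rule iid_functional_product)
  have "expectation (\<lambda>\<omega>. (b p 1 \<omega> * b q 1 \<omega> - c)\<^sup>2)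
      = expectation (\<lambda>\<omega>. (b p 1 \<omega>)\<^sup>2 * (b q 1 \<omega>)\<^sup>2 - 2 * c * (b p 1 \<omega> * b q 1 \<omega>) + c\<^sup>2)"
    by (intro Bochner_Integration.integral_cong refl) (simp add: power2_diff power_mult_distrib)
  also have "\<dots> = expectation (\<lambda>\<omega>. (b p 1 \<omega>)\<^sup>2 * (b q 1 \<omega>)\<^sup>2) - 2 * c * expectation (\<lambda>\<omega>. b p 1 \<omega> * b q 1 \<omega>) + c\<^sup>2"
    using sq_int_imp_integrable[OF b_mult_sq_int[of 1 p q]] fourth_integrable[of 1 p q] by (simp add: prob_space)
  also have "\<dots> \<le> expectation (\<lambda>\<omega>. (b p 1 \<omega>)\<^sup>2 * (b q 1 \<omega>)\<^sup>2)"
    using b_covariance[of 1 p q] by (simp add: c_def[symmetric] power2_eq_square)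
  finally have variance_le: "expectation (\<lambda>\<omega>. (b p 1 \<omega> * b q 1 \<omega> - c)\<^sup>2) \<le> expectation (\<lambda>\<omega>. (b p 1 \<omega>)\<^sup>2 * (b q 1 \<omega>)\<^sup>2)" .
  have "cov_dev n p q \<omega> = (1 / real n) * (\<Sum>i=1..n. b p i \<omega> * b q i \<omega> - c)" for \<omega>
    using n by (simp add: cov_dev_def c_def[symmetric] sum_subtractf field_simps)
  then have "expectation (\<lambda>\<omega>. (cov_dev n p q \<omega>)\<^sup>2) = (1 / real n)\<^sup>2 * expectation (\<lambda>\<omega>. (\<Sum>i=1..n. b p i \<omega> * b q i \<omega> - c)\<^sup>2)"
    by (simp only: power_mult_distrib integral_mult_right_zero)
  also have "\<dots> = (1 / real n) * expectation (\<lambda>\<omega>. (b p 1 \<omega> * b q 1 \<omega> - c)\<^sup>2)"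
    unfolding Z.sum_second_moment using n by (simp add: power2_eq_square)
  also have "\<dots> \<le> (1 / real n) * expectation (\<lambda>\<omega>. (b p 1 \<omega>)\<^sup>2 * (b q 1 \<omega>)\<^sup>2)"
    by (intro mult_left_mono variance_le) simp
  finally show ?thesis .
qed

lemma mean_dev_second_moment:
  assumes n: "1 \<le> n"
  shows "expectation (\<lambda>\<omega>. (mean_dev n p \<omega>)\<^sup>2) = (1 / real n) * l p"
proof -
  interpret Z: iid_functional M path_space path "b p" "score_fun p" by (rule iid_functional_b)
  have "expectation (\<lambda>\<omega>. (mean_dev n p \<omega>)\<^sup>2) = (1 / real n)\<^sup>2 * expectation (\<lambda>\<omega>. (\<Sum>i=1..n. b p i \<omega>)\<^sup>2)"
    by (simp only: mean_dev_def power_mult_distrib integral_mult_right_zero)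
  then show ?thesis
    unfolding Z.sum_second_moment using n b_second_moment[of 1 p] by (simp add: power2_eq_square)
qed

lemma total_dev_measurable: "1 \<le> n \<Longrightarrow> total_dev n \<in> borel_measurable M"
proof -
  assume n: "1 \<le> n"
  have [measurable]: "cov_dev n p q \<in> borel_measurable M" "mean_dev n p \<in> borel_measurable M" for p q
    using sq_int_measurable[OF cov_dev_sq_int[OF n]] sq_int_measurable[OF mean_dev_sq_int] by blast+
  show ?thesis unfolding total_dev_def[abs_def] by measurable
qed

lemma total_dev_const_nonneg: "0 \<le> total_dev_const"
  unfolding total_dev_const_def
  by (intro add_nonneg_nonneg infsum_nonneg suminf_nonneg l_summable l_nonneg) auto

lemma total_dev_expectation:
  assumes n: "1 \<le> n"
  shows "(\<integral>\<^sup>+\<omega>. total_dev n \<omega> \<partial>M) \<le> ennreal (total_dev_const / real n)"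
proof -
  have [measurable]: "cov_dev n p q \<in> borel_measurable M" "mean_dev n p \<in> borel_measurable M" for p q
    using sq_int_measurable[OF cov_dev_sq_int[OF n]] sq_int_measurable[OF mean_dev_sq_int] by blast+
  let ?a = "\<lambda>p q. expectation (\<lambda>\<omega>. (b p 1 \<omega>)\<^sup>2 * (b q 1 \<omega>)\<^sup>2)"
  have a: "0 \<le> ?a p q" for p q by simp
  have "(\<integral>\<^sup>+\<omega>. total_dev n \<omega> \<partial>M) = (\<Sum>q. \<Sum>p. \<integral>\<^sup>+\<omega>. ennreal ((cov_dev n p q \<omega>)\<^sup>2) \<partial>M)
      + (\<Sum>p. \<integral>\<^sup>+\<omega>. ennreal ((mean_dev n p \<omega>)\<^sup>2) \<partial>M)"
    unfolding total_dev_def by (simp add: nn_integral_add nn_integral_suminf)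
  also have "\<dots> = (\<Sum>q. \<Sum>p. ennreal (expectation (\<lambda>\<omega>. (cov_dev n p q \<omega>)\<^sup>2)))
      + (\<Sum>p. ennreal (expectation (\<lambda>\<omega>. (mean_dev n p \<omega>)\<^sup>2)))"
    using sq_int_integrable[OF cov_dev_sq_int[OF n]] sq_int_integrable[OF mean_dev_sq_int]
    by (simp add: nn_integral_eq_integral)
  also have "\<dots> \<le> (\<Sum>q. \<Sum>p. ennreal ((1 / real n) * ?a p q)) + (\<Sum>p. ennreal ((1 / real n) * l p))"
    using cov_dev_second_moment[OF n] mean_dev_second_moment[OF n]
    by (intro add_mono suminf_le summableI ennreal_leI) auto
  also have "(\<Sum>q. \<Sum>p. ennreal ((1 / real n) * ?a p q)) = ennreal (1 / real n) * (\<Sum>q. \<Sum>p. ennreal (?a p q))"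
    using a by (simp only: ennreal_mult'' ennreal_suminf_cmult)
  also have "(\<Sum>p. ennreal ((1 / real n) * l p)) = ennreal (1 / real n) * ennreal (suminf l)"
    using l_nonneg l_summable by (simp only: ennreal_mult'' ennreal_suminf_cmult suminf_ennreal2)
  also have "ennreal (1 / real n) * (\<Sum>q. \<Sum>p. ennreal (?a p q)) + ennreal (1 / real n) * ennreal (suminf l)
      \<le> ennreal (1 / real n) * ennreal (\<Sum>\<^sub>\<infinity>(p, q). ?a p q) + ennreal (1 / real n) * ennreal (suminf l)"
    by (intro add_right_mono mult_left_mono double_suminf_ennreal_le_infsum a fourth_summable) auto
  also have "\<dots> = ennreal (total_dev_const / real n)"
  proof -
    have "0 \<le> (\<Sum>\<^sub>\<infinity>(p, q). ?a p q)" by (intro infsum_nonneg) auto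
    moreover have "0 \<le> suminf l" by (intro suminf_nonneg l_summable l_nonneg)
    ultimately show ?thesis
      by (simp add: total_dev_const_def add_divide_distrib ennreal_plus[symmetric] ennreal_mult[symmetric] del: ennreal_plus)
  qed
  finally show ?thesis .
qed

end

section \<open>The leading term of the eigenfunction expansion\<close>

text \<open>Growing squares are cofinal among the finite sets of pairs.\<close>

lemma square_partial_sums_tendsto_infsum:
  fixes f :: "nat \<times> nat \<Rightarrow> real"
  assumes "f summable_on UNIV"
  shows "(\<lambda>N. \<Sum>q<N. \<Sum>s<N. f (q, s)) \<longlonglongrightarrow> infsum f UNIV"
proof -
  have "filterlim (\<lambda>N::nat. {..<N} \<times> {..<N}) (finite_subsets_at_top UNIV) sequentially"
    unfolding filterlim_finite_subsets_at_top
  proof (intro allI impI)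
    fix X :: "(nat \<times> nat) set" assume X: "finite X \<and> X \<subseteq> UNIV"
    have "finite (fst ` X \<union> snd ` X)" using X by simp
    then obtain m where m: "\<forall>k\<in>fst ` X \<union> snd ` X. k < m" using finite_nat_set_iff_bounded by blast
    show "\<forall>\<^sub>F N in sequentially. finite ({..<N} \<times> {..<N}) \<and> X \<subseteq> {..<N} \<times> {..<N} \<and> {..<N} \<times> {..<N} \<subseteq> UNIV"
      using eventually_ge_at_top[of m]
    proof eventually_elim
      case (elim N)
      have "x \<in> {..<N} \<times> {..<N}" if "x \<in> X" for x
      proof -
        have "fst x < m" "snd x < m" using m that by auto
        then show ?thesis using elim by (simp add: mem_Times_iff)
      qed
      then show ?case by auto
    qed
  qed
  from filterlim_compose[OF has_sum_infsum[OF assms, unfolded has_sum_def] this]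
  show ?thesis by (simp add: sum.cartesian_product)
qed

locale isolated_eigenvalue = functional_sample_moments +
  fixes r :: nat and g :: real
  assumes gap: "\<And>s. s \<noteq> r \<Longrightarrow> g \<le> \<bar>l r - l s\<bar>" and g_pos: "0 < g" and l_r_pos: "0 < l r"
begin

definition coef :: "real \<Rightarrow> nat \<Rightarrow> real" where
  "coef t s = (if s = r then 0 else e s t / (l r - l s))"

definition \<kappa> :: "nat \<Rightarrow> real" where
  "\<kappa> s = (if s = r then 0 else l s / (l r - l s))"

definition V :: "nat \<Rightarrow> 'a \<Rightarrow> real \<Rightarrow> real" where
  "V i \<omega> t = (\<Sum>s. \<kappa> s * b s i \<omega> * e s t)"

text \<open>
  Since \<open>1 / (l r - l s) = (1 + \<kappa> s) / l r\<close>, this is the sum of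
  \<open>coef t s * b s i \<omega> * b r i \<omega>\<close> over \<open>s\<close>, rearranged such that it is defined for
  every \<open>\<omega>\<close> and \<open>t\<close>: the part with \<open>1\<close> is the residual of the observation, and the series with
  \<open>\<kappa> s\<close> converges absolutely.
\<close>

definition W :: "nat \<Rightarrow> 'a \<Rightarrow> real \<Rightarrow> real" where
  "W i \<omega> t = (b r i \<omega> / l r) * (Y i \<omega> t - b r i \<omega> * e r t + V i \<omega> t)"

lemma gap_nonzero: "s \<noteq> r \<Longrightarrow> l r - l s \<noteq> 0"
  using gap g_pos by fastforce

lemma coef_le: "t \<in> {0..1} \<Longrightarrow> \<bar>coef t s\<bar> \<le> C_e / g"
  using gap[of s] g_pos e_le[of t s] C_e_nonneg by (auto simp: coef_def intro!: frac_le divide_nonneg_pos)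

lemma \<kappa>_le: "\<bar>\<kappa> s\<bar> \<le> l s / g"
  using gap[of s] g_pos l_nonneg[of s] by (auto simp: \<kappa>_def intro!: frac_le)

text \<open>The numerator \<open>l s\<close> is summable and the denominators stay above the gap;
  the reciprocals \<open>1 / (l r - l s)\<close> alone would not decay.\<close>

lemma \<kappa>_summable: "summable (\<lambda>s. \<bar>\<kappa> s\<bar>)"
  by (rule summable_comparison_test'[OF summable_divide[OF l_summable, of g], of 0]) (simp add: \<kappa>_le)

lemma b_abs_le: "1 \<le> i \<Longrightarrow> \<omega> \<in> space M \<Longrightarrow> \<bar>b s i \<omega>\<bar> \<le> sqrt (ip (Y i \<omega>) (Y i \<omega>))"
  by (rule real_le_rsqrt) (simp add: b_square_le)

lemma V_term_le:
  assumes "1 \<le> i" "\<omega> \<in> space M" "t \<in> {0..1}"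
  shows "\<bar>\<kappa> s * b s i \<omega> * e s t\<bar> \<le> \<bar>\<kappa> s\<bar> * (sqrt (ip (Y i \<omega>) (Y i \<omega>)) * C_e)"
  unfolding abs_mult mult.assoc using assms
  by (intro mult_left_mono mult_mono b_abs_le e_le) (auto simp: ip_nonneg)

lemma V_summable:
  assumes "1 \<le> i" "\<omega> \<in> space M" "t \<in> {0..1}"
  shows "summable (\<lambda>s. \<bar>\<kappa> s * b s i \<omega> * e s t\<bar>)"
  by (rule summable_comparison_test'[OF summable_mult2[OF \<kappa>_summable, of "sqrt (ip (Y i \<omega>) (Y i \<omega>)) * C_e"], of 0])
     (use V_term_le[OF assms] in simp)

lemma V_joint: "1 \<le> i \<Longrightarrow> (\<lambda>(\<omega>, t). V i \<omega> t) \<in> borel_measurable (M \<Otimes>\<^sub>M unit_leb)"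
proof -
  assume i: "1 \<le> i"
  note [measurable] = b_measurable[OF i]
  show ?thesis unfolding V_def by measurable
qed

lemma V_L2:
  assumes i: "1 \<le> i" and \<omega>: "\<omega> \<in> space M"
  shows "V i \<omega> \<in> L2"
  unfolding L2_eq_sq_int
proof (rule unit_leb.bounded_sq_int)
  show "V i \<omega> \<in> borel_measurable unit_leb"
    using measurable_Pair2[OF V_joint[OF i] \<omega>] by simp
  fix t assume "t \<in> space unit_leb"
  then have t: "t \<in> {0..1}" by simp
  have "\<bar>V i \<omega> t\<bar> \<le> (\<Sum>s. \<bar>\<kappa> s * b s i \<omega> * e s t\<bar>)"
    unfolding V_def by (rule summable_rabs[OF V_summable[OF i \<omega> t]])
  also have "\<dots> \<le> (\<Sum>s. \<bar>\<kappa> s\<bar> * (sqrt (ip (Y i \<omega>) (Y i \<omega>)) * C_e))"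
    by (intro suminf_le V_term_le i \<omega> t V_summable summable_mult2 \<kappa>_summable)
  finally show "\<bar>V i \<omega> t\<bar> \<le> (\<Sum>s. \<bar>\<kappa> s\<bar> * (sqrt (ip (Y i \<omega>) (Y i \<omega>)) * C_e))" .
qed

text \<open>Termwise integration, justified by the summable majorant
  \<open>\<bar>\<kappa> s\<bar> * B\<close>.\<close>

lemma ip_V:
  assumes i: "1 \<le> i" and \<omega>: "\<omega> \<in> space M"
  shows "ip (V i \<omega>) (e q) = \<kappa> q * b q i \<omega>"
proof -
  define B where "B = sqrt (ip (Y i \<omega>) (Y i \<omega>)) * C_e * C_e"
  define f where "f s t = \<kappa> s * b s i \<omega> * e s t * e q t" for s t
  have f_le: "\<bar>f s t\<bar> \<le> \<bar>\<kappa> s\<bar> * B" if t: "t \<in> {0..1}" for s t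
  proof -
    have "\<bar>f s t\<bar> \<le> (\<bar>\<kappa> s\<bar> * (sqrt (ip (Y i \<omega>) (Y i \<omega>)) * C_e)) * C_e"
      unfolding f_def abs_mult[of _ "e q t"]
      by (intro mult_mono V_term_le i \<omega> t e_le) (auto simp: ip_nonneg C_e_nonneg)
    then show ?thesis by (simp add: B_def mult.assoc)
  qed
  have f_int: "integrable unit_leb (f s)" for s
    unfolding f_def mult.assoc using L2_integrable_mult[OF basis.basis_L2 basis.basis_L2, of s q] by simp
  have "(\<lambda>s. integral\<^sup>L unit_leb (f s)) sums (\<integral>t. (\<Sum>s. f s t) \<partial>unit_leb)"
  proof (rule sums_integral[OF f_int])
    have s: "summable (\<lambda>s. \<bar>\<kappa> s\<bar> * B)" by (intro summable_mult2 \<kappa>_summable)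
    show "AE t in unit_leb. summable (\<lambda>s. norm (f s t))"
      by (intro AE_I2 summable_comparison_test'[OF s, of 0]) (simp add: f_le)
    show "summable (\<lambda>s. \<integral>t. norm (f s t) \<partial>unit_leb)"
    proof (rule summable_comparison_test'[OF s, of 0])
      fix s
      have "(\<integral>t. norm (f s t) \<partial>unit_leb) \<le> (\<integral>t. \<bar>\<kappa> s\<bar> * B \<partial>unit_leb)"
        using f_int f_le by (intro integral_mono) auto
      then show "norm (\<integral>t. norm (f s t) \<partial>unit_leb) \<le> \<bar>\<kappa> s\<bar> * B"
        using unit_leb.prob_space by simp
    qed
  qed
  moreover have "(\<integral>t. (\<Sum>s. f s t) \<partial>unit_leb) = ip (V i \<omega>) (e q)"
    unfolding ip_def V_def f_def using summable_rabs_cancel[OF V_summable[OF i \<omega>]]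
    by (intro Bochner_Integration.integral_cong refl suminf_mult2[symmetric]) simp
  moreover have "integral\<^sup>L unit_leb (f s) = (if s = q then \<kappa> q * b q i \<omega> else 0)" for s
  proof -
    have "integral\<^sup>L unit_leb (f s) = \<kappa> s * b s i \<omega> * ip (e s) (e q)"
      unfolding f_def ip_def by (simp add: mult.assoc)
    then show ?thesis by (simp add: basis.orthonormal)
  qed
  ultimately have "(\<lambda>s. if s = q then \<kappa> q * b q i \<omega> else 0) sums ip (V i \<omega>) (e q)" by simp
  then show ?thesis using sums_single[of q "\<lambda>_. \<kappa> q * b q i \<omega>"] sums_unique2 by blast
qed

lemma W_joint: "1 \<le> i \<Longrightarrow> (\<lambda>(\<omega>, t). W i \<omega> t) \<in> borel_measurable (M \<Otimes>\<^sub>M unit_leb)"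
proof -
  assume i: "1 \<le> i"
  note [measurable] = b_measurable[OF i] V_joint[OF i] Y_joint[OF i]
  show ?thesis unfolding W_def by measurable
qed

lemma W_L2: "1 \<le> i \<Longrightarrow> \<omega> \<in> space M \<Longrightarrow> W i \<omega> \<in> L2"
  unfolding W_def by (intro L2_cmult L2_add L2_diff Y_L2 V_L2 basis.basis_L2)

text \<open>Confirms that \<open>W i\<close> is the intended summand: for every sample point its
  basis coefficients are exactly those of the first order term.\<close>

lemma ip_W:
  assumes i: "1 \<le> i" and \<omega>: "\<omega> \<in> space M"
  shows "ip (W i \<omega>) (e s) = (if s = r then 0 else b s i \<omega> * b r i \<omega> / (l r - l s))"
proof -
  have "ip (W i \<omega>) (e s) = (b r i \<omega> / l r) * (b s i \<omega> - b r i \<omega> * ip (e r) (e s) + \<kappa> s * b s i \<omega>)"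
    unfolding W_def using i \<omega>
    by (simp only: ip_cmult_left ip_add_left ip_diff_left L2_diff L2_cmult Y_L2 V_L2 basis.basis_L2 ip_V b_def)
  also have "\<dots> = (if s = r then 0 else b s i \<omega> * b r i \<omega> / (l r - l s))"
  proof (cases "s = r")
    case False
    have "b s i \<omega> + \<kappa> s * b s i \<omega> = l r * b s i \<omega> / (l r - l s)"
      using gap_nonzero[OF False] False by (simp add: \<kappa>_def field_simps)
    then show ?thesis using False l_r_pos by (simp add: basis.orthonormal)
  qed (simp add: basis.orthonormal \<kappa>_def)
  finally show ?thesis .
qed

lemma W_measurable: "1 \<le> i \<Longrightarrow> t \<in> {0..1} \<Longrightarrow> (\<lambda>\<omega>. W i \<omega> t) \<in> borel_measurable M"
  using measurable_Pair1[OF W_joint, of i t] by simp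

section \<open>Mean square convergence of the series for the leading term\<close>

definition W_partial :: "nat \<Rightarrow> nat \<Rightarrow> 'a \<Rightarrow> real \<Rightarrow> real" where
  "W_partial N i \<omega> t = (\<Sum>s<N. coef t s * (b r i \<omega> * b s i \<omega>))"

lemma W_partial_sq_int: "1 \<le> i \<Longrightarrow> (\<lambda>\<omega>. W_partial N i \<omega> t) \<in> sq_int M"
  unfolding W_partial_def by (intro sq_int_sum sq_int_cmult b_mult_sq_int)

lemma expectation_lincomb_square:
  assumes i: "1 \<le> i"
  shows "expectation (\<lambda>\<omega>. (\<Sum>s\<in>I. c s * (b r i \<omega> * b s i \<omega>))\<^sup>2)
    = (\<Sum>q\<in>I. \<Sum>s\<in>I. c q * c s * expectation (\<lambda>\<omega>. (b r i \<omega>)\<^sup>2 * b q i \<omega> * b s i \<omega>))"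
proof -
  have int: "integrable M (\<lambda>\<omega>. (b r i \<omega>)\<^sup>2 * b q i \<omega> * b s i \<omega>)" for q s
    using sq_int_integrable_mult[OF b_mult_sq_int[OF i, of r q] b_mult_sq_int[OF i, of r s]]
    by (simp add: power2_eq_square mult_ac)
  have "expectation (\<lambda>\<omega>. (\<Sum>s\<in>I. c s * (b r i \<omega> * b s i \<omega>))\<^sup>2)
      = expectation (\<lambda>\<omega>. \<Sum>q\<in>I. \<Sum>s\<in>I. c q * c s * ((b r i \<omega>)\<^sup>2 * b q i \<omega> * b s i \<omega>))"
    by (simp add: power2_eq_square sum_product mult_ac)
  also have "\<dots> = (\<Sum>q\<in>I. expectation (\<lambda>\<omega>. \<Sum>s\<in>I. c q * c s * ((b r i \<omega>)\<^sup>2 * b q i \<omega> * b s i \<omega>)))"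
    by (rule Bochner_Integration.integral_sum) (intro Bochner_Integration.integrable_sum integrable_mult_right int)
  also have "\<dots> = (\<Sum>q\<in>I. \<Sum>s\<in>I. expectation (\<lambda>\<omega>. c q * c s * ((b r i \<omega>)\<^sup>2 * b q i \<omega> * b s i \<omega>)))"
    by (intro sum.cong refl Bochner_Integration.integral_sum) (intro integrable_mult_right int)
  finally show ?thesis by simp
qed

text \<open>Summable mixed moments make the partial sums Cauchy in mean square, with some limit
  \<open>G\<close>. To identify \<open>G\<close> with \<open>W\<close>, a subsequence is taken along
  which these sums and the Karhunen-Loeve series both converge almost surely; there the algebraic
  identity between partial sums passes to the limit.\<close>

lemma W_partial_mean_square:
  assumes i: "1 \<le> i" and t: "t \<in> {0..1}"
  shows "(\<lambda>\<omega>. W i \<omega> t) \<in> sq_int M"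
    and "(\<lambda>N. expectation (\<lambda>\<omega>. (W_partial N i \<omega> t - W i \<omega> t)\<^sup>2)) \<longlonglongrightarrow> 0"
proof -
  let ?a = "\<lambda>q s. expectation (\<lambda>\<omega>. (b r i \<omega>)\<^sup>2 * b q i \<omega> * b s i \<omega>)"
  define T where "T N = (\<Sum>q<N. \<Sum>s<N. \<bar>?a q s\<bar>)" for N :: nat
  have abs: "(\<lambda>(q, s). \<bar>?a q s\<bar>) summable_on UNIV"
    using summable_on_iff_abs_summable_on_real[THEN iffD1, OF mixed_summable[OF i, of r]] by (simp add: split_beta')
  define Tinf where "Tinf = (\<Sum>\<^sub>\<infinity>(q, s). \<bar>?a q s\<bar>)"
  have T_lim: "T \<longlonglongrightarrow> Tinf"
    unfolding T_def Tinf_def using square_partial_sums_tendsto_infsum[OF abs] by simp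
  have T_le: "T N \<le> Tinf" for N
  proof (rule incseq_le[OF _ T_lim])
    show "incseq T"
      unfolding T_def incseq_def by (auto intro!: sum_mono2 order_trans[OF sum_mono2 sum_mono] sum_nonneg)
  qed
  have cauchy: "expectation (\<lambda>\<omega>. (W_partial n i \<omega> t - W_partial m i \<omega> t)\<^sup>2) \<le> (C_e / g)\<^sup>2 * (Tinf - T m)" if mn: "m \<le> n" for m n
  proof -
    have "W_partial n i \<omega> t - W_partial m i \<omega> t = (\<Sum>s\<in>{m..<n}. coef t s * (b r i \<omega> * b s i \<omega>))" for \<omega>
      unfolding W_partial_def using sum_diff_nat_ivl[of 0 m n "\<lambda>s. coef t s * (b r i \<omega> * b s i \<omega>)"] mn
      by (simp add: atLeast0LessThan)
    then have "expectation (\<lambda>\<omega>. (W_partial n i \<omega> t - W_partial m i \<omega> t)\<^sup>2)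
        = (\<Sum>q\<in>{m..<n}. \<Sum>s\<in>{m..<n}. coef t q * coef t s * ?a q s)"
      by (simp add: expectation_lincomb_square[OF i])
    also have "\<dots> \<le> (\<Sum>q\<in>{m..<n}. \<Sum>s\<in>{m..<n}. (C_e / g)\<^sup>2 * \<bar>?a q s\<bar>)"
    proof (intro sum_mono)
      fix q s
      have "coef t q * coef t s * ?a q s \<le> \<bar>coef t q\<bar> * \<bar>coef t s\<bar> * \<bar>?a q s\<bar>"
        by (simp flip: abs_mult)
      also have "\<dots> \<le> (C_e / g) * (C_e / g) * \<bar>?a q s\<bar>"
        using coef_le[OF t] C_e_nonneg g_pos by (intro mult_right_mono mult_mono) auto
      finally show "coef t q * coef t s * ?a q s \<le> (C_e / g)\<^sup>2 * \<bar>?a q s\<bar>" by (simp add: power2_eq_square)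
    qed
    also have "\<dots> = (C_e / g)\<^sup>2 * (\<Sum>x\<in>{m..<n} \<times> {m..<n}. \<bar>?a (fst x) (snd x)\<bar>)"
      by (simp add: sum_distrib_left sum.cartesian_product split_beta')
    also have "\<dots> \<le> (C_e / g)\<^sup>2 * (Tinf - T m)"
    proof (intro mult_left_mono)
      \<comment> \<open>The block of pairs with both indices from \<open>m\<close> on lies outside
        the square of side \<open>m\<close>, so the tail of the square sums controls it.\<close>
      have "(\<Sum>x\<in>{m..<n} \<times> {m..<n}. \<bar>?a (fst x) (snd x)\<bar>)
          \<le> (\<Sum>x\<in>{..<n} \<times> {..<n} - {..<m} \<times> {..<m}. \<bar>?a (fst x) (snd x)\<bar>)"
        by (intro sum_mono2) auto
      also have "\<dots> = (\<Sum>x\<in>{..<n} \<times> {..<n}. \<bar>?a (fst x) (snd x)\<bar>) - (\<Sum>x\<in>{..<m} \<times> {..<m}. \<bar>?a (fst x) (snd x)\<bar>)"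
        using mn by (intro sum_diff) auto
      also have "\<dots> = T n - T m"
        unfolding T_def by (simp add: sum.cartesian_product split_beta')
      also have "\<dots> \<le> Tinf - T m" using T_le by simp
      finally show "(\<Sum>x\<in>{m..<n} \<times> {m..<n}. \<bar>?a (fst x) (snd x)\<bar>) \<le> Tinf - T m" .
    qed simp
    finally show ?thesis .
  qed
  have "(\<lambda>m. (C_e / g)\<^sup>2 * (Tinf - T m)) \<longlonglongrightarrow> (C_e / g)\<^sup>2 * (Tinf - Tinf)"
    by (intro tendsto_intros T_lim)
  then have lim0: "(\<lambda>m. (C_e / g)\<^sup>2 * (Tinf - T m)) \<longlonglongrightarrow> 0" by simp
  obtain G where G: "G \<in> sq_int M" and G_lim: "(\<lambda>N. expectation (\<lambda>\<omega>. (W_partial N i \<omega> t - G \<omega>)\<^sup>2)) \<longlonglongrightarrow> 0"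
    using Riesz_Fischer[of "\<lambda>N \<omega>. W_partial N i \<omega> t", OF W_partial_sq_int[OF i] cauchy lim0] by blast
  obtain \<rho> :: "nat \<Rightarrow> nat" where \<rho>: "strict_mono \<rho>" and ae1: "AE \<omega> in M. (\<lambda>k. W_partial (\<rho> k) i \<omega> t) \<longlonglongrightarrow> G \<omega>"
    using sq_int_conv_AE_subseq[of "\<lambda>N \<omega>. W_partial N i \<omega> t", OF W_partial_sq_int[OF i] G G_lim] by blast
  have Yp: "(\<lambda>\<omega>. \<Sum>s<N. b s i \<omega> * e s t) \<in> sq_int M" for N
    using sq_int_sum[of "{..<N}" "\<lambda>s \<omega>. e s t * b s i \<omega>" M] sq_int_cmult[OF b_sq_int[OF i]] by (simp add: mult.commute)
  have "(\<lambda>k. expectation (\<lambda>\<omega>. ((\<Sum>s<\<rho> k. b s i \<omega> * e s t) - Y i \<omega> t)\<^sup>2)) \<longlonglongrightarrow> 0"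
    using LIMSEQ_subseq_LIMSEQ[OF karhunen_loeve[OF i t] \<rho>] by (simp add: comp_def)
  then obtain \<rho>' :: "nat \<Rightarrow> nat" where \<rho>': "strict_mono \<rho>'"
    and ae2: "AE \<omega> in M. (\<lambda>k. \<Sum>s<\<rho> (\<rho>' k). b s i \<omega> * e s t) \<longlonglongrightarrow> Y i \<omega> t"
    using sq_int_conv_AE_subseq[of "\<lambda>k \<omega>. \<Sum>s<\<rho> k. b s i \<omega> * e s t", OF Yp Y_sq_int[OF i t]] by blast
  define \<theta> where "\<theta> k = \<rho> (\<rho>' k)" for k
  have \<theta>: "strict_mono \<theta>" using \<rho> \<rho>' by (simp add: \<theta>_def strict_mono_def)
  have "AE \<omega> in M. W i \<omega> t = G \<omega>"
    using ae1 ae2 AE_space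
  proof eventually_elim
    case (elim \<omega>)
    have 1: "(\<lambda>k. W_partial (\<theta> k) i \<omega> t) \<longlonglongrightarrow> G \<omega>"
      using LIMSEQ_subseq_LIMSEQ[OF elim(1) \<rho>'] by (simp add: \<theta>_def comp_def)
    have 2: "(\<lambda>k. \<Sum>s<\<theta> k. \<kappa> s * b s i \<omega> * e s t) \<longlonglongrightarrow> V i \<omega> t"
      using LIMSEQ_subseq_LIMSEQ[OF summable_LIMSEQ[OF summable_rabs_cancel[OF V_summable[OF i elim(3) t]]] \<theta>]
      by (simp add: V_def comp_def)
    \<comment> \<open>\<open>r < N\<close> ensures that the partial sum contains the term at
      \<open>r\<close>, the one that is subtracted.\<close>
    have eq: "W_partial N i \<omega> t
        = (b r i \<omega> / l r) * ((\<Sum>s<N. b s i \<omega> * e s t) - b r i \<omega> * e r t + (\<Sum>s<N. \<kappa> s * b s i \<omega> * e s t))"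
      if N: "r < N" for N
    proof -
      have "(\<Sum>s<N. b s i \<omega> * e s t) - b r i \<omega> * e r t = (\<Sum>s<N. if s = r then 0 else b s i \<omega> * e s t)"
        using N by (subst sum.remove[of _ r], simp, simp, subst (2) sum.remove[of _ r]) auto
      then have "(b r i \<omega> / l r) * ((\<Sum>s<N. b s i \<omega> * e s t) - b r i \<omega> * e r t + (\<Sum>s<N. \<kappa> s * b s i \<omega> * e s t))
          = (\<Sum>s<N. (b r i \<omega> / l r) * ((if s = r then 0 else b s i \<omega> * e s t) + \<kappa> s * b s i \<omega> * e s t))"
        by (simp only: sum.distrib[symmetric] sum_distrib_left)
      also have "\<dots> = (\<Sum>s<N. coef t s * (b r i \<omega> * b s i \<omega>))"
      proof (intro sum.cong refl)
        fix s
        show "(b r i \<omega> / l r) * ((if s = r then 0 else b s i \<omega> * e s t) + \<kappa> s * b s i \<omega> * e s t) = coef t s * (b r i \<omega> * b s i \<omega>)"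
          using gap_nonzero[of s] l_r_pos by (cases "s = r") (auto simp: coef_def \<kappa>_def divide_simps, auto simp: algebra_simps)
      qed
      finally show ?thesis by (simp add: W_partial_def)
    qed
    have "(\<lambda>k. (b r i \<omega> / l r) * ((\<Sum>s<\<theta> k. b s i \<omega> * e s t) - b r i \<omega> * e r t + (\<Sum>s<\<theta> k. \<kappa> s * b s i \<omega> * e s t))) \<longlonglongrightarrow> W i \<omega> t"
      unfolding W_def using elim(2) 2 by (intro tendsto_intros) (simp_all add: \<theta>_def)
    moreover have "\<forall>\<^sub>F k in sequentially. (b r i \<omega> / l r) * ((\<Sum>s<\<theta> k. b s i \<omega> * e s t) - b r i \<omega> * e r t + (\<Sum>s<\<theta> k. \<kappa> s * b s i \<omega> * e s t))
        = W_partial (\<theta> k) i \<omega> t"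
      using eventually_gt_at_top[of r]
    proof eventually_elim
      case (elim k)
      then have "r < \<theta> k" using seq_suble[OF \<theta>, of k] by simp
      then show ?case using eq by simp
    qed
    ultimately have "(\<lambda>k. W_partial (\<theta> k) i \<omega> t) \<longlonglongrightarrow> W i \<omega> t"
      by (rule Lim_transform_eventually)
    then show ?case using 1 LIMSEQ_unique by blast
  qed
  note WG = this
  note [measurable] = W_measurable[OF i t] sq_int_measurable[OF G] sq_int_measurable[OF W_partial_sq_int[OF i]]
  have "integrable M (\<lambda>\<omega>. (W i \<omega> t)\<^sup>2) \<longleftrightarrow> integrable M (\<lambda>\<omega>. (G \<omega>)\<^sup>2)"
    using WG by (intro integrable_cong_AE) (auto elim!: eventually_mono)
  then show "(\<lambda>\<omega>. W i \<omega> t) \<in> sq_int M"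
    using sq_int_integrable[OF G] by (intro sq_intI) auto
  have "expectation (\<lambda>\<omega>. (W_partial N i \<omega> t - W i \<omega> t)\<^sup>2) = expectation (\<lambda>\<omega>. (W_partial N i \<omega> t - G \<omega>)\<^sup>2)" for N
    using WG by (intro integral_cong_AE) (auto elim!: eventually_mono)
  then show "(\<lambda>N. expectation (\<lambda>\<omega>. (W_partial N i \<omega> t - W i \<omega> t)\<^sup>2)) \<longlonglongrightarrow> 0"
    using G_lim by simp
qed

lemma coef_mixed_summable:
  assumes t: "t \<in> {0..1}"
  shows "(\<lambda>(q, s). coef t q * coef t s * expectation (\<lambda>\<omega>. (b r 1 \<omega>)\<^sup>2 * b q 1 \<omega> * b s 1 \<omega>)) summable_on UNIV"
proof -
  let ?a = "\<lambda>q s. expectation (\<lambda>\<omega>. (b r 1 \<omega>)\<^sup>2 * b q 1 \<omega> * b s 1 \<omega>)"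
  have "(\<lambda>(q, s). \<bar>?a q s\<bar>) summable_on UNIV"
    using summable_on_iff_abs_summable_on_real[THEN iffD1, OF mixed_summable[OF order_refl, of r]] by (simp add: split_beta')
  then have "(\<lambda>x. (C_e / g)\<^sup>2 * (case x of (q, s) \<Rightarrow> \<bar>?a q s\<bar>)) summable_on UNIV"
    by (rule summable_on_cmult_right)
  then have "(\<lambda>x. norm (case x of (q, s) \<Rightarrow> coef t q * coef t s * ?a q s)) summable_on UNIV"
  proof (rule summable_on_comparison_test)
    fix x :: "nat \<times> nat"
    obtain q s where x: "x = (q, s)" by (cases x)
    have "\<bar>coef t q\<bar> * \<bar>coef t s\<bar> * \<bar>?a q s\<bar> \<le> (C_e / g) * (C_e / g) * \<bar>?a q s\<bar>"
      using coef_le[OF t] C_e_nonneg g_pos by (intro mult_right_mono mult_mono) auto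
    then show "norm (case x of (q, s) \<Rightarrow> coef t q * coef t s * ?a q s) \<le> (C_e / g)\<^sup>2 * (case x of (q, s) \<Rightarrow> \<bar>?a q s\<bar>)"
      by (simp add: x abs_mult power2_eq_square)
  qed auto
  then show ?thesis by (rule summable_on_iff_abs_summable_on_real[THEN iffD2])
qed

text \<open>Index \<open>r\<close> carries coefficient 0, and scores with different indices are
  uncorrelated.\<close>

lemma W_expectation:
  assumes t: "t \<in> {0..1}"
  shows "expectation (\<lambda>\<omega>. W 1 \<omega> t) = 0"
proof -
  have one: "(\<lambda>_. 1) \<in> sq_int M" by (simp add: sq_int_def)
  have "(\<lambda>N. expectation (\<lambda>\<omega>. W_partial N 1 \<omega> t * 1)) \<longlonglongrightarrow> expectation (\<lambda>\<omega>. W 1 \<omega> t * 1)"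
    using t by (intro sq_int_conv_mult W_partial_sq_int W_partial_mean_square one) auto
  moreover have "expectation (\<lambda>\<omega>. W_partial N 1 \<omega> t * 1) = 0" for N
  proof -
    have "expectation (\<lambda>\<omega>. W_partial N 1 \<omega> t * 1) = (\<Sum>s<N. coef t s * expectation (\<lambda>\<omega>. b r 1 \<omega> * b s 1 \<omega>))"
      unfolding W_partial_def using sq_int_imp_integrable[OF b_mult_sq_int[of 1]] by simp
    also have "\<dots> = 0" by (intro sum.neutral) (auto simp: b_covariance coef_def)
    finally show ?thesis .
  qed
  ultimately show ?thesis using LIMSEQ_unique[OF _ tendsto_const[of "0::real"]] by auto
qed

text \<open>Both sides are limits of the second moments of the partial sums: one by continuity of
  the norm, the other by exhausting the pairs with squares.\<close>

lemma W_second_moment: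
  assumes t: "t \<in> {0..1}"
  shows "expectation (\<lambda>\<omega>. (W 1 \<omega> t)\<^sup>2)
    = (\<Sum>\<^sub>\<infinity>(q, s). coef t q * coef t s * expectation (\<lambda>\<omega>. (b r 1 \<omega>)\<^sup>2 * b q 1 \<omega> * b s 1 \<omega>))"
proof (rule LIMSEQ_unique)
  show "(\<lambda>N. expectation (\<lambda>\<omega>. (W_partial N 1 \<omega> t)\<^sup>2)) \<longlonglongrightarrow> expectation (\<lambda>\<omega>. (W 1 \<omega> t)\<^sup>2)"
    using t by (intro sq_int_conv_square W_partial_sq_int W_partial_mean_square) auto
  show "(\<lambda>N. expectation (\<lambda>\<omega>. (W_partial N 1 \<omega> t)\<^sup>2))
    \<longlonglongrightarrow> (\<Sum>\<^sub>\<infinity>(q, s). coef t q * coef t s * expectation (\<lambda>\<omega>. (b r 1 \<omega>)\<^sup>2 * b q 1 \<omega> * b s 1 \<omega>))"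
    unfolding W_partial_def expectation_lincomb_square[OF order_refl]
    using square_partial_sums_tendsto_infsum[OF coef_mixed_summable[OF t]] by simp
qed

text \<open>The explicit form of \<open>W\<close> depends on one value of the path and on countably
  many scores, hence is almost surely a measurable functional of the path.\<close>

lemma iid_functional_W:
  assumes t: "t \<in> {0..1}"
  shows "iid_functional M path_space path (\<lambda>i \<omega>. W i \<omega> t)
    (\<lambda>x. (score_fun r x / l r) * (x t - \<mu> t - score_fun r x * e r t + (\<Sum>s. \<kappa> s * score_fun s x * e s t)))"
proof (rule iid_functionalI)
  note score_fun_measurable[measurable]
  have [measurable]: "(\<lambda>x. x t) \<in> borel_measurable path_space"
    by (rule measurable_component_singleton[OF t])
  show "(\<lambda>x. (score_fun r x / l r) * (x t - \<mu> t - score_fun r x * e r t + (\<Sum>s. \<kappa> s * score_fun s x * e s t)))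
      \<in> borel_measurable path_space"
    by measurable
  show "W i \<omega> t = (score_fun r (path i \<omega>) / l r) * (path i \<omega> t - \<mu> t - score_fun r (path i \<omega>) * e r t
      + (\<Sum>s. \<kappa> s * score_fun s (path i \<omega>) * e s t))"
    if "\<forall>s. b s i \<omega> = score_fun s (path i \<omega>)" for i \<omega>
    using that t by (simp add: W_def V_def Y_def path_def)
  show "integrable M (\<lambda>\<omega>. (W 1 \<omega> t)\<^sup>2)" by (rule sq_int_integrable[OF W_partial_mean_square(1)[OF order_refl t]])
  show "expectation (\<lambda>\<omega>. W 1 \<omega> t) = 0" by (rule W_expectation[OF t])
qed (use t in \<open>simp_all add: W_measurable\<close>)

end

section \<open>Mean square convergence and stochastic boundedness\<close>

lemma ms_convI_sq_int:
  assumes "\<And>N. Z N \<in> sq_int M" "Y \<in> sq_int M" "(\<lambda>N. \<integral>\<omega>. (Z N \<omega> - Y \<omega>)\<^sup>2 \<partial>M) \<longlonglongrightarrow> 0"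
  shows "ms_conv M Z Y"
  unfolding ms_conv_def
  using assms sq_int_integrable[OF sq_int_diff[OF assms(1,2)]] by (auto intro: sq_int_measurable)

lemma sq_int_conv_sum:
  assumes "finite I" and f: "\<And>i N. i \<in> I \<Longrightarrow> f i N \<in> sq_int M" and h: "\<And>i. i \<in> I \<Longrightarrow> h i \<in> sq_int M"
    and lim: "\<And>i. i \<in> I \<Longrightarrow> (\<lambda>N. \<integral>\<omega>. (f i N \<omega> - h i \<omega>)\<^sup>2 \<partial>M) \<longlonglongrightarrow> 0"
  shows "(\<lambda>N. \<integral>\<omega>. ((\<Sum>i\<in>I. f i N \<omega>) - (\<Sum>i\<in>I. h i \<omega>))\<^sup>2 \<partial>M) \<longlonglongrightarrow> 0"
  using assms
proof (induction I rule: finite_induct)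
  case (insert i I)
  define F where "F N \<omega> = (\<Sum>i\<in>I. f i N \<omega>) - (\<Sum>i\<in>I. h i \<omega>)" for N \<omega>
  define G where "G N \<omega> = f i N \<omega> - h i \<omega>" for N \<omega>
  have F: "F N \<in> sq_int M" and G: "G N \<in> sq_int M" for N
    unfolding F_def G_def using insert.prems by (auto intro!: sq_int_diff sq_int_sum)
  have "(\<lambda>N. 2 * (\<integral>\<omega>. (G N \<omega>)\<^sup>2 \<partial>M) + 2 * (\<integral>\<omega>. (F N \<omega>)\<^sup>2 \<partial>M)) \<longlonglongrightarrow> 2 * 0 + 2 * 0"
    unfolding F_def G_def using insert.prems insert.IH by (intro tendsto_intros) auto
  then have lim0: "(\<lambda>N. 2 * (\<integral>\<omega>. (G N \<omega>)\<^sup>2 \<partial>M) + 2 * (\<integral>\<omega>. (F N \<omega>)\<^sup>2 \<partial>M)) \<longlonglongrightarrow> 0" by simp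
  have le: "(\<integral>\<omega>. (G N \<omega> + F N \<omega>)\<^sup>2 \<partial>M) \<le> 2 * (\<integral>\<omega>. (G N \<omega>)\<^sup>2 \<partial>M) + 2 * (\<integral>\<omega>. (F N \<omega>)\<^sup>2 \<partial>M)" for N
  proof -
    have "(\<integral>\<omega>. (G N \<omega> + F N \<omega>)\<^sup>2 \<partial>M) \<le> (\<integral>\<omega>. 2 * (G N \<omega>)\<^sup>2 + 2 * (F N \<omega>)\<^sup>2 \<partial>M)"
      using sq_int_integrable[OF F] sq_int_integrable[OF G] sq_int_integrable[OF sq_int_add[OF G F]]
      by (intro integral_mono power2_add_le) auto
    then show ?thesis using sq_int_integrable[OF F] sq_int_integrable[OF G] by simp
  qed
  have "(\<lambda>N. \<integral>\<omega>. (G N \<omega> + F N \<omega>)\<^sup>2 \<partial>M) \<longlonglongrightarrow> 0"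
    by (rule tendsto_sandwich[OF _ _ tendsto_const lim0]) (auto intro!: always_eventually le)
  then show ?case using insert.hyps by (simp add: F_def G_def algebra_simps)
qed simp

lemma ms_conv_lincomb:
  assumes I: "finite I" and f: "\<And>i N. i \<in> I \<Longrightarrow> f i N \<in> sq_int M" and h: "\<And>i. i \<in> I \<Longrightarrow> h i \<in> sq_int M"
    and lim: "\<And>i. i \<in> I \<Longrightarrow> (\<lambda>N. \<integral>\<omega>. (f i N \<omega> - h i \<omega>)\<^sup>2 \<partial>M) \<longlonglongrightarrow> 0"
  shows "ms_conv M (\<lambda>N \<omega>. c * (\<Sum>i\<in>I. f i N \<omega>)) (\<lambda>\<omega>. c * (\<Sum>i\<in>I. h i \<omega>))"
proof (rule ms_convI_sq_int)
  have "(\<lambda>N. c\<^sup>2 * (\<integral>\<omega>. ((\<Sum>i\<in>I. f i N \<omega>) - (\<Sum>i\<in>I. h i \<omega>))\<^sup>2 \<partial>M)) \<longlonglongrightarrow> c\<^sup>2 * 0"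
    by (intro tendsto_mult tendsto_const sq_int_conv_sum I f h lim)
  then show "(\<lambda>N. \<integral>\<omega>. (c * (\<Sum>i\<in>I. f i N \<omega>) - c * (\<Sum>i\<in>I. h i \<omega>))\<^sup>2 \<partial>M) \<longlonglongrightarrow> 0"
    by (simp only: right_diff_distrib[symmetric] power_mult_distrib integral_mult_right_zero mult_zero_right)
qed (use f h in \<open>auto intro!: sq_int_cmult sq_int_sum\<close>)

lemma big_Op_cong:
  assumes Y: "big_Op M Y a" and eq: "\<And>n \<omega>. 1 \<le> n \<Longrightarrow> Y n \<omega> = Z n \<omega>" "\<And>n. a n = a' n"
  shows "big_Op M Z a'"
  unfolding big_Op_def
proof (intro conjI allI impI)
  fix n :: nat assume n: "1 \<le> n"
  have "Z n = Y n" using eq(1)[OF n] by auto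
  then show "Z n \<in> borel_measurable M" using Y n by (simp add: big_Op_def)
next
  fix \<epsilon> :: real assume "0 < \<epsilon>"
  then obtain C where C: "0 < C" "\<forall>\<^sub>F n in sequentially. measure M {\<omega>\<in>space M. \<bar>Y n \<omega>\<bar> > C * a n} \<le> \<epsilon>"
    using Y unfolding big_Op_def by blast
  from C(2) have "\<forall>\<^sub>F n in sequentially. measure M {\<omega>\<in>space M. \<bar>Z n \<omega>\<bar> > C * a' n} \<le> \<epsilon>"
    using eventually_ge_at_top[of 1] by eventually_elim (simp only: eq)
  then show "\<exists>C>0. \<forall>\<^sub>F n in sequentially. measure M {\<omega>\<in>space M. \<bar>Z n \<omega>\<bar> > C * a' n} \<le> \<epsilon>"
    using C(1) by blast
qed

lemma (in prob_space) big_Op_null_imp_tendsto: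
  assumes D: "big_Op M D a" and a: "a \<longlonglongrightarrow> 0" and \<epsilon>: "0 < \<epsilon>"
  shows "(\<lambda>n. prob {\<omega>\<in>space M. \<epsilon> < \<bar>D n \<omega>\<bar>}) \<longlonglongrightarrow> 0"
proof (rule LIMSEQ_I)
  fix \<eta> :: real assume \<eta>: "0 < \<eta>"
  have D_meas: "D n \<in> borel_measurable M" if "1 \<le> n" for n using D that by (simp add: big_Op_def)
  from D \<eta> obtain C where C: "0 < C"
    and ev: "\<forall>\<^sub>F n in sequentially. prob {\<omega>\<in>space M. \<bar>D n \<omega>\<bar> > C * a n} \<le> \<eta> / 2"
    unfolding big_Op_def by (meson half_gt_zero)
  have "(\<lambda>n. C * a n) \<longlonglongrightarrow> C * 0" by (intro tendsto_mult tendsto_const a)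
  then have "\<forall>\<^sub>F n in sequentially. C * a n < \<epsilon>" using \<epsilon> by (auto intro: order_tendstoD)
  with ev have "\<forall>\<^sub>F n in sequentially. prob {\<omega>\<in>space M. \<epsilon> < \<bar>D n \<omega>\<bar>} < \<eta>"
    using eventually_ge_at_top[of 1]
  proof eventually_elim
    case (elim n)
    note [measurable] = D_meas[OF elim(3)]
    have "prob {\<omega>\<in>space M. \<epsilon> < \<bar>D n \<omega>\<bar>} \<le> prob {\<omega>\<in>space M. \<bar>D n \<omega>\<bar> > C * a n}"
      using elim by (intro finite_measure_mono) auto
    then show ?case using elim \<eta> by simp
  qed
  then show "\<exists>N. \<forall>n\<ge>N. norm (prob {\<omega>\<in>space M. \<epsilon> < \<bar>D n \<omega>\<bar>} - 0) < \<eta>"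
    by (auto simp: eventually_sequentially)
qed

section \<open>The empirical mean, and orders in probability obtained from the total
  deviation\<close>

context functional_sample_moments
begin

lemma emp_mean_eq: "1 \<le> n \<Longrightarrow> emp_mean X n \<omega> t = \<mu> t + (1 / real n) * (\<Sum>i=1..n. Y i \<omega> t)"
  by (simp add: emp_mean_def Y_def sum_subtractf field_simps)

lemma emp_cov_eq:
  assumes n: "1 \<le> n"
  shows "emp_cov X n \<omega> t s = (1 / real n) * (\<Sum>i=1..n. (Y i \<omega> t - (1 / real n) * (\<Sum>j=1..n. Y j \<omega> t)) *
    (Y i \<omega> s - (1 / real n) * (\<Sum>j=1..n. Y j \<omega> s)))"
  unfolding emp_cov_def emp_mean_eq[OF n] by (simp add: Y_def diff_diff_eq)

lemma scaled_mean_eq: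
  assumes n: "1 \<le> n"
  shows "sqrt (real n) * (emp_mean X n \<omega> t - \<mu> t) = (1 / sqrt (real n)) * (\<Sum>i=1..n. Y i \<omega> t)"
proof -
  have "sqrt (real n) * (1 / real n) = 1 / sqrt (real n)"
    using n by (simp add: real_div_sqrt field_simps)
  then show ?thesis
    unfolding emp_mean_eq[OF n] by (simp only: add_diff_cancel_left' mult.assoc[symmetric])
qed

lemma Y_partial_sq_int: "1 \<le> i \<Longrightarrow> (\<lambda>\<omega>. \<Sum>s<N. b s i \<omega> * e s t) \<in> sq_int M"
  using sq_int_sum[of "{..<N}" "\<lambda>s \<omega>. e s t * b s i \<omega>" M] sq_int_cmult[OF b_sq_int] by (simp add: mult.commute)

lemma mean_expansion:
  assumes n: "1 \<le> n" and t: "t \<in> {0..1}"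
  shows "ms_conv M (\<lambda>N \<omega>. \<Sum>s<N. ((1 / sqrt (real n)) * (\<Sum>i=1..n. b s i \<omega>)) * e s t)
    (\<lambda>\<omega>. sqrt (real n) * (emp_mean X n \<omega> t - \<mu> t))"
proof -
  have "ms_conv M (\<lambda>N \<omega>. (1 / sqrt (real n)) * (\<Sum>i=1..n. \<Sum>s<N. b s i \<omega> * e s t)) (\<lambda>\<omega>. (1 / sqrt (real n)) * (\<Sum>i=1..n. Y i \<omega> t))"
    by (intro ms_conv_lincomb Y_partial_sq_int Y_sq_int karhunen_loeve t) auto
  moreover have "(1 / sqrt (real n)) * (\<Sum>i=1..n. \<Sum>s<N. b s i \<omega> * e s t) = (\<Sum>s<N. ((1 / sqrt (real n)) * (\<Sum>i=1..n. b s i \<omega>)) * e s t)" for N \<omega>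
    by (subst sum.swap) (simp add: sum_distrib_left sum_distrib_right mult.assoc)
  ultimately show ?thesis by (simp only: scaled_mean_eq[OF n])
qed

text \<open>Mercer's identity on the diagonal, obtained by taking second moments in the
  Karhunen-Loeve expansion.\<close>

lemma variance_expansion:
  assumes t: "t \<in> {0..1}"
  shows "(\<lambda>s. l s * (e s t)\<^sup>2) sums \<sigma> t t"
proof -
  have "(\<lambda>N. expectation (\<lambda>\<omega>. (\<Sum>s<N. b s 1 \<omega> * e s t)\<^sup>2)) \<longlonglongrightarrow> expectation (\<lambda>\<omega>. (Y 1 \<omega> t)\<^sup>2)"
    by (rule sq_int_conv_square[OF Y_partial_sq_int[OF order_refl] Y_sq_int[OF order_refl t] karhunen_loeve[OF order_refl t]])
  moreover have "expectation (\<lambda>\<omega>. (\<Sum>s<N. b s 1 \<omega> * e s t)\<^sup>2) = (\<Sum>s<N. l s * (e s t)\<^sup>2)" for N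
  proof -
    have int: "integrable M (\<lambda>\<omega>. b q 1 \<omega> * b s 1 \<omega>)" for q s
      by (intro sq_int_integrable_mult b_sq_int) auto
    have "expectation (\<lambda>\<omega>. (\<Sum>s<N. b s 1 \<omega> * e s t)\<^sup>2)
        = expectation (\<lambda>\<omega>. \<Sum>q<N. \<Sum>s<N. (e q t * e s t) * (b q 1 \<omega> * b s 1 \<omega>))"
      by (simp add: power2_eq_square sum_product mult_ac)
    also have "\<dots> = (\<Sum>q<N. expectation (\<lambda>\<omega>. \<Sum>s<N. (e q t * e s t) * (b q 1 \<omega> * b s 1 \<omega>)))"
      by (rule Bochner_Integration.integral_sum) (intro Bochner_Integration.integrable_sum integrable_mult_right int)
    also have "\<dots> = (\<Sum>q<N. \<Sum>s<N. expectation (\<lambda>\<omega>. (e q t * e s t) * (b q 1 \<omega> * b s 1 \<omega>)))"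
      by (intro sum.cong refl Bochner_Integration.integral_sum) (intro integrable_mult_right int)
    also have "\<dots> = (\<Sum>q<N. \<Sum>s<N. if q = s then l s * (e s t)\<^sup>2 else 0)"
      by (intro sum.cong refl, simp only: integral_mult_right_zero b_covariance[OF order_refl])
         (simp add: power2_eq_square)
    finally show ?thesis by simp
  qed
  ultimately show ?thesis unfolding sums_def by (simp only: Y_second_moment[OF order_refl t])
qed

lemma mean_conv_in_dist:
  assumes t: "t \<in> {0..1}"
  shows "conv_in_dist M (\<lambda>n \<omega>. sqrt (real n) * (emp_mean X n \<omega> t - \<mu> t)) (normal_law 0 (\<sigma> t t))"
proof -
  interpret Z: iid_functional M path_space path "\<lambda>i \<omega>. Y i \<omega> t" "\<lambda>x. x t - \<mu> t" by (rule iid_functional_Y[OF t])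
  have *: "(\<lambda>n \<omega>. sqrt (real n) * (emp_mean X n \<omega> t - \<mu> t)) n = (\<lambda>n \<omega>. (1 / sqrt (real n)) * (\<Sum>i=1..n. Y i \<omega> t)) n" for n
    by (cases "n = 0") (simp_all add: fun_eq_iff scaled_mean_eq)
  show ?thesis
    using Z.scaled_sum_conv_in_dist unfolding Y_second_moment[OF order_refl t] *[THEN ext] .
qed

text \<open>Markov's inequality for \<open>total_dev\<close>. The free factor \<open>c n\<close>
  serves both rates: 1 for the eigenfunction remainder and \<open>sqrt (real n)\<close> for the
  eigenvalue.\<close>

lemma big_Op_of_total_dev_bound:
  assumes D: "\<And>n. 1 \<le> n \<Longrightarrow> D n \<in> borel_measurable M" and t0: "0 < t0" and K: "0 < K"
    and c: "\<And>n. 1 \<le> n \<Longrightarrow> 0 < c n"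
    and le: "\<And>n \<omega>. 1 \<le> n \<Longrightarrow> \<omega> \<in> space M \<Longrightarrow> total_dev n \<omega> \<le> ennreal t0 \<Longrightarrow>
      \<bar>D n \<omega>\<bar> \<le> K * enn2real (total_dev n \<omega>)"
  shows "big_Op M (\<lambda>n \<omega>. c n * D n \<omega>) (\<lambda>n. c n / real n)"
  unfolding big_Op_def
proof (intro conjI allI impI)
  fix n :: nat assume "1 \<le> n"
  then show "(\<lambda>\<omega>. c n * D n \<omega>) \<in> borel_measurable M" using D by (intro borel_measurable_times) auto
next
  fix \<epsilon> :: real assume \<epsilon>: "0 < \<epsilon>"
  \<comment> \<open>Chosen so that Markov's bound becomes \<epsilon> times
    \<open>total_dev_const / (total_dev_const + 1)\<close>; the 1 keeps \<open>C\<close> positive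
    even if the constant is 0.\<close>
  define C where "C = K * (total_dev_const + 1) / \<epsilon>"
  have C: "0 < C" using K \<epsilon> total_dev_const_nonneg by (simp add: C_def)
  have "(\<lambda>n. C / K * (1 / real n)) \<longlonglongrightarrow> C / K * 0" by (intro tendsto_mult tendsto_const lim_1_over_n)
  then have "\<forall>\<^sub>F n in sequentially. C / K * (1 / real n) < t0" using t0 by (auto intro: order_tendstoD)
  then have "\<forall>\<^sub>F n in sequentially. prob {\<omega>\<in>space M. \<bar>c n * D n \<omega>\<bar> > C * (c n / real n)} \<le> \<epsilon>"
    using eventually_ge_at_top[of 1]
  proof eventually_elim
    case (elim n)
    note n = elim(2)
    \<comment> \<open>The value of \<open>total_dev\<close> at which the deterministic bound reaches
      \<open>C / n\<close>; for large n it lies below the threshold \<open>t0\<close>.\<close>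
    define \<theta> where "\<theta> = C / K * (1 / real n)"
    have \<theta>: "0 < \<theta>" "\<theta> < t0" using C K n elim(1) by (auto simp: \<theta>_def)
    note [measurable] = total_dev_measurable[OF n]
    have sub: "{\<omega>\<in>space M. \<bar>c n * D n \<omega>\<bar> > C * (c n / real n)} \<subseteq> {\<omega>\<in>space M. 1 \<le> ennreal (1 / \<theta>) * total_dev n \<omega>}"
    proof safe
      fix \<omega> assume \<omega>: "\<omega> \<in> space M" and gt: "\<bar>c n * D n \<omega>\<bar> > C * (c n / real n)"
      have "ennreal \<theta> \<le> total_dev n \<omega>"
      proof (rule ccontr)
        assume "\<not> ennreal \<theta> \<le> total_dev n \<omega>"
        then have lt: "total_dev n \<omega> < ennreal \<theta>" by simp
        then have "total_dev n \<omega> \<le> ennreal t0" using \<theta> by (meson ennreal_leI less_imp_le order_trans)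
        from le[OF n \<omega> this] have "\<bar>D n \<omega>\<bar> \<le> K * enn2real (total_dev n \<omega>)" .
        also have "\<dots> \<le> K * \<theta>"
          using lt \<theta> K by (intro mult_left_mono enn2real_leI) auto
        also have "\<dots> = C / real n" using K by (simp add: \<theta>_def)
        finally have "c n * \<bar>D n \<omega>\<bar> \<le> c n * (C / real n)" using c[OF n] by (intro mult_left_mono) auto
        then show False using gt c[OF n] by (simp add: abs_mult mult.commute)
      qed
      then have "ennreal (1 / \<theta>) * ennreal \<theta> \<le> ennreal (1 / \<theta>) * total_dev n \<omega>" by (intro mult_left_mono) auto
      moreover have "ennreal (1 / \<theta>) * ennreal \<theta> = 1" using \<theta> by (simp flip: ennreal_mult)
      ultimately show "1 \<le> ennreal (1 / \<theta>) * total_dev n \<omega>" by simp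
    qed
    have "emeasure M {\<omega>\<in>space M. \<bar>c n * D n \<omega>\<bar> > C * (c n / real n)} \<le> emeasure M {\<omega>\<in>space M. 1 \<le> ennreal (1 / \<theta>) * total_dev n \<omega>}"
      by (rule emeasure_mono[OF sub]) measurable
    also have "\<dots> \<le> ennreal (1 / \<theta>) * (\<integral>\<^sup>+\<omega>. total_dev n \<omega> * indicator (space M) \<omega> \<partial>M)"
      by (rule nn_integral_Markov_inequality) auto
    also have "(\<integral>\<^sup>+\<omega>. total_dev n \<omega> * indicator (space M) \<omega> \<partial>M) = (\<integral>\<^sup>+\<omega>. total_dev n \<omega> \<partial>M)"
      by (intro nn_integral_cong) simp
    also have "ennreal (1 / \<theta>) * (\<integral>\<^sup>+\<omega>. total_dev n \<omega> \<partial>M) \<le> ennreal (1 / \<theta>) * ennreal (total_dev_const / real n)"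
      by (intro mult_left_mono total_dev_expectation n) simp
    also have "\<dots> = ennreal (1 / \<theta> * (total_dev_const / real n))"
      using \<theta> total_dev_const_nonneg by (intro ennreal_mult[symmetric]) auto
    also have "\<dots> \<le> ennreal \<epsilon>"
    proof (rule ennreal_leI)
      have "1 / \<theta> * (total_dev_const / real n) = \<epsilon> * (total_dev_const / (total_dev_const + 1))"
      proof -
        have "total_dev_const + 1 \<noteq> 0" using total_dev_const_nonneg by simp
        then show ?thesis using n K \<epsilon> by (simp add: \<theta>_def C_def)
      qed
      also have "\<dots> \<le> \<epsilon> * 1"
        using \<epsilon> total_dev_const_nonneg by (intro mult_left_mono) (auto simp: divide_le_eq_1)
      finally show "1 / \<theta> * (total_dev_const / real n) \<le> \<epsilon>" by simp
    qed
    finally show ?case using \<epsilon> by (simp add: emeasure_eq_measure)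
  qed
  then show "\<exists>C>0. \<forall>\<^sub>F n in sequentially. prob {\<omega>\<in>space M. \<bar>c n * D n \<omega>\<bar> > C * (c n / real n)} \<le> \<epsilon>"
    using C by blast
qed

end

section \<open>Empirical eigenvalues and eigenfunctions\<close>

locale empirical_eigenvalue = isolated_eigenvalue +
  fixes lamh :: "nat \<Rightarrow> 'a \<Rightarrow> nat \<Rightarrow> real" and gamh :: "nat \<Rightarrow> 'a \<Rightarrow> nat \<Rightarrow> real \<Rightarrow> real"
  assumes emp_eigen: "\<And>n \<omega>. n \<ge> 1 \<Longrightarrow> \<omega> \<in> space M \<Longrightarrow>
        eigensystem (emp_cov X n \<omega>) (lamh n \<omega>) (gamh n \<omega>)"
    and emp_random: "\<And>n. n \<ge> 1 \<Longrightarrow> random_function M (\<lambda>\<omega>. gamh n \<omega> (Suc r))"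
    and emp_sign: "\<And>n \<omega>. n \<ge> 1 \<Longrightarrow> \<omega> \<in> space M \<Longrightarrow> ip (e r) (gamh n \<omega> (Suc r)) \<ge> 0"
begin

definition S :: "nat \<Rightarrow> 'a \<Rightarrow> real \<Rightarrow> real" where
  "S n \<omega> t = (1 / real n) * (\<Sum>i=1..n. W i \<omega> t)"

text \<open>As a plain difference it makes the decomposition hold at every sample point and
  argument; only its size has to be proved.\<close>

definition R :: "nat \<Rightarrow> 'a \<Rightarrow> real \<Rightarrow> real" where
  "R n \<omega> t = gamh n \<omega> (Suc r) t - e r t - S n \<omega> t"

lemma gamh_L2: "1 \<le> n \<Longrightarrow> \<omega> \<in> space M \<Longrightarrow> gamh n \<omega> (Suc r) \<in> L2"
  and gamh_joint: "1 \<le> n \<Longrightarrow> (\<lambda>(\<omega>, t). gamh n \<omega> (Suc r) t) \<in> borel_measurable (M \<Otimes>\<^sub>M unit_leb)"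
  using emp_random by (auto simp: random_function_def)

lemma S_L2: "\<omega> \<in> space M \<Longrightarrow> S n \<omega> \<in> L2"
  unfolding S_def by (intro L2_cmult L2_sum W_L2) auto

lemma S_joint: "(\<lambda>(\<omega>, t). S n \<omega> t) \<in> borel_measurable (M \<Otimes>\<^sub>M unit_leb)"
proof -
  have "(\<lambda>x. (1 / real n) * (\<Sum>i=1..n. (\<lambda>(\<omega>, t). W i \<omega> t) x)) \<in> borel_measurable (M \<Otimes>\<^sub>M unit_leb)"
    by (intro borel_measurable_times borel_measurable_const borel_measurable_sum W_joint) simp
  then show ?thesis by (simp add: S_def split_beta')
qed

lemma R_L2: "1 \<le> n \<Longrightarrow> \<omega> \<in> space M \<Longrightarrow> R n \<omega> \<in> L2"
  unfolding R_def by (intro L2_diff gamh_L2 basis.basis_L2 S_L2)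

lemma R_joint: "1 \<le> n \<Longrightarrow> (\<lambda>(\<omega>, t). R n \<omega> t) \<in> borel_measurable (M \<Otimes>\<^sub>M unit_leb)"
proof -
  assume n: "1 \<le> n"
  note [measurable] = gamh_joint[OF n] S_joint[of n]
  show ?thesis unfolding R_def by measurable
qed

lemma S_random: "random_function M (S n)"
  and R_random: "1 \<le> n \<Longrightarrow> random_function M (R n)"
  using S_joint S_L2 R_joint R_L2 by (simp_all add: random_function_def)

text \<open>The coefficients take the form that \<open>sample_eigen_expansion\<close> demands of its
  remainder.\<close>

lemma ip_R:
  assumes n: "1 \<le> n" and \<omega>: "\<omega> \<in> space M"
  shows "ip (R n \<omega>) (e s) = ip (gamh n \<omega> (Suc r)) (e s) -
    (if s = r then 1 else (1 / real n) * (\<Sum>i=1..n. b s i \<omega> * b r i \<omega>) / (l r - l s))"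
proof -
  have "ip (S n \<omega>) (e s) = (1 / real n) * (\<Sum>i=1..n. ip (W i \<omega>) (e s))"
    unfolding S_def ip_cmult_left by (subst ip_sum_left) (auto intro: W_L2 \<omega> basis.basis_L2)
  also have "\<dots> = (if s = r then 0 else (1 / real n) * (\<Sum>i=1..n. b s i \<omega> * b r i \<omega>) / (l r - l s))"
    by (simp add: ip_W[OF _ \<omega>] sum_divide_distrib[symmetric])
  finally have "ip (S n \<omega>) (e s) = (if s = r then 0 else (1 / real n) * (\<Sum>i=1..n. b s i \<omega> * b r i \<omega>) / (l r - l s))" .
  moreover have "ip (R n \<omega>) (e s) = ip (gamh n \<omega> (Suc r)) (e s) - ip (e r) (e s) - ip (S n \<omega>) (e s)"
    unfolding R_def using n \<omega> by (simp add: ip_diff_left gamh_L2 basis.basis_L2 S_L2 L2_diff)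
  ultimately show ?thesis by (simp add: basis.orthonormal)
qed

lemma empirical_bounds:
  assumes n: "1 \<le> n" and \<omega>: "\<omega> \<in> space M" and small: "total_dev n \<omega> \<le> ennreal (min 1 (g\<^sup>2 / 32))"
  shows "\<bar>lamh n \<omega> (Suc r) - (1 / real n) * (\<Sum>i=1..n. b r i \<omega> * b r i \<omega>)\<bar> \<le> (8 / g + 1) * enn2real (total_dev n \<omega>)"
    "ip (R n \<omega>) (R n \<omega>) \<le> (704 / g^4 + 2 / g\<^sup>2) * (enn2real (total_dev n \<omega>))\<^sup>2"
proof -
  \<comment> \<open>Excludes the value infinity, so that the conversion to a real number is
    exact.\<close>
  have fin: "total_dev n \<omega> \<noteq> top" using small by (metis ennreal_neq_top neq_top_trans)
  have \<tau>: "enn2real (total_dev n \<omega>) \<le> min 1 (g\<^sup>2 / 32)" using small by (intro enn2real_leI) auto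
  have sm: "(\<Sum>q. \<Sum>p. ennreal (((1 / real n) * (\<Sum>i=1..n. ip (Y i \<omega>) (e p) * ip (Y i \<omega>) (e q)) - (if p = q then l p else 0))\<^sup>2)) +
        (\<Sum>p. ennreal (((1 / real n) * (\<Sum>i=1..n. ip (Y i \<omega>) (e p)))\<^sup>2)) \<le> ennreal (enn2real (total_dev n \<omega>))"
    using fin unfolding ennreal_enn2real_if by (simp add: total_dev_def cov_dev_def mean_dev_def b_def)
  note * = sample_eigen_expansion[OF basis n Y_L2[OF _ \<omega>] emp_eigen[OF n \<omega>] emp_cov_eq[OF n] l_antimono l_nonneg
      gap g_pos emp_sign[OF n \<omega>] sm enn2real_nonneg _ _ R_L2[OF n \<omega>] ip_R[OF n \<omega>, unfolded b_def]]
  show "\<bar>lamh n \<omega> (Suc r) - (1 / real n) * (\<Sum>i=1..n. b r i \<omega> * b r i \<omega>)\<bar> \<le> (8 / g + 1) * enn2real (total_dev n \<omega>)"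
    unfolding b_def by (rule *(1)) (use \<tau> in auto)
  show "ip (R n \<omega>) (R n \<omega>) \<le> (704 / g^4 + 2 / g\<^sup>2) * (enn2real (total_dev n \<omega>))\<^sup>2"
    by (rule *(2)) (use \<tau> in auto)
qed

lemma threshold_pos: "0 < min 1 (g\<^sup>2 / 32)"
  using g_pos by simp

lemma remainder_big_Op: "big_Op M (\<lambda>n \<omega>. l2norm (R n \<omega>)) (\<lambda>n. 1 / real n)"
proof -
  define K where "K = sqrt (704 / g^4 + 2 / g\<^sup>2)"
  have K: "0 < K" unfolding K_def using g_pos by (simp add: add_pos_pos)
  have "big_Op M (\<lambda>n \<omega>. 1 * l2norm (R n \<omega>)) (\<lambda>n. 1 / real n)"
  proof (rule big_Op_of_total_dev_bound[OF _ threshold_pos K])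
    show "(\<lambda>\<omega>. l2norm (R n \<omega>)) \<in> borel_measurable M" if "1 \<le> n" for n
    proof -
      note [measurable] = R_joint[OF that]
      show ?thesis unfolding l2norm_def ip_def by measurable
    qed
    fix n \<omega> assume n: "1 \<le> n" and \<omega>: "\<omega> \<in> space M" and small: "total_dev n \<omega> \<le> ennreal (min 1 (g\<^sup>2 / 32))"
    have "l2norm (R n \<omega>) \<le> sqrt ((704 / g^4 + 2 / g\<^sup>2) * (enn2real (total_dev n \<omega>))\<^sup>2)"
      unfolding l2norm_def by (rule real_sqrt_le_mono[OF empirical_bounds(2)[OF n \<omega> small]])
    also have "\<dots> = K * enn2real (total_dev n \<omega>)" by (simp add: K_def real_sqrt_mult)
    finally show "\<bar>l2norm (R n \<omega>)\<bar> \<le> K * enn2real (total_dev n \<omega>)"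
      by (simp add: l2norm_def ip_nonneg)
  qed simp
  then show ?thesis by simp
qed

text \<open>Measurability is given for the eigenfunction; the eigenvalue is recovered from it as the
  value of the empirical quadratic form at a unit vector.\<close>

lemma lamh_measurable:
  assumes n: "1 \<le> n"
  shows "(\<lambda>\<omega>. lamh n \<omega> (Suc r)) \<in> borel_measurable M"
proof -
  define Yc where "Yc i \<omega> t = Y i \<omega> t - (1 / real n) * (\<Sum>j=1..n. Y j \<omega> t)" for i \<omega> t
  have "lamh n \<omega> (Suc r) = (1 / real n) * (\<Sum>i=1..n. (ip (Yc i \<omega>) (gamh n \<omega> (Suc r)))\<^sup>2)" if \<omega>: "\<omega> \<in> space M" for \<omega>
  proof -
    have "Yc i \<omega> \<in> L2" if "i \<in> {1..n}" for i
      unfolding Yc_def using that by (intro L2_diff L2_cmult L2_sum Y_L2 \<omega>) auto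
    then interpret finite_rank "\<lambda>i. Yc i \<omega>" "{1..n}" "1 / real n"
      by unfold_locales auto
    have k: "emp_cov X n \<omega> t s = (1 / real n) * (\<Sum>i=1..n. Yc i \<omega> t * Yc i \<omega> s)" for t s
      unfolding Yc_def by (rule emp_cov_eq[OF n])
    have G: "gamh n \<omega> (Suc r) \<in> L2" "ip (gamh n \<omega> (Suc r)) (gamh n \<omega> (Suc r)) = 1"
      using emp_eigen[OF n \<omega>] by (auto simp: eigensystem_def eigenfunction_def)
    have "cov_op (gamh n \<omega> (Suc r)) t = lamh n \<omega> (Suc r) * gamh n \<omega> (Suc r) t" if "t \<in> {0..1}" for t
      using int_op_eq_cov_op[OF G(1) k, of t] emp_eigen[OF n \<omega>] that by (auto simp: eigensystem_def eigenfunction_def)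
    then have "ip (cov_op (gamh n \<omega> (Suc r))) (gamh n \<omega> (Suc r)) = ip (\<lambda>t. lamh n \<omega> (Suc r) * gamh n \<omega> (Suc r) t) (gamh n \<omega> (Suc r))"
      unfolding ip_def by (intro Bochner_Integration.integral_cong) auto
    then show ?thesis unfolding ip_cov_op[OF G(1)] cov_form_self ip_cmult_left G(2) by simp
  qed
  moreover have "(\<lambda>\<omega>. (1 / real n) * (\<Sum>i=1..n. (ip (Yc i \<omega>) (gamh n \<omega> (Suc r)))\<^sup>2)) \<in> borel_measurable M"
  proof (intro borel_measurable_times borel_measurable_const borel_measurable_sum borel_measurable_power)
    fix i assume i: "i \<in> {1..n}"
    have "(\<lambda>x. (\<lambda>(\<omega>, t). Y i \<omega> t) x - (1 / real n) * (\<Sum>j=1..n. (\<lambda>(\<omega>, t). Y j \<omega> t) x)) \<in> borel_measurable (M \<Otimes>\<^sub>M unit_leb)"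
      using i by (intro borel_measurable_diff borel_measurable_times borel_measurable_const borel_measurable_sum Y_joint) auto
    then have [measurable]: "(\<lambda>(\<omega>, t). Yc i \<omega> t) \<in> borel_measurable (M \<Otimes>\<^sub>M unit_leb)"
      by (simp add: Yc_def split_beta')
    note [measurable] = gamh_joint[OF n]
    show "(\<lambda>\<omega>. ip (Yc i \<omega>) (gamh n \<omega> (Suc r))) \<in> borel_measurable M" unfolding ip_def by measurable
  qed
  ultimately show ?thesis by (subst measurable_cong) auto
qed

lemma eigenvalue_expansion:
  "big_Op M (\<lambda>n \<omega>. sqrt (real n) * (lamh n \<omega> (Suc r) - l r) - (1 / sqrt (real n)) * (\<Sum>i=1..n. (b r i \<omega>)\<^sup>2 - l r))
     (\<lambda>n. 1 / sqrt (real n))"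
proof -
  define D where "D n \<omega> = lamh n \<omega> (Suc r) - (1 / real n) * (\<Sum>i=1..n. b r i \<omega> * b r i \<omega>)" for n \<omega>
  have "big_Op M (\<lambda>n \<omega>. sqrt (real n) * D n \<omega>) (\<lambda>n. sqrt (real n) / real n)"
  proof (rule big_Op_of_total_dev_bound[OF _ threshold_pos])
    show "0 < 8 / g + 1" using g_pos by (simp add: add_pos_pos)
    show "D n \<in> borel_measurable M" if "1 \<le> n" for n
      unfolding D_def[abs_def]
      by (intro borel_measurable_diff lamh_measurable that borel_measurable_times borel_measurable_const
          borel_measurable_sum b_measurable) auto
    show "\<bar>D n \<omega>\<bar> \<le> (8 / g + 1) * enn2real (total_dev n \<omega>)"
      if "1 \<le> n" "\<omega> \<in> space M" "total_dev n \<omega> \<le> ennreal (min 1 (g\<^sup>2 / 32))" for n \<omega>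
      unfolding D_def by (rule empirical_bounds(1)[OF that])
  qed simp
  moreover have "sqrt (real n) * D n \<omega> = sqrt (real n) * (lamh n \<omega> (Suc r) - l r) - (1 / sqrt (real n)) * (\<Sum>i=1..n. (b r i \<omega>)\<^sup>2 - l r)"
    if n: "1 \<le> n" for n \<omega>
  proof -
    have "(1 / sqrt (real n)) * (\<Sum>i=1..n. (b r i \<omega>)\<^sup>2 - l r) = (sqrt (real n) * (1 / real n)) * (\<Sum>i=1..n. (b r i \<omega>)\<^sup>2 - l r)"
      using n by (simp add: real_div_sqrt field_simps)
    also have "\<dots> = sqrt (real n) * ((1 / real n) * (\<Sum>i=1..n. b r i \<omega> * b r i \<omega>) - l r)"
      using n by (simp add: sum_subtractf power2_eq_square field_simps)
    finally show ?thesis by (simp add: D_def algebra_simps)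
  qed
  moreover have "sqrt (real n) / real n = 1 / sqrt (real n)" for n
    by (cases "n = 0") (simp_all add: real_div_sqrt field_simps)
  ultimately show ?thesis by (rule big_Op_cong)
qed

lemma eigenvalue_conv_in_dist:
  "conv_in_dist M (\<lambda>n \<omega>. sqrt (real n) * (lamh n \<omega> (Suc r) - l r))
     (normal_law 0 (expectation (\<lambda>\<omega>. ((b r 1 \<omega>)\<^sup>2 - l r)\<^sup>2)))"
proof (rule conv_in_dist_Slutsky)
  interpret Z: iid_functional M path_space path "\<lambda>i \<omega>. b r i \<omega> * b r i \<omega> - (if r = r then l r else 0)"
    "\<lambda>x. score_fun r x * score_fun r x - (if r = r then l r else 0)"
    by (rule iid_functional_product)
  show "conv_in_dist M (\<lambda>n \<omega>. (1 / sqrt (real n)) * (\<Sum>i=1..n. (b r i \<omega>)\<^sup>2 - l r)) (normal_law 0 (expectation (\<lambda>\<omega>. ((b r 1 \<omega>)\<^sup>2 - l r)\<^sup>2)))"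
    using Z.scaled_sum_conv_in_dist by (simp add: power2_eq_square)
  show "real_distribution (normal_law 0 (expectation (\<lambda>\<omega>. ((b r 1 \<omega>)\<^sup>2 - l r)\<^sup>2)))"
    by (intro real_distribution_normal_law) simp
  show "(\<lambda>\<omega>. sqrt (real n) * (lamh n \<omega> (Suc r) - l r)) \<in> borel_measurable M" if "1 \<le> n" for n
    by (intro borel_measurable_times borel_measurable_diff borel_measurable_const lamh_measurable that)
  have "(\<lambda>n. 1 / sqrt (real n)) \<longlonglongrightarrow> 0"
    by (intro real_tendsto_divide_at_top[OF tendsto_const] filterlim_compose[OF sqrt_at_top filterlim_real_sequentially])
  then show "(\<lambda>n. prob {\<omega>\<in>space M. \<epsilon> < \<bar>sqrt (real n) * (lamh n \<omega> (Suc r) - l r) - (1 / sqrt (real n)) * (\<Sum>i=1..n. (b r i \<omega>)\<^sup>2 - l r)\<bar>}) \<longlonglongrightarrow> 0"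
    if "0 < \<epsilon>" for \<epsilon>
    by (rule big_Op_null_imp_tendsto[OF eigenvalue_expansion _ that])
qed

lemma eigenvalue_variance_integrable: "integrable M (\<lambda>\<omega>. ((b r 1 \<omega>)\<^sup>2 - l r)\<^sup>2)"
  using iid_functional.square_integrable[OF iid_functional_product[of r r]] by (simp add: power2_eq_square)

section \<open>Series and limit law of the leading term\<close>

lemma S_mean_square:
  assumes t: "t \<in> {0..1}"
  shows "ms_conv M (\<lambda>N \<omega>. \<Sum>s<N. if s = r then 0 else
      ((1 / (real n * (l r - l s))) * (\<Sum>i=1..n. b s i \<omega> * b r i \<omega>)) * e s t) (\<lambda>\<omega>. S n \<omega> t)"
proof -
  have "ms_conv M (\<lambda>N \<omega>. (1 / real n) * (\<Sum>i=1..n. W_partial N i \<omega> t)) (\<lambda>\<omega>. (1 / real n) * (\<Sum>i=1..n. W i \<omega> t))"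
    by (intro ms_conv_lincomb W_partial_sq_int W_partial_mean_square t) auto
  moreover have "(1 / real n) * (\<Sum>i=1..n. W_partial N i \<omega> t)
      = (\<Sum>s<N. if s = r then 0 else ((1 / (real n * (l r - l s))) * (\<Sum>i=1..n. b s i \<omega> * b r i \<omega>)) * e s t)" for N \<omega>
  proof -
    have "(1 / real n) * (\<Sum>i=1..n. W_partial N i \<omega> t) = (\<Sum>s<N. (1 / real n) * (coef t s * (\<Sum>i=1..n. b r i \<omega> * b s i \<omega>)))"
      unfolding W_partial_def by (subst sum.swap) (simp add: sum_distrib_left)
    also have "\<dots> = (\<Sum>s<N. if s = r then 0 else ((1 / (real n * (l r - l s))) * (\<Sum>i=1..n. b s i \<omega> * b r i \<omega>)) * e s t)"
      by (intro sum.cong refl) (simp add: coef_def mult.commute)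
    finally show ?thesis .
  qed
  ultimately show ?thesis by (simp only: S_def)
qed

lemma S_conv_in_dist:
  assumes t: "t \<in> {0..1}"
  shows "conv_in_dist M (\<lambda>n \<omega>. sqrt (real n) * S n \<omega> t)
    (normal_law 0 (\<Sum>\<^sub>\<infinity>(q, s). coef t q * coef t s * expectation (\<lambda>\<omega>. (b r 1 \<omega>)\<^sup>2 * b q 1 \<omega> * b s 1 \<omega>)))"
proof -
  note Z = iid_functional.scaled_sum_conv_in_dist[OF iid_functional_W[OF t], unfolded W_second_moment[OF t]]
  have *: "(\<lambda>n \<omega>. sqrt (real n) * S n \<omega> t) = (\<lambda>n \<omega>. (1 / sqrt (real n)) * (\<Sum>i=1..n. W i \<omega> t))"
  proof (intro ext)
    fix n \<omega>
    have "sqrt (real n) * (1 / real n) = 1 / sqrt (real n)"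
      by (cases "n = 0") (simp_all add: real_div_sqrt field_simps)
    then show "sqrt (real n) * S n \<omega> t = (1 / sqrt (real n)) * (\<Sum>i=1..n. W i \<omega> t)"
      by (simp only: S_def mult.assoc[symmetric])
  qed
  show ?thesis unfolding * by (rule Z)
qed

end

section \<open>Passage between indices from 0 and from 1, and final assembly\<close>

lemma iterated_infsum_Suc_shift:
  fixes f :: "nat \<Rightarrow> nat \<Rightarrow> real" and F :: "nat \<times> nat \<Rightarrow> real"
  assumes F: "F summable_on UNIV"
    and eq: "\<And>q s. q \<noteq> k \<Longrightarrow> s \<noteq> k \<Longrightarrow> F (q, s) = f (Suc q) (Suc s)"
    and zero: "\<And>q s. q = k \<or> s = k \<Longrightarrow> F (q, s) = 0"
  defines "A \<equiv> {1..} - {Suc k}"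
  shows "(\<lambda>(q, s). f q s) summable_on A \<times> A"
    and "(\<Sum>\<^sub>\<infinity>q\<in>A. \<Sum>\<^sub>\<infinity>s\<in>A. f q s) = infsum F UNIV"
proof -
  let ?B = "(UNIV - {k}) \<times> (UNIV - {k})"
  have "bij_betw Suc (UNIV - {k}) A"
    unfolding A_def by (rule bij_betw_byWitness[where f'="\<lambda>n. n - 1"]) auto
  then have bij: "bij_betw (map_prod Suc Suc) ?B (A \<times> A)" by (intro bij_betw_map_prod)
  have cong: "(case map_prod Suc Suc x of (q, s) \<Rightarrow> f q s) = F x" if "x \<in> ?B" for x
    using that eq by (cases x) auto
  have "F summable_on ?B" by (rule summable_on_subset_banach[OF F]) simp
  then have "(\<lambda>x. case map_prod Suc Suc x of (q, s) \<Rightarrow> f q s) summable_on ?B"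
    by (subst summable_on_cong[OF cong])
  then show s: "(\<lambda>(q, s). f q s) summable_on A \<times> A"
    by (rule summable_on_reindex_bij_betw[OF bij, THEN iffD1])
  have "(\<Sum>\<^sub>\<infinity>q\<in>A. \<Sum>\<^sub>\<infinity>s\<in>A. f q s) = (\<Sum>\<^sub>\<infinity>(q, s)\<in>A \<times> A. f q s)"
    by (rule infsum_Sigma'_banach[OF s])
  also have "\<dots> = (\<Sum>\<^sub>\<infinity>x\<in>?B. case map_prod Suc Suc x of (q, s) \<Rightarrow> f q s)"
    by (rule infsum_reindex_bij_betw[OF bij, symmetric])
  also have "\<dots> = infsum F ?B" by (rule infsum_cong[OF cong])
  \<comment> \<open>The row and the column at \<open>k\<close>, missing from the smaller index set,
    contribute 0.\<close>
  also have "\<dots> = infsum F UNIV" by (rule infsum_cong_neutral) (auto simp: zero)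
  finally show "(\<Sum>\<^sub>\<infinity>q\<in>A. \<Sum>\<^sub>\<infinity>s\<in>A. f q s) = infsum F UNIV" .
qed

lemma bij_betw_Suc: "bij_betw Suc UNIV {1..}"
  unfolding bij_betw_def by (auto simp: image_iff Suc_le_eq gr0_conv_Suc)

lemma sum_atLeast1_remove_shift:
  "(\<Sum>s\<in>{1..N} - {Suc k}. f s) = (\<Sum>s<N. if s = k then 0 else f (Suc s))" for f :: "nat \<Rightarrow> real"
proof -
  have "(\<Sum>s\<in>{1..N} - {Suc k}. f s) = (\<Sum>s\<in>{1..N}. if s = Suc k then 0 else f s)"
    by (rule sum.mono_neutral_cong_left) auto
  also have "\<dots> = (\<Sum>s<N. if Suc s = Suc k then 0 else f (Suc s))"
    by (simp only: One_nat_def sum.atLeast1_atMost_eq)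
  finally show ?thesis by simp
qed

theorem theorem2:
  fixes M :: "'a measure"
    and X :: "nat \<Rightarrow> 'a \<Rightarrow> real \<Rightarrow> real"
    and \<mu> :: "real \<Rightarrow> real"
    and \<sigma> :: "real \<Rightarrow> real \<Rightarrow> real"
    and lam :: "nat \<Rightarrow> real"
    and gam :: "nat \<Rightarrow> real \<Rightarrow> real"
    and \<beta> :: "nat \<Rightarrow> nat \<Rightarrow> 'a \<Rightarrow> real"
    and lamh :: "nat \<Rightarrow> 'a \<Rightarrow> nat \<Rightarrow> real"
    and gamh :: "nat \<Rightarrow> 'a \<Rightarrow> nat \<Rightarrow> real \<Rightarrow> real"
  assumes prob: "prob_space M"
    and iid: "iid_random_functions M X"
    and second_moments: "\<And>i t. i \<ge> 1 \<Longrightarrow> t \<in> {0..1} \<Longrightarrow> integrable M (\<lambda>\<omega>. (X i \<omega> t)\<^sup>2)"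
    and mean: "\<And>i t. i \<ge> 1 \<Longrightarrow> t \<in> {0..1} \<Longrightarrow> \<mu> t = (\<integral>\<omega>. X i \<omega> t \<partial>M)"
    and cov: "\<And>i t s. i \<ge> 1 \<Longrightarrow> t \<in> {0..1} \<Longrightarrow> s \<in> {0..1} \<Longrightarrow>
        \<sigma> t s = (\<integral>\<omega>. (X i \<omega> t - \<mu> t) * (X i \<omega> s - \<mu> s) \<partial>M)"
    and cov_cont: "continuous_on ({0..1} \<times> {0..1}) (\<lambda>(t, s). \<sigma> t s)"
    and eigen: "eigensystem \<sigma> lam gam"
    and complete: "complete_system gam"
    and gam_bounded: "\<exists>C. \<forall>s\<ge>1. \<forall>t\<in>{0..1}. \<bar>gam s t\<bar> \<le> C"
    and scores: "\<And>r i \<omega>. \<beta> r i \<omega> = ip (\<lambda>t. X i \<omega> t - \<mu> t) (gam r)"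
    and karhunen_loeve: "\<And>i t. i \<ge> 1 \<Longrightarrow> t \<in> {0..1} \<Longrightarrow>
        ms_conv M (\<lambda>N \<omega>. \<mu> t + (\<Sum>r=1..N. \<beta> r i \<omega> * gam r t)) (\<lambda>\<omega>. X i \<omega> t)"
    and fourth_integrable: "\<And>i r s. i \<ge> 1 \<Longrightarrow> r \<ge> 1 \<Longrightarrow> s \<ge> 1 \<Longrightarrow>
        integrable M (\<lambda>\<omega>. (\<beta> r i \<omega>)\<^sup>2 * (\<beta> s i \<omega>)\<^sup>2)"
    and fourth_summable: "\<And>i. i \<ge> 1 \<Longrightarrow>
        (\<lambda>(r, s). \<integral>\<omega>. (\<beta> r i \<omega>)\<^sup>2 * (\<beta> s i \<omega>)\<^sup>2 \<partial>M) summable_on ({1..} \<times> {1..})"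
    and mixed_summable: "\<And>i r. i \<ge> 1 \<Longrightarrow> r \<ge> 1 \<Longrightarrow>
        (\<lambda>(q, s). \<integral>\<omega>. (\<beta> r i \<omega>)\<^sup>2 * \<beta> q i \<omega> * \<beta> s i \<omega> \<partial>M) summable_on ({1..} \<times> {1..})"
    and emp_eigen: "\<And>n \<omega>. n \<ge> 1 \<Longrightarrow> \<omega> \<in> space M \<Longrightarrow>
        eigensystem (emp_cov X n \<omega>) (lamh n \<omega>) (gamh n \<omega>)"
    and emp_random: "\<And>n r. n \<ge> 1 \<Longrightarrow> r \<ge> 1 \<Longrightarrow> random_function M (\<lambda>\<omega>. gamh n \<omega> r)"
    and emp_sign: "\<And>n \<omega> r. n \<ge> 1 \<Longrightarrow> \<omega> \<in> space M \<Longrightarrow> r \<ge> 1 \<Longrightarrow> ip (gam r) (gamh n \<omega> r) \<ge> 0"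
  shows
    "(\<forall>t\<in>{0..1}.
        (\<forall>n\<ge>1. ms_conv M
           (\<lambda>N \<omega>. \<Sum>r=1..N. ((1 / sqrt (real n)) * (\<Sum>i=1..n. \<beta> r i \<omega>)) * gam r t)
           (\<lambda>\<omega>. sqrt (real n) * (emp_mean X n \<omega> t - \<mu> t))) \<and>
        (\<lambda>r. lam r * (gam r t)\<^sup>2) summable_on {1..} \<and>
        conv_in_dist M (\<lambda>n \<omega>. sqrt (real n) * (emp_mean X n \<omega> t - \<mu> t))
          (normal_law 0 (\<Sum>\<^sub>\<infinity>r\<in>{1..}. lam r * (gam r t)\<^sup>2)))
     \<and>
     (\<forall>r\<ge>1. (r = 1 \<or> lam (r - 1) > lam r) \<and> lam r > lam (r + 1) \<longrightarrow>
        big_Op M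
          (\<lambda>n \<omega>. sqrt (real n) * (lamh n \<omega> r - lam r)
                 - (1 / sqrt (real n)) * (\<Sum>i=1..n. (\<beta> r i \<omega>)\<^sup>2 - lam r))
          (\<lambda>n. 1 / sqrt (real n)) \<and>
        integrable M (\<lambda>\<omega>. ((\<beta> r 1 \<omega>)\<^sup>2 - lam r)\<^sup>2) \<and>
        conv_in_dist M (\<lambda>n \<omega>. sqrt (real n) * (lamh n \<omega> r - lam r))
          (normal_law 0 (\<integral>\<omega>. ((\<beta> r 1 \<omega>)\<^sup>2 - lam r)\<^sup>2 \<partial>M)) \<and>
        (\<exists>S R.
           (\<forall>n\<ge>1. random_function M (S n) \<and> random_function M (R n)) \<and>
           (\<forall>n\<ge>1. \<forall>t\<in>{0..1}. ms_conv M
              (\<lambda>N \<omega>. \<Sum>s\<in>{1..N} - {r}.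
                 ((1 / (real n * (lam r - lam s))) * (\<Sum>i=1..n. \<beta> s i \<omega> * \<beta> r i \<omega>)) * gam s t)
              (\<lambda>\<omega>. S n \<omega> t)) \<and>
           (\<forall>n\<ge>1. \<forall>\<omega>\<in>space M. \<forall>t\<in>{0..1}. gamh n \<omega> r t - gam r t = S n \<omega> t + R n \<omega> t) \<and>
           big_Op M (\<lambda>n \<omega>. l2norm (R n \<omega>)) (\<lambda>n. 1 / real n) \<and>
           (\<forall>t\<in>{0..1}.
              (\<lambda>(q, s). (\<integral>\<omega>. (\<beta> r 1 \<omega>)\<^sup>2 * \<beta> q 1 \<omega> * \<beta> s 1 \<omega> \<partial>M)
                  / ((lam q - lam r) * (lam s - lam r)) * gam q t * gam s t)
                summable_on (({1..} - {r}) \<times> ({1..} - {r})) \<and>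
              conv_in_dist M (\<lambda>n \<omega>. sqrt (real n) * S n \<omega> t)
                (normal_law 0
                   (\<Sum>\<^sub>\<infinity>q\<in>{1..} - {r}. \<Sum>\<^sub>\<infinity>s\<in>{1..} - {r}.
                      (\<integral>\<omega>. (\<beta> r 1 \<omega>)\<^sup>2 * \<beta> q 1 \<omega> * \<beta> s 1 \<omega> \<partial>M)
                      / ((lam q - lam r) * (lam s - lam r)) * gam q t * gam s t)))))"
proof -
  define l where "l s = lam (Suc s)" for s
  define e where "e s = gam (Suc s)" for s
  interpret M: prob_space M by (rule prob)
  have gam: "eigenfunction \<sigma> (lam r) (gam r)" "ip (gam r) (gam s) = (if r = s then 1 else 0)"
    if "1 \<le> r" "1 \<le> s" for r s
    using eigen that by (auto simp: eigensystem_def)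
  interpret F: functional_sample M X \<mu> \<sigma> l e
  proof (intro functional_sample.intro functional_sample_axioms.intro)
    show "orthonormal_basis e"
    proof
      show "e s \<in> L2" "ip (e r) (e s) = (if r = s then 1 else 0)" for r s
        using gam[of "Suc _" "Suc _"] by (auto simp: e_def eigenfunction_def)
      fix v assume v: "v \<in> L2" "\<And>s. ip v (e s) = 0"
      have "ip v (gam r) = 0" if "1 \<le> r" for r
        using v(2)[of "r - 1"] that by (simp add: e_def)
      then show "AE t in unit_leb. v t = 0" using complete v(1) by (auto simp: complete_system_def)
    qed
    show "int_op \<sigma> (e s) t = l s * e s t" if "t \<in> {0..1}" for s t
      using gam(1)[of "Suc s" 1] that by (auto simp: e_def l_def eigenfunction_def)
    show "l q \<le> l p" if "p \<le> q" for p q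
      unfolding l_def using eigensystem_antimono[OF eigen, of "Suc p" "Suc q"] that by simp
    show "\<exists>C. \<forall>s. \<forall>t\<in>{0..1}. \<bar>e s t\<bar> \<le> C" using gam_bounded by (force simp: e_def)
  qed (fact prob iid second_moments mean cov cov_cont)+
  have b: "F.b s i \<omega> = \<beta> (Suc s) i \<omega>" for s i \<omega>
    by (simp add: F.b_def F.Y_def[abs_def] scores e_def)
  have bij2: "bij_betw (map_prod Suc Suc) UNIV ({1..} \<times> {1..})"
    using bij_betw_map_prod[OF bij_betw_Suc bij_betw_Suc] by simp
  interpret F: functional_sample_moments M X \<mu> \<sigma> l e
  proof
    show "(\<lambda>N. M.expectation (\<lambda>\<omega>. ((\<Sum>s<N. F.b s i \<omega> * e s t) - F.Y i \<omega> t)\<^sup>2)) \<longlonglongrightarrow> 0"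
      if "1 \<le> i" "t \<in> {0..1}" for i t
    proof -
      have "\<mu> t + (\<Sum>r=1..N. \<beta> r i \<omega> * gam r t) - X i \<omega> t = (\<Sum>s<N. F.b s i \<omega> * e s t) - F.Y i \<omega> t" for N \<omega>
        by (simp add: sum.atLeast1_atMost_eq b e_def F.Y_def)
      then show ?thesis using karhunen_loeve[OF that] by (simp add: ms_conv_def)
    qed
    show "integrable M (\<lambda>\<omega>. (F.b p i \<omega>)\<^sup>2 * (F.b q i \<omega>)\<^sup>2)" if "1 \<le> i" for i p q
      unfolding b by (rule fourth_integrable) (use that in auto)
    show "(\<lambda>(p, q). M.expectation (\<lambda>\<omega>. (F.b p 1 \<omega>)\<^sup>2 * (F.b q 1 \<omega>)\<^sup>2)) summable_on UNIV"
      using summable_on_reindex_bij_betw[OF bij2, THEN iffD2, OF fourth_summable[OF order_refl]]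
      by (simp add: b map_prod_def split_beta')
    show "(\<lambda>(q, s). M.expectation (\<lambda>\<omega>. (F.b r i \<omega>)\<^sup>2 * F.b q i \<omega> * F.b s i \<omega>)) summable_on UNIV" if "1 \<le> i" for i r
      using summable_on_reindex_bij_betw[OF bij2, THEN iffD2, OF mixed_summable[OF that, of "Suc r"]]
      by (simp add: b map_prod_def split_beta')
  qed
  show ?thesis
  proof (rule conjI, goal_cases)
    case 1
    show ?case
    proof (rule ballI, goal_cases)
      case (1 t)
      have "((\<lambda>s. l s * (e s t)\<^sup>2) has_sum \<sigma> t t) UNIV"
        by (rule sums_nonneg_imp_has_sum[OF F.variance_expansion[OF 1]]) (simp add: F.l_nonneg)
      then have var: "((\<lambda>r. lam r * (gam r t)\<^sup>2) has_sum \<sigma> t t) {1..}"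
        using has_sum_reindex_bij_betw[OF bij_betw_Suc, of "\<lambda>r. lam r * (gam r t)\<^sup>2"] by (simp add: l_def e_def)
      show ?case
      proof (intro conjI allI impI)
        show "ms_conv M (\<lambda>N \<omega>. \<Sum>r=1..N. ((1 / sqrt (real n)) * (\<Sum>i=1..n. \<beta> r i \<omega>)) * gam r t)
           (\<lambda>\<omega>. sqrt (real n) * (emp_mean X n \<omega> t - \<mu> t))" if "1 \<le> n" for n
          using F.mean_expansion[OF that 1] by (simp add: sum.atLeast1_atMost_eq b e_def)
        show "(\<lambda>r. lam r * (gam r t)\<^sup>2) summable_on {1..}" using var by (rule has_sum_imp_summable)
        show "conv_in_dist M (\<lambda>n \<omega>. sqrt (real n) * (emp_mean X n \<omega> t - \<mu> t))
          (normal_law 0 (\<Sum>\<^sub>\<infinity>r\<in>{1..}. lam r * (gam r t)\<^sup>2))"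
          unfolding infsumI[OF var] by (rule F.mean_conv_in_dist[OF 1])
      qed
    qed
  next
    case 2
    show ?case
    proof (intro allI impI, goal_cases)
      case (1 r)
      define k where "k = r - 1"
      have r: "r = Suc k" using 1(1) by (simp add: k_def)
      \<comment> \<open>The distance of \<open>l k\<close> to its nearer neighbour in the ordered
        list; at \<open>k = 0\<close> there is no upper neighbour. Monotonicity extends the bound to
        all other indices.\<close>
      define g where "g = (if k = 0 then l k - l (Suc k) else min (l k - l (Suc k)) (l (k - 1) - l k))"
      have step: "l (Suc k) < l k" "k \<noteq> 0 \<Longrightarrow> l k < l (k - 1)"
        using 1(2) by (auto simp: l_def r)
      have gap: "g \<le> \<bar>l k - l s\<bar>" if "s \<noteq> k" for s
      proof (cases "s < k")
        case True
        then have "l (k - 1) \<le> l s" by (intro F.l_antimono) simp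
        moreover have "g \<le> l (k - 1) - l k" using True by (simp add: g_def)
        ultimately show ?thesis by linarith
      next
        case False
        then have "l s \<le> l (Suc k)" using that by (intro F.l_antimono) simp
        moreover have "g \<le> l k - l (Suc k)" by (simp add: g_def)
        ultimately show ?thesis by linarith
      qed
      interpret E: empirical_eigenvalue M X \<mu> \<sigma> l e k g lamh gamh
      proof
        show "g \<le> \<bar>l k - l s\<bar>" if "s \<noteq> k" for s by (rule gap[OF that])
        show "0 < g" using step by (cases "k = 0") (simp_all add: g_def)
        \<comment> \<open>Strictly above the next eigenvalue, which is nonnegative.\<close>
        show "0 < l k" using step(1) F.l_nonneg[of "Suc k"] by simp
        show "0 \<le> ip (e k) (gamh n \<omega> (Suc k))" if "1 \<le> n" "\<omega> \<in> space M" for n \<omega>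
          unfolding e_def using emp_sign[OF that, of "Suc k"] by simp
        show "random_function M (\<lambda>\<omega>. gamh n \<omega> (Suc k))" if "1 \<le> n" for n
          using emp_random[OF that, of "Suc k"] by simp
      qed (fact emp_eigen)
      have br: "\<beta> r i \<omega> = F.b k i \<omega>" for i \<omega> by (simp add: b r)
      have lr: "lam r = l k" by (simp add: l_def r)
      let ?a = "\<lambda>q s. \<integral>\<omega>. (\<beta> r 1 \<omega>)\<^sup>2 * \<beta> q 1 \<omega> * \<beta> s 1 \<omega> \<partial>M"
      let ?f = "\<lambda>t q s. ?a q s / ((lam q - lam r) * (lam s - lam r)) * gam q t * gam s t"
      have shift: "(\<lambda>(q, s). ?f t q s) summable_on (({1..} - {r}) \<times> ({1..} - {r}))"
        "(\<Sum>\<^sub>\<infinity>q\<in>{1..} - {r}. \<Sum>\<^sub>\<infinity>s\<in>{1..} - {r}. ?f t q s)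
          = (\<Sum>\<^sub>\<infinity>(q, s). E.coef t q * E.coef t s * M.expectation (\<lambda>\<omega>. (F.b k 1 \<omega>)\<^sup>2 * F.b q 1 \<omega> * F.b s 1 \<omega>))"
        if t: "t \<in> {0..1}" for t
      proof -
        have eq: "(case (q, s) of (q, s) \<Rightarrow> E.coef t q * E.coef t s * M.expectation (\<lambda>\<omega>. (F.b k 1 \<omega>)\<^sup>2 * F.b q 1 \<omega> * F.b s 1 \<omega>))
            = ?f t (Suc q) (Suc s)" if "q \<noteq> k" "s \<noteq> k" for q s
        proof -
          \<comment> \<open>The variance is stated with \<open>lam q - lam r\<close> but
            \<open>coef\<close> divides by the opposite difference; the two sign changes
            cancel.\<close>
          have "(lam (Suc q) - lam r) * (lam (Suc s) - lam r) = (l k - l q) * (l k - l s)"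
            by (simp add: l_def r algebra_simps)
          then show ?thesis using that by (simp add: E.coef_def br b e_def mult_ac)
        qed
        have zero: "(case (q, s) of (q, s) \<Rightarrow> E.coef t q * E.coef t s * M.expectation (\<lambda>\<omega>. (F.b k 1 \<omega>)\<^sup>2 * F.b q 1 \<omega> * F.b s 1 \<omega>)) = 0"
          if "q = k \<or> s = k" for q s
          using that by (auto simp: E.coef_def)
        note shift' = iterated_infsum_Suc_shift[where f="?f t" and k=k, folded r, OF E.coef_mixed_summable[OF t]]
        show "(\<lambda>(q, s). ?f t q s) summable_on (({1..} - {r}) \<times> ({1..} - {r}))" by (rule shift'(1)) (fact eq, fact zero)
        show "(\<Sum>\<^sub>\<infinity>q\<in>{1..} - {r}. \<Sum>\<^sub>\<infinity>s\<in>{1..} - {r}. ?f t q s)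
          = (\<Sum>\<^sub>\<infinity>(q, s). E.coef t q * E.coef t s * M.expectation (\<lambda>\<omega>. (F.b k 1 \<omega>)\<^sup>2 * F.b q 1 \<omega> * F.b s 1 \<omega>))"
          by (rule shift'(2)) (fact eq, fact zero)
      qed
      show ?case
      proof (intro conjI)
        show "big_Op M
          (\<lambda>n \<omega>. sqrt (real n) * (lamh n \<omega> r - lam r)
                 - (1 / sqrt (real n)) * (\<Sum>i=1..n. (\<beta> r i \<omega>)\<^sup>2 - lam r))
          (\<lambda>n. 1 / sqrt (real n))"
          using E.eigenvalue_expansion unfolding br lr unfolding r .
        show "integrable M (\<lambda>\<omega>. ((\<beta> r 1 \<omega>)\<^sup>2 - lam r)\<^sup>2)"
          using E.eigenvalue_variance_integrable unfolding br lr .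
        show "conv_in_dist M (\<lambda>n \<omega>. sqrt (real n) * (lamh n \<omega> r - lam r))
          (normal_law 0 (\<integral>\<omega>. ((\<beta> r 1 \<omega>)\<^sup>2 - lam r)\<^sup>2 \<partial>M))"
          using E.eigenvalue_conv_in_dist unfolding br lr unfolding r .
        show "\<exists>S R.
           (\<forall>n\<ge>1. random_function M (S n) \<and> random_function M (R n)) \<and>
           (\<forall>n\<ge>1. \<forall>t\<in>{0..1}. ms_conv M
              (\<lambda>N \<omega>. \<Sum>s\<in>{1..N} - {r}.
                 ((1 / (real n * (lam r - lam s))) * (\<Sum>i=1..n. \<beta> s i \<omega> * \<beta> r i \<omega>)) * gam s t)
              (\<lambda>\<omega>. S n \<omega> t)) \<and>
           (\<forall>n\<ge>1. \<forall>\<omega>\<in>space M. \<forall>t\<in>{0..1}. gamh n \<omega> r t - gam r t = S n \<omega> t + R n \<omega> t) \<and>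
           big_Op M (\<lambda>n \<omega>. l2norm (R n \<omega>)) (\<lambda>n. 1 / real n) \<and>
           (\<forall>t\<in>{0..1}.
              (\<lambda>(q, s). (\<integral>\<omega>. (\<beta> r 1 \<omega>)\<^sup>2 * \<beta> q 1 \<omega> * \<beta> s 1 \<omega> \<partial>M)
                  / ((lam q - lam r) * (lam s - lam r)) * gam q t * gam s t)
                summable_on (({1..} - {r}) \<times> ({1..} - {r})) \<and>
              conv_in_dist M (\<lambda>n \<omega>. sqrt (real n) * S n \<omega> t)
                (normal_law 0
                   (\<Sum>\<^sub>\<infinity>q\<in>{1..} - {r}. \<Sum>\<^sub>\<infinity>s\<in>{1..} - {r}.
                      (\<integral>\<omega>. (\<beta> r 1 \<omega>)\<^sup>2 * \<beta> q 1 \<omega> * \<beta> s 1 \<omega> \<partial>M)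
                      / ((lam q - lam r) * (lam s - lam r)) * gam q t * gam s t)))"
        proof (rule exI[of _ E.S], rule exI[of _ E.R], intro conjI allI ballI impI)
          show "random_function M (E.S n)" for n by (rule E.S_random)
          show "random_function M (E.R n)" if "1 \<le> n" for n by (rule E.R_random[OF that])
          show "ms_conv M (\<lambda>N \<omega>. \<Sum>s\<in>{1..N} - {r}.
                 ((1 / (real n * (lam r - lam s))) * (\<Sum>i=1..n. \<beta> s i \<omega> * \<beta> r i \<omega>)) * gam s t)
              (\<lambda>\<omega>. E.S n \<omega> t)" if "t \<in> {0..1}" for n t
            unfolding r sum_atLeast1_remove_shift
            using E.S_mean_square[OF that, of n] unfolding b l_def[symmetric] e_def[symmetric] .
          show "gamh n \<omega> r t - gam r t = E.S n \<omega> t + E.R n \<omega> t" for n \<omega> t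
            by (simp add: E.R_def r e_def)
          show "big_Op M (\<lambda>n \<omega>. l2norm (E.R n \<omega>)) (\<lambda>n. 1 / real n)" by (rule E.remainder_big_Op)
          show "(\<lambda>(q, s). ?f t q s) summable_on (({1..} - {r}) \<times> ({1..} - {r}))" if "t \<in> {0..1}" for t
            by (rule shift(1)[OF that])
          show "conv_in_dist M (\<lambda>n \<omega>. sqrt (real n) * E.S n \<omega> t)
                (normal_law 0 (\<Sum>\<^sub>\<infinity>q\<in>{1..} - {r}. \<Sum>\<^sub>\<infinity>s\<in>{1..} - {r}. ?f t q s))" if "t \<in> {0..1}" for t
            unfolding shift(2)[OF that] by (rule E.S_conv_in_dist[OF that])
        qed
      qed
    qed
  qed
qed

end
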